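(* Let $\mathbf{L}$ be a finite-dimensional associative algebra over a field $\mathbf{K}$ of characteristic $0$, and let $\mathbf{R}$ be the associated unital associative algebra with basis $\hat E,\hat H_\mu,\hat X^\nu$. Put $$\Phi^{1,1}=\hat E\otimes\hat E-\hat X^\nu\otimes\hat H_\nu\in\mathbf{R}^{\otimes2}.$$ Let $\Phi\in T(\mathbf{R})\otimes T(\mathbf{R})$ be the twisting cocycle expanding $\Phi^{1,1}$, i.e. the unique invertible normalized solution of the twisting equation $(\Delta\otimes \mathrm{id})(\Phi)\Phi_{12}=(\mathrm{id}\otimes\Delta)(\Phi)\Phi_{23}$ such that for all $k\ge1$ $$(\pi^1\otimes\pi^k)(\Phi)=\Phi^{1,1}_{12}\,\Phi^{1,1}_{13}\cdots\Phi^{1,1}_{1\,(k+1)}\in\mathbf{R}\otimes\mathbf{R}^{\otimes k}.$$ Then $\Phi$ belongs to $U(\mathbf{L}^* )\otimes U(\mathbf{L})$ and has the form $$\Phi=\exp(-\tilde X^\nu\otimes H_\nu),$$ where the $\tilde X^\nu$ are expressed by (formal power) series in the commuting generators $X^\mu$.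
   Context: Summation over repeated indices is understood. $(H_\mu)$ is a basis of $\mathbf{L}$, with multiplication $H_\mu H_\nu=B_{\mu\nu}^\sigma H_\sigma$, and $(X^\mu)$ is the dual basis of $\mathbf{L}^*$. Lie algebra $\mathbf{L}\triangleright\mathbf{L}^*$: it has basis $H_\mu,X^\nu$ and brackets $[H_\mu,H_\nu]=(B_{\mu\nu}^\sigma-B_{\nu\mu}^\sigma)H_\sigma$, $[H_\mu,X^\nu]=-B_{\mu\sigma}^\nu X^\sigma$, $[X^\mu,X^\nu]=0$. Here $U(\mathbf{L})$ and $U(\mathbf{L}^* )$ denote the universal enveloping algebras of the Lie subalgebras spanned by the $H_\mu$ and by the $X^\nu$. The unital associative algebra $\mathbf{R}$ has basis $\hat E$ (identity), $\hat H_\mu$, $\hat X^\nu$ and products $\hat H_\mu\hat H_\nu=B_{\mu\nu}^\sigma\hat H_\sigma$, $\hat X^\nu\hat H_\mu=B_{\mu\sigma}^\nu\hat X^\sigma$, $\hat X^\mu\hat X^\nu=0$, $\hat H_\mu\hat X^\nu=0$. Tensor bialgebra: $T(\mathbf{R})=\prod_{n\ge 0}\mathbf{R}^{\otimes n}$, $\mathbf{R}^{\otimes 0}=\mathbf{K}$, with componentwise multiplication (each $\mathbf{R}^{\otimes n}$ has its tensor-product algebra structure with unit $e^n$) and unit $1=\sum_n e^n$. $\pi^n\colon T(\mathbf{R})\to\mathbf{R}^{\otimes n}$ are the projections and $\varepsilon=\pi^0$ is the counit. The coproduct is $\Delta(y_1\otimes\cdots\otimes y_n)=\sum_{k=0}^{n}(y_1\otimes\cdots\otimes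 y_k)\otimes(y_{k+1}\otimes\cdots\otimes y_n)$ (empty products are $e^0$). Tensor products of $T(\mathbf{R})$ are completed: $T(\mathbf{R})\otimes T(\mathbf{R})=\prod_{m,n}\mathbf{R}^{\otimes m}\otimes\mathbf{R}^{\otimes n}$, etc. Normalized means $(\varepsilon\otimes\mathrm{id})(\Phi)=(\mathrm{id}\otimes\varepsilon)(\Phi)=1$. For every family of invertible elements $\Phi^{1,k}\in\mathbf{R}\otimes\mathbf{R}^{\otimes k}$, $k\ge1$, there is a unique invertible normalized solution of the twisting equation with $(\pi^1\otimes\pi^k)(\Phi)=\Phi^{1,k}$. $\Phi^{1,1}_{ij}$ denotes $\Phi^{1,1}$ placed in the tensor factors $i,j$. Embedding of the enveloping algebra: $1\mapsto\hat E$, $X^\nu\mapsto\hat X^\nu$, $H_\mu\mapsto\hat H_\mu$ extends to an algebra homomorphism $\rho\colon U(\mathbf{L}\triangleright\mathbf{L}^* )\to\mathbf{R}$, and $\phi(h)=\varepsilon(h)e^0+\sum_{n\ge1}\rho^{\otimes n}(\Delta^{n}(h))$, where $\Delta^n\colon U\to U^{\otimes n}$ is the iterated coproduct ($\Delta^1=\mathrm{id}$), is a bialgebra homomorphism $U(\mathbf{L}\triangleright\mathbf{L}^* )\to T(\mathbf{R})$. Elements of the enveloping algebra are identified with their images under $\phi$. The images of the $X^\nu$ in every $\mathbf{R}^{\otimes n}$ are commuting and nilpotent, so formal power series in the $X^\nu$ define elements of $T(\mathbf{R})$. "$\Phi$ belongs to $U(\mathbf{L}^* )\otimes U(\mathbf{L})$"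 is understood in the completed sense: $(\pi^m\otimes\pi^n)(\Phi)\in\pi^m(\phi(U(\mathbf{L}^* )))\otimes\pi^n(\phi(U(\mathbf{L})))$ for all $m,n$. The series $\tilde X^\nu$ are taken without constant term, so that the exponential is well defined in each component. *)

theory Defs
  imports Complex_Main "HOL-Algebra.Group" "HOL-Library.Multiset" "HOL-Library.Groups_Big_Fun"
begin

section \<open>The algebra L\<close>

locale fin_dim_assoc_algebra = vector_space scale
  for scale :: "'k::field_char_0 \<Rightarrow> 'l::ring \<Rightarrow> 'l" +
  fixes d :: nat and H :: "nat \<Rightarrow> 'l" and B :: "nat \<Rightarrow> nat \<Rightarrow> nat \<Rightarrow> 'k"
  assumes scale_mult_left: "scale a x * y = scale a (x * y)"
    and scale_mult_right: "x * scale a y = scale a (x * y)"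
    and inj_H: "inj_on H {..<d}"
    and independent_H: "independent (H ` {..<d})"
    and span_H: "span (H ` {..<d}) = UNIV"
    and mult_H: "\<mu> < d \<Longrightarrow> \<nu> < d \<Longrightarrow> H \<mu> * H \<nu> = (\<Sum>\<sigma><d. scale (B \<mu> \<nu> \<sigma>) (H \<sigma>))"

section \<open>Algebras given by structure constants\<close>

text \<open>
  A (possibly completed) algebra with basis \<open>S\<close> is represented by the coordinate functions of
  its elements: \<open>c i j k\<close> is the coefficient of \<open>k\<close> in the product of the basis elements
  \<open>i\<close> and \<open>j\<close>.  For fixed \<open>k\<close> only finitely many \<open>(i, j)\<close> have \<open>c i j k \<noteq> 0\<close> in all instances
  below, so that infinite (formal) linear combinations can be multiplied as well.
  \<open>Sum_any\<close> is the sum over the support, and is used for sums with finite support only.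
\<close>

definition basis_mult ::
    "('i \<Rightarrow> 'i \<Rightarrow> 'i \<Rightarrow> 'k::comm_ring_1) \<Rightarrow> ('i \<Rightarrow> 'k) \<Rightarrow> ('i \<Rightarrow> 'k) \<Rightarrow> 'i \<Rightarrow> 'k"
  where "basis_mult c f g k = Sum_any (\<lambda>(i, j). f i * g j * c i j k)"

definition basis_alg ::
    "'i set \<Rightarrow> ('i \<Rightarrow> 'i \<Rightarrow> 'i \<Rightarrow> 'k::comm_ring_1) \<Rightarrow> ('i \<Rightarrow> 'k) \<Rightarrow> ('i \<Rightarrow> 'k) monoid"
  where "basis_alg S c u = \<lparr>carrier = {f. \<forall>i. f i \<noteq> 0 \<longrightarrow> i \<in> S}, monoid.mult = basis_mult c, one = u\<rparr>"

text \<open>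
  If \<open>c\<close> are the structure constants of an algebra \<open>A\<close>, then the following are those of the
  product over all \<open>n\<close> of the algebras \<open>A\<^sup>\<otimes>\<^sup>n\<close>; the word \<open>[a\<^sub>1, \<dots>, a\<^sub>n]\<close> of basis elements stands
  for \<open>a\<^sub>1 \<otimes> \<dots> \<otimes> a\<^sub>n\<close>.
\<close>

definition tensor_const ::
    "('i \<Rightarrow> 'i \<Rightarrow> 'i \<Rightarrow> 'k::comm_ring_1) \<Rightarrow> 'i list \<Rightarrow> 'i list \<Rightarrow> 'i list \<Rightarrow> 'k"
  where "tensor_const c u v w =
    (if length u = length w \<and> length v = length w
     then (\<Prod>i<length w. c (u ! i) (v ! i) (w ! i)) else 0)"

section \<open>The algebra R and its tensor bialgebra\<close>

datatype ridx = Ehat | Hhat nat | Xhat nat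

definition rbasis :: "nat \<Rightarrow> ridx set"
  where "rbasis d = {Ehat} \<union> Hhat ` {..<d} \<union> Xhat ` {..<d}"

fun rconst0 :: "(nat \<Rightarrow> nat \<Rightarrow> nat \<Rightarrow> 'k::field_char_0) \<Rightarrow> ridx \<Rightarrow> ridx \<Rightarrow> ridx \<Rightarrow> 'k"
  where
    "rconst0 B Ehat b c = of_bool (c = b)"
  | "rconst0 B a Ehat c = of_bool (c = a)"
  | "rconst0 B (Hhat \<mu>) (Hhat \<nu>) c = (case c of Hhat \<sigma> \<Rightarrow> B \<mu> \<nu> \<sigma> | _ \<Rightarrow> 0)"
  | "rconst0 B (Xhat \<nu>) (Hhat \<mu>) c = (case c of Xhat \<sigma> \<Rightarrow> B \<mu> \<sigma> \<nu> | _ \<Rightarrow> 0)"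
  | "rconst0 B (Xhat \<mu>) (Xhat \<nu>) c = 0"
  | "rconst0 B (Hhat \<mu>) (Xhat \<nu>) c = 0"

definition rconst ::
    "nat \<Rightarrow> (nat \<Rightarrow> nat \<Rightarrow> nat \<Rightarrow> 'k::field_char_0) \<Rightarrow> ridx \<Rightarrow> ridx \<Rightarrow> ridx \<Rightarrow> 'k"
  where "rconst d B a b c = (if {a, b, c} \<subseteq> rbasis d then rconst0 B a b c else 0)"

definition R_alg :: "nat \<Rightarrow> (nat \<Rightarrow> nat \<Rightarrow> nat \<Rightarrow> 'k::field_char_0) \<Rightarrow> (ridx \<Rightarrow> 'k) monoid"
  where "R_alg d B = basis_alg (rbasis d) (rconst d B) (\<lambda>a. of_bool (a = Ehat))"

definition R_pow ::
    "nat \<Rightarrow> (nat \<Rightarrow> nat \<Rightarrow> nat \<Rightarrow> 'k::field_char_0) \<Rightarrow> nat \<Rightarrow> (ridx list \<Rightarrow> 'k) monoid"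
  where "R_pow d B n =
    basis_alg {w \<in> lists (rbasis d). length w = n} (tensor_const (rconst d B))
      (\<lambda>w. of_bool (w = replicate n Ehat))"

definition T_one :: "ridx list \<Rightarrow> 'k::field_char_0"
  where "T_one w = of_bool (set w \<subseteq> {Ehat})"

definition T_alg :: "nat \<Rightarrow> (nat \<Rightarrow> nat \<Rightarrow> nat \<Rightarrow> 'k::field_char_0) \<Rightarrow> (ridx list \<Rightarrow> 'k) monoid"
  where "T_alg d B = basis_alg (lists (rbasis d)) (tensor_const (rconst d B)) T_one"

text \<open>
  The completed tensor power \<open>T(R)\<^sup>\<otimes>\<^sup>k\<close>; the list \<open>[w\<^sub>1, \<dots>, w\<^sub>k]\<close> of words stands for
  \<open>w\<^sub>1 \<otimes> \<dots> \<otimes> w\<^sub>k\<close>.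
\<close>

definition T_pow ::
    "nat \<Rightarrow> (nat \<Rightarrow> nat \<Rightarrow> nat \<Rightarrow> 'k::field_char_0) \<Rightarrow> nat \<Rightarrow> (ridx list list \<Rightarrow> 'k) monoid"
  where "T_pow d B k =
    basis_alg {W \<in> lists (lists (rbasis d)). length W = k}
      (tensor_const (tensor_const (rconst d B)))
      (\<lambda>W. of_bool (length W = k) * (\<Prod>w\<leftarrow>W. T_one w))"

definition T_proj :: "nat \<Rightarrow> (ridx list \<Rightarrow> 'k::field_char_0) \<Rightarrow> ridx list \<Rightarrow> 'k"
  where "T_proj n f w = (if length w = n then f w else 0)"

definition T2_proj :: "nat \<Rightarrow> nat \<Rightarrow> (ridx list list \<Rightarrow> 'k::field_char_0) \<Rightarrow> ridx list list \<Rightarrow> 'k"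
  where "T2_proj m n F W = (if map length W = [m, n] then F W else 0)"

definition T_tensor ::
    "(ridx list \<Rightarrow> 'k::field_char_0) \<Rightarrow> (ridx list \<Rightarrow> 'k) \<Rightarrow> ridx list list \<Rightarrow> 'k"
  where "T_tensor f g W = (case W of [u, v] \<Rightarrow> f u * g v | _ \<Rightarrow> 0)"

definition tensor_subspace ::
    "(ridx list \<Rightarrow> 'k::field_char_0) set \<Rightarrow> (ridx list \<Rightarrow> 'k) set \<Rightarrow> (ridx list list \<Rightarrow> 'k) set"
  where "tensor_subspace V V' =
    {(\<lambda>W. \<Sum>i<r. T_tensor (f i) (g i) W) | (r::nat) f g. \<forall>i<r. f i \<in> V \<and> g i \<in> V'}"

section \<open>Twisting cocycles\<close>

text \<open>
  The coproduct of \<open>T(R)\<close> is deconcatenation of words, so the coefficient of \<open>u \<otimes> v\<close> in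
  \<open>\<Delta> f\<close> is that of the concatenation \<open>u @ v\<close> in \<open>f\<close>.
\<close>

definition Delta_id :: "(ridx list list \<Rightarrow> 'k::field_char_0) \<Rightarrow> ridx list list \<Rightarrow> 'k"
  where "Delta_id F W = (case W of [u, v, w] \<Rightarrow> F [u @ v, w] | _ \<Rightarrow> 0)"

definition id_Delta :: "(ridx list list \<Rightarrow> 'k::field_char_0) \<Rightarrow> ridx list list \<Rightarrow> 'k"
  where "id_Delta F W = (case W of [u, v, w] \<Rightarrow> F [u, v @ w] | _ \<Rightarrow> 0)"

definition leg12 :: "(ridx list list \<Rightarrow> 'k::field_char_0) \<Rightarrow> ridx list list \<Rightarrow> 'k"
  where "leg12 F W = (case W of [u, v, w] \<Rightarrow> F [u, v] * T_one w | _ \<Rightarrow> 0)"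

definition leg23 :: "(ridx list list \<Rightarrow> 'k::field_char_0) \<Rightarrow> ridx list list \<Rightarrow> 'k"
  where "leg23 F W = (case W of [u, v, w] \<Rightarrow> T_one u * F [v, w] | _ \<Rightarrow> 0)"

definition twisting_equation ::
    "nat \<Rightarrow> (nat \<Rightarrow> nat \<Rightarrow> nat \<Rightarrow> 'k::field_char_0) \<Rightarrow> (ridx list list \<Rightarrow> 'k) \<Rightarrow> bool"
  where "twisting_equation d B F \<longleftrightarrow>
    Delta_id F \<otimes>\<^bsub>T_pow d B 3\<^esub> leg12 F = id_Delta F \<otimes>\<^bsub>T_pow d B 3\<^esub> leg23 F"

text \<open>Since \<open>\<epsilon> = \<pi>\<^sup>0\<close>, \<open>(\<epsilon> \<otimes> id)(F)\<close> has the coordinates \<open>w \<mapsto> F [[], w]\<close>.\<close>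

definition normalized :: "(ridx list list \<Rightarrow> 'k::field_char_0) \<Rightarrow> bool"
  where "normalized F \<longleftrightarrow> (\<lambda>w. F [[], w]) = T_one \<and> (\<lambda>w. F [w, []]) = T_one"

definition Phi11 :: "nat \<Rightarrow> ridx \<Rightarrow> ridx \<Rightarrow> 'k::field_char_0"
  where "Phi11 d a b = of_bool (a = Ehat \<and> b = Ehat)
    - (\<Sum>\<nu><d. of_bool (a = Xhat \<nu> \<and> b = Hhat \<nu>))"

text \<open>\<open>place n i j f\<close> is \<open>f \<in> R \<otimes> R\<close> placed in the factors \<open>i\<close>, \<open>j\<close> of \<open>R\<^sup>\<otimes>\<^sup>n\<close>, counted from 0.\<close>

definition place ::
    "nat \<Rightarrow> nat \<Rightarrow> nat \<Rightarrow> (ridx \<Rightarrow> ridx \<Rightarrow> 'k::field_char_0) \<Rightarrow> ridx list \<Rightarrow> 'k"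
  where "place n i j f w =
    (if length w = n then f (w ! i) (w ! j) * (\<Prod>l\<in>{..<n} - {i, j}. of_bool (w ! l = Ehat)) else 0)"

definition Phi1 ::
    "nat \<Rightarrow> (nat \<Rightarrow> nat \<Rightarrow> nat \<Rightarrow> 'k::field_char_0) \<Rightarrow> nat \<Rightarrow> ridx list \<Rightarrow> 'k"
  where "Phi1 d B k =
    foldr (\<lambda>j t. place (k + 1) 0 j (Phi11 d) \<otimes>\<^bsub>R_pow d B (k + 1)\<^esub> t) [1..<k + 1] \<one>\<^bsub>R_pow d B (k + 1)\<^esub>"

text \<open>The identification of \<open>R \<otimes> R\<^sup>\<otimes>\<^sup>k\<close> with \<open>R\<^sup>\<otimes>\<^sup>(\<^sup>k\<^sup>+\<^sup>1\<^sup>)\<close> is concatenation of words.\<close>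

definition expands_Phi11 ::
    "nat \<Rightarrow> (nat \<Rightarrow> nat \<Rightarrow> nat \<Rightarrow> 'k::field_char_0) \<Rightarrow> (ridx list list \<Rightarrow> 'k) \<Rightarrow> bool"
  where "expands_Phi11 d B F \<longleftrightarrow>
    (\<forall>k\<ge>1. \<forall>u v. length u = 1 \<longrightarrow> length v = k \<longrightarrow> F [u, v] = Phi1 d B k (u @ v))"

section \<open>The enveloping algebra\<close>

datatype gen = GenH nat | GenX nat

definition lie_basis :: "nat \<Rightarrow> gen set"
  where "lie_basis d = GenH ` {..<d} \<union> GenX ` {..<d}"

text \<open>\<open>lie_const B x y z\<close> is the coefficient of \<open>z\<close> in the bracket \<open>[x, y]\<close>.\<close>

fun lie_const :: "(nat \<Rightarrow> nat \<Rightarrow> nat \<Rightarrow> 'k::field_char_0) \<Rightarrow> gen \<Rightarrow> gen \<Rightarrow> gen \<Rightarrow> 'k"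
  where
    "lie_const B (GenH \<mu>) (GenH \<nu>) (GenH \<sigma>) = B \<mu> \<nu> \<sigma> - B \<nu> \<mu> \<sigma>"
  | "lie_const B (GenH \<mu>) (GenX \<nu>) (GenX \<sigma>) = - B \<mu> \<sigma> \<nu>"
  | "lie_const B (GenX \<nu>) (GenH \<mu>) (GenX \<sigma>) = B \<mu> \<sigma> \<nu>"
  | "lie_const B _ _ _ = 0"

text \<open>
  The enveloping algebra is the quotient of the free algebra on the basis of the Lie algebra
  (finitely supported functions on words) by the two-sided ideal generated by all
  \<open>x y - y x - [x, y]\<close>.
\<close>

definition word :: "gen list \<Rightarrow> gen list \<Rightarrow> 'k::field_char_0"
  where "word v w = of_bool (w = v)"

definition free_alg :: "gen set \<Rightarrow> (gen list \<Rightarrow> 'k::field_char_0) set"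
  where "free_alg G = {h. finite {w. h w \<noteq> 0} \<and> (\<forall>w. h w \<noteq> 0 \<longrightarrow> set w \<subseteq> G)}"

definition relator ::
    "nat \<Rightarrow> (nat \<Rightarrow> nat \<Rightarrow> nat \<Rightarrow> 'k::field_char_0) \<Rightarrow> gen list \<Rightarrow> gen \<Rightarrow> gen \<Rightarrow> gen list
      \<Rightarrow> gen list \<Rightarrow> 'k"
  where "relator d B u x y v w =
    word (u @ [x, y] @ v) w - word (u @ [y, x] @ v) w
      - (\<Sum>z\<in>lie_basis d. lie_const B x y z * word (u @ [z] @ v) w)"

inductive_set uea_ideal ::
    "nat \<Rightarrow> (nat \<Rightarrow> nat \<Rightarrow> nat \<Rightarrow> 'k::field_char_0) \<Rightarrow> (gen list \<Rightarrow> 'k) set"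
  for d B where
    zero: "(\<lambda>_. 0) \<in> uea_ideal d B"
  | add: "\<lbrakk>h \<in> uea_ideal d B; set u \<subseteq> lie_basis d; set v \<subseteq> lie_basis d;
      x \<in> lie_basis d; y \<in> lie_basis d\<rbrakk>
      \<Longrightarrow> (\<lambda>w. h w + a * relator d B u x y v w) \<in> uea_ideal d B"

definition uea_rel ::
    "nat \<Rightarrow> (nat \<Rightarrow> nat \<Rightarrow> nat \<Rightarrow> 'k::field_char_0) \<Rightarrow> ((gen list \<Rightarrow> 'k) \<times> (gen list \<Rightarrow> 'k)) set"
  where "uea_rel d B = {(h, h'). h \<in> free_alg (lie_basis d) \<and> h' \<in> free_alg (lie_basis d) \<and>
    (\<lambda>w. h w - h' w) \<in> uea_ideal d B}"

definition uea_class ::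
    "nat \<Rightarrow> (nat \<Rightarrow> nat \<Rightarrow> nat \<Rightarrow> 'k::field_char_0) \<Rightarrow> (gen list \<Rightarrow> 'k) \<Rightarrow> (gen list \<Rightarrow> 'k) set"
  where "uea_class d B h = uea_rel d B `` {h}"

text \<open>
  The subalgebras of \<open>U(L \<triangleright> L\<^sup>*)\<close> generated by \<open>L\<close> and by \<open>L\<^sup>*\<close>, which are \<open>U(L)\<close> and \<open>U(L\<^sup>*)\<close>
  by the theorem of Poincare, Birkhoff and Witt.
\<close>

definition U_L :: "nat \<Rightarrow> (nat \<Rightarrow> nat \<Rightarrow> nat \<Rightarrow> 'k::field_char_0) \<Rightarrow> (gen list \<Rightarrow> 'k) set set"
  where "U_L d B = uea_class d B ` free_alg (GenH ` {..<d})"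

definition U_Ldual :: "nat \<Rightarrow> (nat \<Rightarrow> nat \<Rightarrow> nat \<Rightarrow> 'k::field_char_0) \<Rightarrow> (gen list \<Rightarrow> 'k) set set"
  where "U_Ldual d B = uea_class d B ` free_alg (GenX ` {..<d})"

section \<open>The embedding of the enveloping algebra\<close>

text \<open>
  The coproduct is the algebra homomorphism with \<open>\<Delta> x = x \<otimes> 1 + 1 \<otimes> x\<close> for generators \<open>x\<close>:
  \<open>cop_word w u v\<close> is the coefficient of \<open>u \<otimes> v\<close> in \<open>\<Delta> w\<close>, computed from
  \<open>\<Delta> (x w) = (x \<otimes> 1 + 1 \<otimes> x) (\<Delta> w)\<close>.
\<close>

fun cop_word :: "gen list \<Rightarrow> gen list \<Rightarrow> gen list \<Rightarrow> 'k::field_char_0"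
  where
    "cop_word [] u v = of_bool (u = [] \<and> v = [])"
  | "cop_word (x # w) u v =
      (case u of [] \<Rightarrow> 0 | y # u' \<Rightarrow> if y = x then cop_word w u' v else 0)
      + (case v of [] \<Rightarrow> 0 | y # v' \<Rightarrow> if y = x then cop_word w u v' else 0)"

definition cop :: "(gen list \<Rightarrow> 'k::field_char_0) \<Rightarrow> gen list \<Rightarrow> gen list \<Rightarrow> 'k"
  where "cop h u v = Sum_any (\<lambda>w. h w * cop_word w u v)"

text \<open>
  \<open>cop_iter h [u\<^sub>1, \<dots>, u\<^sub>n]\<close> is the coefficient of \<open>u\<^sub>1 \<otimes> \<dots> \<otimes> u\<^sub>n\<close> in \<open>\<Delta>\<^sup>n h\<close>, where \<open>\<Delta>\<^sup>0\<close> is the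
  counit and \<open>\<Delta>\<^sup>n\<^sup>+\<^sup>1 = (id \<otimes> \<Delta>\<^sup>n) \<circ> \<Delta>\<close>; in particular \<open>\<Delta>\<^sup>1 = id\<close>.
\<close>

fun cop_iter :: "(gen list \<Rightarrow> 'k::field_char_0) \<Rightarrow> gen list list \<Rightarrow> 'k"
  where
    "cop_iter h [] = h []"
  | "cop_iter h (u # us) = cop_iter (cop h u) us"

fun hat :: "gen \<Rightarrow> ridx"
  where
    "hat (GenH \<mu>) = Hhat \<mu>"
  | "hat (GenX \<nu>) = Xhat \<nu>"

fun rho_word ::
    "nat \<Rightarrow> (nat \<Rightarrow> nat \<Rightarrow> nat \<Rightarrow> 'k::field_char_0) \<Rightarrow> gen list \<Rightarrow> ridx \<Rightarrow> 'k"
  where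
    "rho_word d B [] = \<one>\<^bsub>R_alg d B\<^esub>"
  | "rho_word d B (x # w) = (\<lambda>a. of_bool (a = hat x)) \<otimes>\<^bsub>R_alg d B\<^esub> rho_word d B w"

text \<open>
  \<open>\<phi>(h) = \<epsilon>(h) e\<^sup>0 + \<Sum>\<^sub>n\<^sub>\<ge>\<^sub>1 \<rho>\<^sup>\<otimes>\<^sup>n(\<Delta>\<^sup>n h)\<close>, first for \<open>h\<close> in the free algebra and then, by
  \<open>phi_uea_class\<close> below, for its class in the enveloping algebra.
\<close>

definition phi_free ::
    "nat \<Rightarrow> (nat \<Rightarrow> nat \<Rightarrow> nat \<Rightarrow> 'k::field_char_0) \<Rightarrow> (gen list \<Rightarrow> 'k) \<Rightarrow> ridx list \<Rightarrow> 'k"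
  where "phi_free d B h w =
    Sum_any (\<lambda>us. if length us = length w
      then cop_iter h us * (\<Prod>i<length w. rho_word d B (us ! i) (w ! i)) else 0)"

definition phi ::
    "nat \<Rightarrow> (nat \<Rightarrow> nat \<Rightarrow> nat \<Rightarrow> 'k::field_char_0) \<Rightarrow> (gen list \<Rightarrow> 'k) set \<Rightarrow> ridx list \<Rightarrow> 'k"
  where "phi d B C = phi_free d B (SOME h. h \<in> C)"

definition phi_gen ::
    "nat \<Rightarrow> (nat \<Rightarrow> nat \<Rightarrow> nat \<Rightarrow> 'k::field_char_0) \<Rightarrow> gen \<Rightarrow> ridx list \<Rightarrow> 'k"
  where "phi_gen d B x = phi d B (uea_class d B (word [x]))"

subsection \<open>Compatibility with the quotient\<close>

lemma finite_rbasis [simp]: "finite (rbasis d)"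
  by (simp add: rbasis_def)

lemma sum_rbasis:
  "(\<Sum>a\<in>rbasis d. f a) = f Ehat + (\<Sum>\<mu><d. f (Hhat \<mu>)) + (\<Sum>\<mu><d. f (Xhat \<mu>))"
proof -
  have "(\<Sum>a\<in>rbasis d. f a) = f Ehat + (\<Sum>a\<in>Hhat ` {..<d} \<union> Xhat ` {..<d}. f a)"
    unfolding rbasis_def Un_assoc by (subst sum.union_disjoint) auto
  also have "(\<Sum>a\<in>Hhat ` {..<d} \<union> Xhat ` {..<d}. f a) = (\<Sum>\<mu><d. f (Hhat \<mu>)) + (\<Sum>\<mu><d. f (Xhat \<mu>))"
    by (subst sum.union_disjoint) (auto simp: sum.reindex inj_on_def)
  finally show ?thesis by (simp add: add.assoc)
qed

lemma sum_lie_basis: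
  "(\<Sum>z\<in>lie_basis d. f z) = (\<Sum>\<mu><d. f (GenH \<mu>)) + (\<Sum>\<mu><d. f (GenX \<mu>))"
  unfolding lie_basis_def by (subst sum.union_disjoint) (auto simp: sum.reindex inj_on_def)

lemma basis_mem [simp]:
  "Ehat \<in> rbasis d" "Hhat \<mu> \<in> rbasis d \<longleftrightarrow> \<mu> < d" "Xhat \<mu> \<in> rbasis d \<longleftrightarrow> \<mu> < d"
  "GenH \<mu> \<in> lie_basis d \<longleftrightarrow> \<mu> < d" "GenX \<mu> \<in> lie_basis d \<longleftrightarrow> \<mu> < d"
  by (auto simp: rbasis_def lie_basis_def)

lemma finite_lie_basis [simp]: "finite (lie_basis d)"
  by (simp add: lie_basis_def)

context fin_dim_assoc_algebra
begin

lemma B_assoc: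
  assumes "\<mu> < d" "\<nu> < d" "\<rho> < d" "\<tau> < d"
  shows "(\<Sum>\<sigma><d. B \<nu> \<rho> \<sigma> * B \<mu> \<sigma> \<tau>) = (\<Sum>\<sigma><d. B \<mu> \<nu> \<sigma> * B \<sigma> \<rho> \<tau>)"
proof -
  define u where "u \<tau> = (\<Sum>\<sigma><d. B \<nu> \<rho> \<sigma> * B \<mu> \<sigma> \<tau>) - (\<Sum>\<sigma><d. B \<mu> \<nu> \<sigma> * B \<sigma> \<rho> \<tau>)" for \<tau>
  have l: "H \<mu> * (H \<nu> * H \<rho>) = (\<Sum>\<tau><d. scale (\<Sum>\<sigma><d. B \<nu> \<rho> \<sigma> * B \<mu> \<sigma> \<tau>) (H \<tau>))"
  proof -
    have "H \<mu> * (H \<nu> * H \<rho>) = (\<Sum>\<sigma><d. scale (B \<nu> \<rho> \<sigma>) (H \<mu> * H \<sigma>))"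
      using assms by (simp add: mult_H sum_distrib_left scale_mult_right)
    also have "\<dots> = (\<Sum>\<sigma><d. \<Sum>\<tau><d. scale (B \<nu> \<rho> \<sigma> * B \<mu> \<sigma> \<tau>) (H \<tau>))"
      using assms by (intro sum.cong) (auto simp: mult_H scale_sum_right)
    also have "\<dots> = (\<Sum>\<tau><d. \<Sum>\<sigma><d. scale (B \<nu> \<rho> \<sigma> * B \<mu> \<sigma> \<tau>) (H \<tau>))"
      by (rule sum.swap)
    finally show ?thesis by (simp add: scale_sum_left)
  qed
  have r: "(H \<mu> * H \<nu>) * H \<rho> = (\<Sum>\<tau><d. scale (\<Sum>\<sigma><d. B \<mu> \<nu> \<sigma> * B \<sigma> \<rho> \<tau>) (H \<tau>))"
  proof -
    have "(H \<mu> * H \<nu>) * H \<rho> = (\<Sum>\<sigma><d. scale (B \<mu> \<nu> \<sigma>) (H \<sigma> * H \<rho>))"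
      using assms by (simp add: mult_H sum_distrib_right scale_mult_left)
    also have "\<dots> = (\<Sum>\<sigma><d. \<Sum>\<tau><d. scale (B \<mu> \<nu> \<sigma> * B \<sigma> \<rho> \<tau>) (H \<tau>))"
      using assms by (intro sum.cong) (auto simp: mult_H scale_sum_right)
    also have "\<dots> = (\<Sum>\<tau><d. \<Sum>\<sigma><d. scale (B \<mu> \<nu> \<sigma> * B \<sigma> \<rho> \<tau>) (H \<tau>))"
      by (rule sum.swap)
    finally show ?thesis by (simp add: scale_sum_left)
  qed
  have z: "(\<Sum>\<tau><d. scale (u \<tau>) (H \<tau>)) = 0"
    using l r by (simp add: u_def scale_left_diff_distrib sum_subtractf mult.assoc)
  define v where "v = (\<lambda>x. u (the_inv_into {..<d} H x))"
  have "(\<Sum>x\<in>H ` {..<d}. scale (v x) x) = 0"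
    using z by (simp add: sum.reindex[OF inj_H] v_def the_inv_into_f_f[OF inj_H])
  then have "\<forall>x\<in>H ` {..<d}. v x = 0"
    using independent_H by (simp add: dependent_finite) blast
  then have "u \<tau> = 0"
    using assms by (simp add: v_def the_inv_into_f_f[OF inj_H])
  then show ?thesis by (simp add: u_def)
qed

lemma B_assoc':
  assumes "\<mu> < d" "\<nu> < d" "\<rho> < d" "\<tau> < d"
  shows "(\<Sum>\<sigma><d. B \<mu> \<sigma> \<tau> * B \<nu> \<rho> \<sigma>) = (\<Sum>\<sigma><d. B \<mu> \<nu> \<sigma> * B \<sigma> \<rho> \<tau>)"
  using B_assoc[OF assms] by (simp add: mult.commute)

lemma hat_rbasis: "x \<in> lie_basis d \<Longrightarrow> hat x \<in> rbasis d"
  by (auto simp: lie_basis_def rbasis_def)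

lemma rconst_bracket:
  assumes "x \<in> lie_basis d" "y \<in> lie_basis d" "e \<in> rbasis d"
  shows "(\<Sum>b\<in>rbasis d. rconst d B (hat x) b a * rconst d B (hat y) e b)
       - (\<Sum>b\<in>rbasis d. rconst d B (hat y) b a * rconst d B (hat x) e b)
       = (\<Sum>z\<in>lie_basis d. lie_const B x y z * rconst d B (hat z) e a)"
proof (cases "a \<in> rbasis d")
  case True
  note assms = assms True
  have L: "(\<Sum>b\<in>rbasis d. rconst d B (hat x) b a * rconst d B (hat y) e b)
     = (\<Sum>b\<in>rbasis d. rconst0 B (hat x) b a * rconst0 B (hat y) e b)" 
    if "x \<in> lie_basis d" "y \<in> lie_basis d" for x y
    using assms that by (intro sum.cong) (auto simp: rconst_def hat_rbasis)
  have R: "(\<Sum>z\<in>lie_basis d. lie_const B x y z * rconst d B (hat z) e a)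
     = (\<Sum>z\<in>lie_basis d. lie_const B x y z * rconst0 B (hat z) e a)" 
    using assms by (intro sum.cong) (auto simp: rconst_def hat_rbasis)
  have "(\<Sum>b\<in>rbasis d. rconst0 B (hat x) b a * rconst0 B (hat y) e b)
       - (\<Sum>b\<in>rbasis d. rconst0 B (hat y) b a * rconst0 B (hat x) e b)
       = (\<Sum>z\<in>lie_basis d. lie_const B x y z * rconst0 B (hat z) e a)"
    using assms
    apply (cases x; cases y; cases a; cases e)
    apply (simp_all add: sum_rbasis sum_lie_basis)
    apply (simp_all add: of_bool_def if_distrib[of "\<lambda>t. _ * t"] if_distrib[of "\<lambda>t. t * _"] cong: if_cong)
    apply (simp_all add: B_assoc algebra_simps sum_subtractf sum_negf)
    apply (auto intro: B_assoc' B_assoc'[symmetric])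
    done
  then show ?thesis using assms by (simp add: L R)
qed (simp add: rconst_def)
end

definition bounded_words :: "nat \<Rightarrow> nat \<Rightarrow> gen list set"
  where "bounded_words d N = {w. set w \<subseteq> lie_basis d \<and> length w \<le> N}"

definition bounded_supp :: "nat \<Rightarrow> nat \<Rightarrow> (gen list \<Rightarrow> 'k::field_char_0) \<Rightarrow> bool"
  where "bounded_supp d N h \<longleftrightarrow> (\<forall>w. h w \<noteq> 0 \<longrightarrow> w \<in> bounded_words d N)"

lemma finite_bounded_words [simp]: "finite (bounded_words d N)"
  unfolding bounded_words_def by (rule finite_lists_length_le) simp

lemma Sum_any_neq_0: "Sum_any f \<noteq> 0 \<Longrightarrow> \<exists>x. f x \<noteq> 0"
  by (rule ccontr) (simp add: Sum_any.expand_set)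

lemma Sum_any_bounded:
  "finite S \<Longrightarrow> (\<And>x. f x \<noteq> 0 \<Longrightarrow> x \<in> S) \<Longrightarrow> Sum_any f = sum f S"
  by (rule Sum_any.expand_superset) auto

lemma cop_word_neq_0:
  "cop_word w u v \<noteq> (0::'k::field_char_0) \<Longrightarrow> set u \<subseteq> set w \<and> set v \<subseteq> set w \<and> length u + length v = length w"
proof (induction w u v rule: cop_word.induct)
  case (2 x w u v)
  show ?case
  proof (cases "(case u of [] \<Rightarrow> 0 | y # u' \<Rightarrow> if y = x then cop_word w u' v else 0) = (0::'k)")
    case True
    then obtain v' where "v = x # v'" "cop_word w u v' \<noteq> (0::'k)"
      using 2 by (auto split: list.splits if_splits)
    then show ?thesis using 2 by auto
  next
    case False
    then obtain u' where "u = x # u'" "cop_word w u' v \<noteq> (0::'k)"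
      by (auto split: list.splits if_splits)
    then show ?thesis using 2 by auto
  qed
qed (auto split: if_splits)

lemma cop_neq_0:
  assumes "bounded_supp d N h" "cop h u v \<noteq> 0"
  shows "u \<in> bounded_words d N \<and> v \<in> bounded_words d N"
proof -
  obtain w where "h w \<noteq> 0" "cop_word w u v \<noteq> (0::'a)"
    using Sum_any_neq_0[OF assms(2)[unfolded cop_def]] by auto
  then have "set w \<subseteq> lie_basis d" "length w \<le> N"
      "set u \<subseteq> set w" "set v \<subseteq> set w" "length u + length v = length w"
    using assms(1) cop_word_neq_0[of w u v] by (auto simp: bounded_supp_def bounded_words_def)
  then show ?thesis
    by (auto simp: bounded_words_def)
qed

lemma bounded_supp_cop: "bounded_supp d N h \<Longrightarrow> bounded_supp d N (cop h u)"
  using cop_neq_0[of d N h u] by (simp add: bounded_supp_def)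

lemma cop_eq_sum: "bounded_supp d N h \<Longrightarrow> cop h u v = (\<Sum>w\<in>bounded_words d N. h w * cop_word w u v)"
  unfolding cop_def by (rule Sum_any_bounded) (auto simp: bounded_supp_def)

lemma cop_iter_neq_0:
  "bounded_supp d N h \<Longrightarrow> cop_iter h us \<noteq> 0 \<Longrightarrow> set us \<subseteq> bounded_words d N"
proof (induction us arbitrary: h)
  case (Cons u us)
  obtain v where "cop h u v \<noteq> 0"
  proof (rule ccontr)
    assume "\<not> thesis"
    then have "\<not> (\<exists>v. cop h u v \<noteq> 0)" using that by blast
    then have "cop h u = (\<lambda>_. 0)" by auto
    moreover have "cop_iter (\<lambda>_. 0::'a) us = 0"
    proof (induction us)
      case (Cons u us)
      have "cop (\<lambda>_. 0::'a) u = (\<lambda>_. 0)"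
        by (simp add: fun_eq_iff cop_def)
      then show ?case using Cons.IH by simp
    qed simp
    ultimately show False using Cons.prems by simp
  qed
  then have "u \<in> bounded_words d N"
    using cop_neq_0[OF Cons.prems(1)] by blast
  moreover have "set us \<subseteq> bounded_words d N"
    using Cons.IH[OF bounded_supp_cop[OF Cons.prems(1)]] Cons.prems(2) by simp
  ultimately show ?case by simp
qed simp

lemma phi_free_Nil: "phi_free d B h [] = h []"
proof -
  have "phi_free d B h [] = Sum_any (\<lambda>us :: gen list list. if us = [] then h [] else 0)"
    unfolding phi_free_def by (rule Sum_any.cong) auto
  then show ?thesis by (simp)
qed

lemma phi_free_eq_sum:
  assumes "bounded_supp d N h"
  shows "phi_free d B h w = (\<Sum>us | length us = length w \<and> set us \<subseteq> bounded_words d N.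
    cop_iter h us * (\<Prod>i<length w. rho_word d B (us ! i) (w ! i)))"
proof -
  have "finite {us. length us = length w \<and> set us \<subseteq> bounded_words d N}"
    using finite_lists_length_eq[of "bounded_words d N" "length w"] by (simp add: conj_commute)
  then have "phi_free d B h w = (\<Sum>us | length us = length w \<and> set us \<subseteq> bounded_words d N.
     if length us = length w
      then cop_iter h us * (\<Prod>i<length w. rho_word d B (us ! i) (w ! i)) else 0)"
    unfolding phi_free_def by (rule Sum_any_bounded) (use cop_iter_neq_0[OF assms] in \<open>auto split: if_splits\<close>)
  also have "\<dots> = (\<Sum>us | length us = length w \<and> set us \<subseteq> bounded_words d N.
    cop_iter h us * (\<Prod>i<length w. rho_word d B (us ! i) (w ! i)))"
    by (rule sum.cong) auto
  finally show ?thesis .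
qed

lemma phi_free_Cons:
  assumes "bounded_supp d N h"
  shows "phi_free d B h (a # w) =
    (\<Sum>u\<in>bounded_words d N. rho_word d B u a * phi_free d B (cop h u) w)"
proof -
  let ?L = "{us. length us = length w \<and> set us \<subseteq> bounded_words d N}"
  have eq: "{us. length us = length (a # w) \<and> set us \<subseteq> bounded_words d N}
     = (\<lambda>(u, us). u # us) ` (bounded_words d N \<times> ?L)"
    by (auto simp: image_iff length_Suc_conv)
  have inj: "inj_on (\<lambda>(u, us). u # us) X" for X :: "(gen list \<times> gen list list) set"
    by (auto simp: inj_on_def)
  show ?thesis
    unfolding phi_free_eq_sum[OF assms] phi_free_eq_sum[OF bounded_supp_cop[OF assms]] eq
    by (subst sum.reindex[OF inj])
       (simp add: sum.cartesian_product split_def prod.lessThan_Suc_shift sum_distrib_left mult_ac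
         del: prod.lessThan_Suc)
qed

lemma bounded_supp_lin:
  "bounded_supp d N f \<Longrightarrow> bounded_supp d N g \<Longrightarrow> bounded_supp d N (\<lambda>w. f w + c * g w)"
  by (auto simp: bounded_supp_def) (metis add.right_neutral mult_zero_right)+

lemma cop_lin:
  assumes "bounded_supp d N f" "bounded_supp d N g"
  shows "cop (\<lambda>w. f w + c * g w) u = (\<lambda>v. cop f u v + c * cop g u v)"
  unfolding cop_eq_sum[OF bounded_supp_lin[OF assms]] cop_eq_sum[OF assms(1)] cop_eq_sum[OF assms(2)] fun_eq_iff
  by (simp add: sum.distrib sum_distrib_left algebra_simps)

lemma phi_free_lin:
  assumes "bounded_supp d N f" "bounded_supp d N g"
  shows "phi_free d B (\<lambda>w. f w + c * g w) w = phi_free d B f w + c * phi_free d B g w"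
  using assms
proof (induction w arbitrary: f g)
  case (Cons a w)
  then show ?case
    by (simp add: phi_free_Cons[of d N] bounded_supp_lin cop_lin bounded_supp_cop
        sum.distrib sum_distrib_left algebra_simps)
qed (simp add: phi_free_Nil)

definition prepend :: "gen \<Rightarrow> (gen list \<Rightarrow> 'k::field_char_0) \<Rightarrow> gen list \<Rightarrow> 'k"
  where "prepend x h w = (case w of [] \<Rightarrow> 0 | y # w' \<Rightarrow> if y = x then h w' else 0)"

lemma bounded_supp_prepend:
  "bounded_supp d N h \<Longrightarrow> x \<in> lie_basis d \<Longrightarrow> bounded_supp d (Suc N) (prepend x h)"
  by (auto simp: bounded_supp_def bounded_words_def prepend_def split: list.splits if_splits)

lemma bounded_supp_mono: "bounded_supp d N h \<Longrightarrow> N \<le> M \<Longrightarrow> bounded_supp d M h"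
  by (fastforce simp: bounded_supp_def bounded_words_def)

lemma sum_prepend:
  assumes "bounded_supp d N h" "x \<in> lie_basis d"
  shows "(\<Sum>w\<in>bounded_words d (Suc N). prepend x h w * f w) = (\<Sum>w\<in>bounded_words d N. h w * f (x # w))"
proof -
  have "(\<Sum>w\<in>bounded_words d N. h w * f (x # w)) = (\<Sum>w\<in>Cons x ` bounded_words d N. prepend x h w * f w)"
    by (simp add: sum.reindex prepend_def)
  also have "\<dots> = (\<Sum>w\<in>bounded_words d (Suc N). prepend x h w * f w)"
    using assms
    by (intro sum.mono_neutral_left finite_bounded_words)
       (auto simp: bounded_words_def prepend_def image_iff split: list.splits if_splits)
  finally show ?thesis by simp
qed

lemma cop_prepend:
  assumes "bounded_supp d N h" "x \<in> lie_basis d"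
  shows "cop (prepend x h) u = (\<lambda>v. prepend x (\<lambda>u'. cop h u' v) u + 1 * prepend x (cop h u) v)"
proof
  fix v
  have "cop (prepend x h) u v = (\<Sum>w\<in>bounded_words d N. h w * cop_word (x # w) u v)"
    by (simp only: cop_eq_sum[OF bounded_supp_prepend[OF assms]] sum_prepend[OF assms])
  also have "\<dots> = prepend x (\<lambda>u'. cop h u' v) u + 1 * prepend x (cop h u) v"
    by (auto simp: prepend_def cop_eq_sum[OF assms(1)] distrib_left sum.distrib split: list.splits)
  finally show "cop (prepend x h) u v = prepend x (\<lambda>u'. cop h u' v) u + 1 * prepend x (cop h u) v" .
qed

lemma basis_mult_single:
  "basis_mult c (\<lambda>a. of_bool (a = b)) g k = Sum_any (\<lambda>j. g j * c b j k)"
proof -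
  have "Sum_any (\<lambda>j. g j * c b j k) = sum (\<lambda>j. g j * c b j k) {j. g j * c b j k \<noteq> 0}"
    by (simp add: Sum_any.expand_set)
  also have "\<dots> = sum (\<lambda>p. (case p of (i, j) \<Rightarrow> of_bool (i = b) * g j * c i j k)) (Pair b ` {j. g j * c b j k \<noteq> 0})"
    by (subst sum.reindex) (auto simp: inj_on_def)
  also have "Pair b ` {j. g j * c b j k \<noteq> 0} = {p. (case p of (i, j) \<Rightarrow> of_bool (i = b) * g j * c i j k) \<noteq> 0}"
    by (auto simp: image_iff of_bool_def split: if_splits)
  finally show ?thesis
    by (simp add: basis_mult_def Sum_any.expand_set)
qed

lemma rho_word_Cons:
  "rho_word d B (x # w) a = (\<Sum>b\<in>rbasis d. rconst d B (hat x) b a * rho_word d B w b)"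
proof -
  have "rho_word d B (x # w) a = Sum_any (\<lambda>b. rho_word d B w b * rconst d B (hat x) b a)"
    by (simp add: R_alg_def basis_alg_def basis_mult_single)
  also have "\<dots> = (\<Sum>b\<in>rbasis d. rho_word d B w b * rconst d B (hat x) b a)"
    by (rule Sum_any_bounded) (auto simp: rconst_def split: if_splits)
  finally show ?thesis by (simp add: mult.commute)
qed

text \<open>Multiplication from the left by the image of a generator in all tensor powers of R.\<close>

fun lmult ::
    "nat \<Rightarrow> (nat \<Rightarrow> nat \<Rightarrow> nat \<Rightarrow> 'k::field_char_0) \<Rightarrow> gen \<Rightarrow> (ridx list \<Rightarrow> 'k) \<Rightarrow> ridx list \<Rightarrow> 'k"
  where
    "lmult d B x f [] = 0"
  | "lmult d B x f (a # w) =
      (\<Sum>b\<in>rbasis d. rconst d B (hat x) b a * f (b # w)) + lmult d B x (\<lambda>v. f (a # v)) w"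

lemma lmult_lin: "lmult d B x (\<lambda>w. f w + c * g w) w = lmult d B x f w + c * lmult d B x g w"
  by (induction w arbitrary: f g) (simp_all add: algebra_simps sum.distrib sum_distrib_left)

lemma lmult_zero: "lmult d B x (\<lambda>w. 0) w = 0"
  by (induction w) simp_all

lemma lmult_sum: "finite S \<Longrightarrow> lmult d B x (\<lambda>w. \<Sum>i\<in>S. c i * f i w) w = (\<Sum>i\<in>S. c i * lmult d B x (f i) w)"
proof (induction S rule: finite_induct)
  case (insert i S)
  have "lmult d B x (\<lambda>w. \<Sum>i\<in>insert i S. c i * f i w) w = lmult d B x (\<lambda>w. (\<Sum>i\<in>S. c i * f i w) + c i * f i w) w"
    using insert by (simp add: add.commute)
  then show ?case using insert by (simp only: lmult_lin) (simp add: add.commute)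
qed (simp add: lmult_zero)

lemma phi_free_prepend:
  assumes "bounded_supp d N h" "x \<in> lie_basis d"
  shows "phi_free d B (prepend x h) w = lmult d B x (phi_free d B h) w"
  using assms(1)
proof (induction w arbitrary: h)
  case Nil
  then show ?case by (simp add: phi_free_Nil prepend_def)
next
  case (Cons a w)
  let ?D = "bounded_words d (Suc N)"
  have s: "bounded_supp d (Suc N) (cop h u)" "bounded_supp d (Suc N) (prepend x (cop h u))"
     "bounded_supp d (Suc N) h" for u
    using bounded_supp_mono[OF Cons.prems, of "Suc N"]
       bounded_supp_prepend[OF bounded_supp_cop[OF Cons.prems] assms(2)]
    by (auto intro: bounded_supp_cop)
  have s': "bounded_supp d (Suc N) (\<lambda>v. prepend x (\<lambda>u'. cop h u' v) u)" for u
    using s(1) by (cases u) (auto simp: prepend_def bounded_supp_def)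
  have p0: "phi_free d B (\<lambda>_. 0) w = 0" 
    using phi_free_lin[of d 0 "\<lambda>_. 0" "\<lambda>_. 0" B "-1" w] by (simp add: bounded_supp_def)
  have pp: "phi_free d B (\<lambda>v. prepend x (\<lambda>u'. cop h u' v) u) w = prepend x (\<lambda>u'. phi_free d B (cop h u') w) u" for u
    by (cases u) (auto simp: prepend_def p0)
  have "phi_free d B (prepend x h) (a # w) =
     (\<Sum>u\<in>?D. rho_word d B u a * phi_free d B (cop (prepend x h) u) w)"
    by (rule phi_free_Cons[OF bounded_supp_prepend[OF Cons.prems assms(2)]])
  also have "\<dots> = (\<Sum>u\<in>?D. rho_word d B u a * prepend x (\<lambda>u'. phi_free d B (cop h u') w) u)
      + (\<Sum>u\<in>?D. rho_word d B u a * phi_free d B (prepend x (cop h u)) w)"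
    by (simp add: cop_prepend[OF Cons.prems assms(2)] phi_free_lin[OF s' s(2), where c=1, simplified]
        pp distrib_left sum.distrib)
  also have "(\<Sum>u\<in>?D. rho_word d B u a * prepend x (\<lambda>u'. phi_free d B (cop h u') w) u)
     = (\<Sum>u\<in>bounded_words d N. rho_word d B (x # u) a * phi_free d B (cop h u) w)"
  proof -
    have "(\<Sum>u\<in>bounded_words d N. rho_word d B (x # u) a * phi_free d B (cop h u) w)
      = (\<Sum>u\<in>Cons x ` bounded_words d N. rho_word d B u a * prepend x (\<lambda>u'. phi_free d B (cop h u') w) u)"
      by (simp add: sum.reindex prepend_def)
    also have "\<dots> = (\<Sum>u\<in>?D. rho_word d B u a * prepend x (\<lambda>u'. phi_free d B (cop h u') w) u)"
      using assms(2)
      by (intro sum.mono_neutral_left finite_bounded_words)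
         (auto simp: bounded_words_def prepend_def image_iff split: list.splits if_splits)
    finally show ?thesis by simp
  qed
  also have "\<dots> = (\<Sum>b\<in>rbasis d. rconst d B (hat x) b a * phi_free d B h (b # w))"
    by (simp only: rho_word_Cons phi_free_Cons[OF Cons.prems] sum_distrib_left sum_distrib_right
         mult.assoc) (rule sum.swap)
  also have "(\<Sum>u\<in>?D. rho_word d B u a * phi_free d B (prepend x (cop h u)) w)
     = lmult d B x (\<lambda>v. phi_free d B h (a # v)) w"
    by (simp add: Cons.IH[OF bounded_supp_cop[OF Cons.prems]] phi_free_Cons[OF s(3)] lmult_sum)
  finally show ?case by simp
qed

lemma bounded_supp_word: "set u \<subseteq> lie_basis d \<Longrightarrow> bounded_supp d (length u) (word u)"
  by (auto simp: bounded_supp_def bounded_words_def word_def)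

lemma word_Cons: "word (x # u) = prepend x (word u)"
  by (auto simp: word_def prepend_def fun_eq_iff split: list.splits)

lemma phi_free_word_Cons:
  "set u \<subseteq> lie_basis d \<Longrightarrow> x \<in> lie_basis d \<Longrightarrow>
    phi_free d B (word (x # u)) = lmult d B x (phi_free d B (word u))"
  by (simp add: word_Cons phi_free_prepend[OF bounded_supp_word] fun_eq_iff)

lemma phi_free_zero: "phi_free d B (\<lambda>_. 0) w = 0" 
  using phi_free_lin[of d 0 "\<lambda>_. 0" "\<lambda>_. 0" B "-1" w] by (simp add: bounded_supp_def)

lemma phi_free_sum:
  assumes "finite S" "\<And>i. i \<in> S \<Longrightarrow> bounded_supp d N (f i)"
  shows "phi_free d B (\<lambda>w. \<Sum>i\<in>S. c i * f i w) w = (\<Sum>i\<in>S. c i * phi_free d B (f i) w) \<and>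
    bounded_supp d N (\<lambda>w. \<Sum>i\<in>S. c i * f i w)"
  using assms
proof (induction S rule: finite_induct)
  case (insert i S)
  then have *: "bounded_supp d N (\<lambda>w. \<Sum>i\<in>S. c i * f i w)" "bounded_supp d N (f i)" by auto
  show ?case using insert phi_free_lin[OF *, of B "c i" w] bounded_supp_lin[OF *, of "c i"]
    by (simp add: add.commute)
qed (simp add: phi_free_zero bounded_supp_def)

context fin_dim_assoc_algebra
begin

lemma lmult_bracket:
  assumes "x \<in> lie_basis d" "y \<in> lie_basis d"
  shows "lmult d B x (lmult d B y f) w - lmult d B y (lmult d B x f) w =
    (\<Sum>z\<in>lie_basis d. lie_const B x y z * lmult d B z f w)"
proof (induction w arbitrary: f)
  case (Cons a w)
  let ?R = "rbasis d"
  have e: "lmult d B x (lmult d B y f) (a # w) =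
     (\<Sum>e\<in>?R. (\<Sum>b\<in>?R. rconst d B (hat x) b a * rconst d B (hat y) e b) * f (e # w))
     + (\<Sum>b\<in>?R. rconst d B (hat x) b a * lmult d B y (\<lambda>v. f (b # v)) w)
     + (\<Sum>b\<in>?R. rconst d B (hat y) b a * lmult d B x (\<lambda>v. f (b # v)) w)
     + lmult d B x (lmult d B y (\<lambda>v. f (a # v))) w" for x y
  proof -
    have 1: "lmult d B x (\<lambda>v. lmult d B y f (a # v)) w =
       (\<Sum>b\<in>?R. rconst d B (hat y) b a * lmult d B x (\<lambda>v. f (b # v)) w)
       + lmult d B x (lmult d B y (\<lambda>v. f (a # v))) w"
      unfolding lmult.simps
      using lmult_lin[of d B x "\<lambda>w. (\<Sum>b\<in>?R. rconst d B (hat y) b a * f (b # w))" 1 "lmult d B y (\<lambda>v. f (a # v))" w]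
      unfolding mult_1 lmult_sum[OF finite_rbasis] .
    have 2: "(\<Sum>e\<in>?R. (\<Sum>b\<in>?R. rconst d B (hat x) b a * rconst d B (hat y) e b) * f (e # w))
      = (\<Sum>b\<in>?R. rconst d B (hat x) b a * (\<Sum>e\<in>?R. rconst d B (hat y) e b * f (e # w)))"
      by (simp only: sum_distrib_left sum_distrib_right mult.assoc) (rule sum.swap)
    show ?thesis
      unfolding 2 lmult.simps(2)[of d B x "lmult d B y f"] 1
      by (simp add: distrib_left sum.distrib)
  qed
  have "lmult d B x (lmult d B y f) (a # w) - lmult d B y (lmult d B x f) (a # w)
     = (\<Sum>e\<in>?R. ((\<Sum>b\<in>?R. rconst d B (hat x) b a * rconst d B (hat y) e b)
          - (\<Sum>b\<in>?R. rconst d B (hat y) b a * rconst d B (hat x) e b)) * f (e # w))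
      + (\<Sum>z\<in>lie_basis d. lie_const B x y z * lmult d B z (\<lambda>v. f (a # v)) w)"
    using Cons by (simp only: e left_diff_distrib sum_subtractf) (simp add: Cons.IH[symmetric])
  also have "(\<Sum>e\<in>?R. ((\<Sum>b\<in>?R. rconst d B (hat x) b a * rconst d B (hat y) e b)
          - (\<Sum>b\<in>?R. rconst d B (hat y) b a * rconst d B (hat x) e b)) * f (e # w))
     = (\<Sum>e\<in>?R. (\<Sum>z\<in>lie_basis d. lie_const B x y z * rconst d B (hat z) e a) * f (e # w))"
    using assms by (intro sum.cong refl) (simp add: rconst_bracket)
  also have "\<dots> = (\<Sum>z\<in>lie_basis d. lie_const B x y z * (\<Sum>e\<in>?R. rconst d B (hat z) e a * f (e # w)))"
    by (simp only: sum_distrib_left sum_distrib_right mult.assoc) (rule sum.swap)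
  finally show ?case
    by (simp add: distrib_left sum.distrib)
qed simp

lemma bounded_supp_relator:
  assumes "x \<in> lie_basis d" "y \<in> lie_basis d" "set u \<subseteq> lie_basis d" "set v \<subseteq> lie_basis d"
  shows "bounded_supp d (length u + length v + 2) (relator d B u x y v)"
proof -
  have "relator d B u x y v w = 0" if "w \<notin> bounded_words d (length u + length v + 2)" for w
  proof -
    have "w \<noteq> u @ [x, y] @ v" "w \<noteq> u @ [y, x] @ v" "\<And>z. z \<in> lie_basis d \<Longrightarrow> w \<noteq> u @ [z] @ v"
      using assms that by (auto simp: bounded_words_def)
    then show ?thesis by (simp add: relator_def word_def)
  qed
  then show ?thesis by (auto simp: bounded_supp_def)
qed

lemma phi_free_relator:
  assumes "x \<in> lie_basis d" "y \<in> lie_basis d" "set u \<subseteq> lie_basis d" "set v \<subseteq> lie_basis d"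
  shows "phi_free d B (relator d B u x y v) = (\<lambda>w. 0)"
  using assms(3)
proof (induction u)
  case Nil
  let ?N = "length v + 2"
  have b: "bounded_supp d ?N (word (t @ v))" if "set t \<subseteq> lie_basis d" "length t \<le> 2" for t
    using bounded_supp_mono[OF bounded_supp_word[of "t @ v" d], of ?N] that assms by simp
  let ?s = "\<lambda>w. \<Sum>z\<in>lie_basis d. lie_const B x y z * word ([z] @ v) w"
  have b1: "bounded_supp d ?N (word ([z] @ v))" if "z \<in> lie_basis d" for z
    using b[of "[z]"] that by simp
  have s: "phi_free d B ?s w = (\<Sum>z\<in>lie_basis d. lie_const B x y z * phi_free d B (word ([z] @ v)) w)"
    and s': "bounded_supp d ?N ?s" for w
    using phi_free_sum[of "lie_basis d" d ?N "\<lambda>z. word ([z] @ v)" B "lie_const B x y" w, OF finite_lie_basis b1]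
    by auto
  have 1: "relator d B [] x y v = (\<lambda>w. (word ([x, y] @ v) w + (- 1) * word ([y, x] @ v) w) + (- 1) * ?s w)"
    by (simp add: relator_def fun_eq_iff)
  have b2: "bounded_supp d ?N (word ([x, y] @ v))" "bounded_supp d ?N (word ([y, x] @ v))"
    using b[of "[x, y]"] b[of "[y, x]"] assms by simp_all
  have 2: "phi_free d B (relator d B [] x y v) w =
     phi_free d B (word ([x, y] @ v)) w - phi_free d B (word ([y, x] @ v)) w - phi_free d B ?s w" for w
    unfolding 1 phi_free_lin[OF bounded_supp_lin[OF b2] s'] phi_free_lin[OF b2] by simp
  show ?case
  proof
    fix w
    have *: "(\<Sum>z\<in>lie_basis d. lie_const B x y z * phi_free d B (word ([z] @ v)) w) =
       (\<Sum>z\<in>lie_basis d. lie_const B x y z * lmult d B z (phi_free d B (word v)) w)"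
      using assms by (intro sum.cong) (simp_all add: phi_free_word_Cons)
    show "phi_free d B (relator d B [] x y v) w = 0"
      unfolding 2 s *
      using assms lmult_bracket[OF assms(1,2), of "phi_free d B (word v)" w]
      by (simp add: phi_free_word_Cons)
  qed
next
  case (Cons z u)
  have "relator d B (z # u) x y v = prepend z (relator d B u x y v)"
    by (auto simp: relator_def word_def prepend_def fun_eq_iff split: list.splits)
  moreover have "phi_free d B (prepend z (relator d B u x y v)) =
      lmult d B z (phi_free d B (relator d B u x y v))"
    using Cons assms phi_free_prepend[OF bounded_supp_relator[OF assms(1,2) _ assms(4), of u], of z B]
    by (simp add: fun_eq_iff)
  ultimately show ?case
    using Cons by (simp add: fun_eq_iff[of "lmult _ _ _ _"] lmult_zero)
qed

lemma phi_free_uea_ideal: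
  assumes "h \<in> uea_ideal d B"
  shows "(\<exists>N. bounded_supp d N h) \<and> phi_free d B h = (\<lambda>w. 0)"
  using assms
proof induction
  case zero
  then show ?case by (auto simp: phi_free_zero bounded_supp_def)
next
  case (add h u v x y a)
  then obtain N where "bounded_supp d N h" by blast
  define M where "M = max N (length u + length v + 2)"
  have *: "bounded_supp d M h" "bounded_supp d M (relator d B u x y v)"
    using \<open>bounded_supp d N h\<close> bounded_supp_relator[of x y u v] add
    by (auto simp: M_def intro: bounded_supp_mono)
  show ?case
    using bounded_supp_lin[OF *] phi_free_lin[OF *] phi_free_relator add
    by auto
qed

lemma free_alg_bounded_supp:
  assumes "h \<in> free_alg (lie_basis d)"
  shows "\<exists>N. bounded_supp d N h"
proof -
  have "finite (length ` {w. h w \<noteq> 0})"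
    using assms by (simp add: free_alg_def)
  then obtain N where "\<forall>n\<in>length ` {w. h w \<noteq> 0}. n \<le> N"
    using finite_nat_set_iff_bounded_le by blast
  then show ?thesis
    using assms by (auto simp: free_alg_def bounded_supp_def bounded_words_def)
qed

lemma phi_uea_class:
  assumes "h \<in> free_alg (lie_basis d)"
  shows "phi d B (uea_class d B h) = phi_free d B h"
proof -
  have "h \<in> uea_class d B h"
    using assms by (simp add: uea_class_def uea_rel_def uea_ideal.zero)
  then have "(SOME h'. h' \<in> uea_class d B h) \<in> uea_class d B h"
    by (rule someI[of "\<lambda>h'. h' \<in> uea_class d B h"])
  then obtain h' where h': "h' = (SOME h'. h' \<in> uea_class d B h)"
     "h' \<in> free_alg (lie_basis d)" "(\<lambda>w. h w - h' w) \<in> uea_ideal d B"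
    by (auto simp: uea_class_def uea_rel_def)
  obtain N M where *: "bounded_supp d N h" "bounded_supp d M h'"
    using assms h'(2) free_alg_bounded_supp by blast
  have "bounded_supp d (max N M) h" "bounded_supp d (max N M) h'"
    using *[THEN bounded_supp_mono] by auto
  then have "phi_free d B (\<lambda>w. h w + (- 1) * h' w) = (\<lambda>w. phi_free d B h w + (- 1) * phi_free d B h' w)"
    using phi_free_lin by blast
  then have "phi_free d B h' = phi_free d B h"
    using phi_free_uea_ideal[OF h'(3)] by (simp add: fun_eq_iff)
  then show ?thesis
    by (simp add: phi_def h'(1))
qed

end

section \<open>Power series and the exponential\<close>

text \<open>
  A formal power series in the commuting variables \<open>X\<^sup>0, \<dots>, X\<^sup>d\<^sup>-\<^sup>1\<close> is a coefficient function
  \<open>p :: nat multiset \<Rightarrow> 'k\<close>; a monomial is the multiset of the indices of its factors.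
\<close>

definition X_monomial ::
    "nat \<Rightarrow> (nat \<Rightarrow> nat \<Rightarrow> nat \<Rightarrow> 'k::field_char_0) \<Rightarrow> nat multiset \<Rightarrow> ridx list \<Rightarrow> 'k"
  where "X_monomial d B \<alpha> =
    foldr (\<lambda>\<mu> t. phi_gen d B (GenX \<mu>) \<otimes>\<^bsub>T_alg d B\<^esub> t) (sorted_list_of_multiset \<alpha>) \<one>\<^bsub>T_alg d B\<^esub>"

definition X_series ::
    "nat \<Rightarrow> (nat \<Rightarrow> nat \<Rightarrow> nat \<Rightarrow> 'k::field_char_0) \<Rightarrow> (nat multiset \<Rightarrow> 'k) \<Rightarrow> ridx list \<Rightarrow> 'k"
  where "X_series d B p w =
    Sum_any (\<lambda>\<alpha>. if set_mset \<alpha> \<subseteq> {..<d} then p \<alpha> * X_monomial d B \<alpha> w else 0)"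

definition T2_exp ::
    "nat \<Rightarrow> (nat \<Rightarrow> nat \<Rightarrow> nat \<Rightarrow> 'k::field_char_0) \<Rightarrow> (ridx list list \<Rightarrow> 'k) \<Rightarrow> ridx list list \<Rightarrow> 'k"
  where "T2_exp d B A W = Sum_any (\<lambda>k. (A [^]\<^bsub>T_pow d B 2\<^esub> (k::nat)) W / fact k)"

text \<open>
  The following lemmas show that the sums in \<open>X_series\<close> and, for series without constant term,
  in \<open>T2_exp\<close> have finite support.
\<close>

definition X_degree :: "ridx list \<Rightarrow> nat"
  where "X_degree w = length (filter (\<lambda>a. a \<in> range Xhat) w)"

lemma X_degree_le_length: "X_degree w \<le> length w"
  by (simp add: X_degree_def)

lemma tensor_const_Cons:
  "tensor_const c (a # u) (b # v) (e # w) = c a b e * tensor_const c u v w"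
  by (simp add: tensor_const_def prod.lessThan_Suc_shift del: prod.lessThan_Suc)

lemma tensor_const_length: "tensor_const c u v w \<noteq> 0 \<Longrightarrow> length u = length w \<and> length v = length w"
  by (auto simp: tensor_const_def split: if_splits)

lemma rconst_X_degree:
  "rconst d B a b c \<noteq> 0 \<Longrightarrow> X_degree [a] + X_degree [b] \<le> X_degree [c]"
  by (cases a; cases b; cases c) (auto simp: rconst_def X_degree_def split: if_splits)

lemma tensor_const_X_degree:
  assumes "tensor_const (rconst d B) u v w \<noteq> 0"
  shows "X_degree u + X_degree v \<le> X_degree w"
proof -
  have "length u = length v" "length v = length w"
    using tensor_const_length[OF assms] by auto
  then show ?thesis
    using assms
  proof (induction u v w rule: list_induct3)
    case (Cons a u b v e w)
    then show ?case
      using rconst_X_degree[of d B a b e]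
      by (auto simp: tensor_const_Cons X_degree_def split: if_splits)
  qed (simp add: X_degree_def)
qed

lemma basis_mult_neq_0:
  assumes "basis_mult c f g k \<noteq> 0"
  obtains i j where "f i \<noteq> 0" "g j \<noteq> 0" "c i j k \<noteq> 0"
proof -
  obtain p where "(case p of (i, j) \<Rightarrow> f i * g j * c i j k) \<noteq> 0"
    using Sum_any_neq_0[OF assms[unfolded basis_mult_def]] by blast
  moreover obtain i j where "p = (i, j)" by (cases p)
  ultimately have "f i * g j * c i j k \<noteq> 0" by simp
  then have "f i \<noteq> 0" "g j \<noteq> 0" "c i j k \<noteq> 0" by auto
  then show thesis by (rule that)
qed

lemma lmult_X_degree: "lmult d B (GenX \<mu>) f w \<noteq> 0 \<Longrightarrow> X_degree w \<ge> 1"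
proof (induction w arbitrary: f)
  case (Cons a w f)
  show ?case
  proof (cases "lmult d B (GenX \<mu>) (\<lambda>v. f (a # v)) w = 0")
    case True
    then obtain b where "rconst d B (Xhat \<mu>) b a \<noteq> 0"
      using Cons.prems by (force intro: ccontr sum.neutral)
    then show ?thesis
      using rconst_X_degree[of d B "Xhat \<mu>" b a] by (auto simp: X_degree_def split: if_splits)
  next
    case False
    then show ?thesis
      using Cons.IH by (force simp: X_degree_def)
  qed
qed simp

lemma finite_T2_exp_terms:
  assumes "\<And>W. A W \<noteq> 0 \<Longrightarrow> W \<noteq> [] \<and> X_degree (hd W) \<ge> 1"
  shows "finite {k::nat. (A [^]\<^bsub>T_pow d B 2\<^esub> k) W \<noteq> 0}"
proof -
  have "k \<le> X_degree (hd W)" if "(A [^]\<^bsub>T_pow d B 2\<^esub> k) W \<noteq> 0" for k :: nat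
    using that
  proof (induction k arbitrary: W)
    case (Suc k W)
    then obtain U V where *: "(A [^]\<^bsub>T_pow d B 2\<^esub> k) U \<noteq> 0" "A V \<noteq> 0"
        "tensor_const (tensor_const (rconst d B)) U V W \<noteq> 0"
    proof -
      have "basis_mult (tensor_const (tensor_const (rconst d B))) (A [^]\<^bsub>T_pow d B 2\<^esub> k) A W \<noteq> 0"
        using Suc.prems by (simp add: nat_pow_def T_pow_def basis_alg_def)
      then show thesis by (rule basis_mult_neq_0) (rule that)
    qed
    obtain u U' v V' w W' where "U = u # U'" "V = v # V'" "W = w # W'"
      using assms[OF *(2)] tensor_const_length[OF *(3)] by (cases U; cases V; cases W) auto
    then show ?case
      using Suc.IH[OF *(1)] assms[OF *(2)] *(3) tensor_const_X_degree[of d B u v w]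
      by (auto simp: tensor_const_Cons)
  qed simp
  then show ?thesis
    by (auto intro: finite_subset[of _ "{..X_degree (hd W)}"])
qed

context fin_dim_assoc_algebra
begin

lemma phi_gen_X_degree:
  assumes "\<mu> < d" "phi_gen d B (GenX \<mu>) w \<noteq> 0"
  shows "X_degree w \<ge> 1"
proof -
  have "word [GenX \<mu>] \<in> (free_alg (lie_basis d) :: (gen list \<Rightarrow> 'k) set)"
    using assms by (auto simp: free_alg_def word_def)
  then have "phi_gen d B (GenX \<mu>) w = lmult d B (GenX \<mu>) (phi_free d B (word [])) w"
    using assms phi_free_word_Cons[of "[]" d "GenX \<mu>" B] by (simp add: phi_gen_def phi_uea_class)
  then show ?thesis
    using assms lmult_X_degree by force
qed

lemma X_monomial_X_degree:
  assumes "set_mset \<alpha> \<subseteq> {..<d}" "X_monomial d B \<alpha> w \<noteq> 0"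
  shows "size \<alpha> \<le> X_degree w"
proof -
  have *: "length \<mu>s \<le> X_degree w"
    if "set \<mu>s \<subseteq> {..<d}" "foldr (\<lambda>\<mu> t. phi_gen d B (GenX \<mu>) \<otimes>\<^bsub>T_alg d B\<^esub> t) \<mu>s \<one>\<^bsub>T_alg d B\<^esub> w \<noteq> 0" for \<mu>s
    using that
  proof (induction \<mu>s arbitrary: w)
    case (Cons \<mu> \<mu>s w)
    then obtain u v where "phi_gen d B (GenX \<mu>) u \<noteq> 0" "tensor_const (rconst d B) u v w \<noteq> 0"
       "foldr (\<lambda>\<mu> t. phi_gen d B (GenX \<mu>) \<otimes>\<^bsub>T_alg d B\<^esub> t) \<mu>s \<one>\<^bsub>T_alg d B\<^esub> v \<noteq> 0"
    proof -
      have "basis_mult (tensor_const (rconst d B)) (phi_gen d B (GenX \<mu>))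
          (foldr (\<lambda>\<mu> t. phi_gen d B (GenX \<mu>) \<otimes>\<^bsub>T_alg d B\<^esub> t) \<mu>s \<one>\<^bsub>T_alg d B\<^esub>) w \<noteq> 0"
        using Cons.prems(2) by (simp add: T_alg_def basis_alg_def)
      then show thesis by (rule basis_mult_neq_0) (rule that)
    qed
    then show ?case
      using Cons.IH[of v] Cons.prems(1) phi_gen_X_degree[of \<mu> u] tensor_const_X_degree[of d B u v w] by simp
  qed simp
  show ?thesis
  proof -
    have "set (sorted_list_of_multiset \<alpha>) = set_mset \<alpha>" "length (sorted_list_of_multiset \<alpha>) = size \<alpha>"
      using mset_sorted_list_of_multiset[of \<alpha>] by (metis set_mset_mset, metis size_mset)
    then show ?thesis
      using *[of "sorted_list_of_multiset \<alpha>"] assms unfolding X_monomial_def by simp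
  qed
qed

lemma finite_X_series_terms:
  "finite {\<alpha>. set_mset \<alpha> \<subseteq> {..<d} \<and> X_monomial d B \<alpha> w \<noteq> 0}"
proof (rule finite_subset)
  show "{\<alpha>. set_mset \<alpha> \<subseteq> {..<d} \<and> X_monomial d B \<alpha> w \<noteq> 0}
      \<subseteq> mset ` {\<mu>s. set \<mu>s \<subseteq> {..<d} \<and> length \<mu>s \<le> X_degree w}"
  proof
    fix \<alpha> assume "\<alpha> \<in> {\<alpha>. set_mset \<alpha> \<subseteq> {..<d} \<and> X_monomial d B \<alpha> w \<noteq> 0}"
    moreover obtain \<mu>s where "\<alpha> = mset \<mu>s" using ex_mset by metis
    ultimately show "\<alpha> \<in> mset ` {\<mu>s. set \<mu>s \<subseteq> {..<d} \<and> length \<mu>s \<le> X_degree w}"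
      using X_monomial_X_degree[of \<alpha> w] by auto
  qed
qed (simp add: finite_lists_length_le)

lemma X_series_X_degree:
  assumes "p {#} = 0" "X_series d B p w \<noteq> 0"
  shows "X_degree w \<ge> 1"
proof -
  obtain \<alpha> where \<alpha>: "set_mset \<alpha> \<subseteq> {..<d}" "p \<alpha> \<noteq> 0" "X_monomial d B \<alpha> w \<noteq> 0"
    using Sum_any_neq_0[OF assms(2)[unfolded X_series_def]] by (auto split: if_splits)
  then have "\<alpha> \<noteq> {#}" using assms(1) by auto
  then show ?thesis
    using X_monomial_X_degree[OF \<alpha>(1,3)] by (cases \<alpha>) auto
qed

lemma finite_exp_X_series_terms:
  assumes "\<And>\<nu>. \<nu> < d \<Longrightarrow> p \<nu> {#} = 0"
  shows "finite {k::nat.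
    ((\<lambda>W. - (\<Sum>\<nu><d. T_tensor (X_series d B (p \<nu>)) (f \<nu>) W)) [^]\<^bsub>T_pow d B 2\<^esub> k) W \<noteq> 0}"
proof (rule finite_T2_exp_terms)
  fix W assume "- (\<Sum>\<nu><d. T_tensor (X_series d B (p \<nu>)) (f \<nu>) W) \<noteq> 0"
  then have "(\<Sum>\<nu><d. T_tensor (X_series d B (p \<nu>)) (f \<nu>) W) \<noteq> 0" by simp
  then obtain \<nu> where "\<nu> < d" "T_tensor (X_series d B (p \<nu>)) (f \<nu>) W \<noteq> 0"
    by (rule sum.not_neutral_contains_not_neutral) auto
  then show "W \<noteq> [] \<and> X_degree (hd W) \<ge> 1"
    using X_series_X_degree[of "p \<nu>" "hd W"] assms
    by (auto simp: T_tensor_def split: list.splits)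
qed

end

end

theory Submission
  imports Defs
begin

text \<open>
  Repeated indices are summed over.  Write \<open>x\<^sub>i = X\<^sup>\<nu> \<otimes> (H\<^sub>\<nu>)\<^sub>i\<close>, where \<open>(H\<^sub>\<nu>)\<^sub>i\<close> is \<open>H\<^sub>\<nu>\<close> in the \<open>i\<close>-th tensor factor of \<open>R\<^sup>\<otimes>\<^sup>k\<close>.  These elements
  commute with each other, since the \<open>X\<close> commute.  The proof shows that the component of \<open>\<Phi>\<close> in
  \<open>R\<^sup>\<otimes>\<^sup>m \<otimes> R\<^sup>\<otimes>\<^sup>k\<close> is the product \<open>(1 - x\<^sub>1) \<cdots> (1 - x\<^sub>k)\<close>, and that this product is an exponential.

  \<^emph>\<open>The product.\<close>  In the components of the twisting equation with a single tensor factor \<open>R\<close> in the first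
  place almost everything vanishes, because \<open>X X = H X = 0\<close> in \<open>R\<close>.  What remains is a recursion on \<open>m\<close>
  (\<open>twisting_recursion\<close>): the part of \<open>\<Phi>\<close> that begins with the unit of \<open>R\<close> is \<open>\<Phi>\<close> for \<open>m - 1\<close>, the part
  that begins with \<open>X\<^sup>\<nu>\<close> is \<open>- [H\<^sub>\<nu> \<otimes> 1, \<Phi>] - (1 \<otimes> H\<^sub>\<nu>) \<Phi>\<close>, again for \<open>m - 1\<close>, and there is no part that
  begins with \<open>H\<^sub>\<nu>\<close>.  The product satisfies the same recursion (\<open>cocycle_Xhat\<close>), as follows from
  \<open>[H\<^sub>\<nu> \<otimes> 1, x\<^sub>i] = - (H\<^sub>\<nu>)\<^sub>i x\<^sub>i\<close>.

  \<^emph>\<open>The exponential.\<close>  The image of \<open>H\<^sub>\<nu>\<close> in \<open>R\<^sup>\<otimes>\<^sup>k\<close> is the sum of the \<open>(H\<^sub>\<nu>)\<^sub>i\<close>, and the powers \<open>x\<^sub>i\<^sup>n\<close> are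
  computed in \<open>L\<close>.  So if the series for \<open>X\<close>-tilde are the components of
  \<open>- log (1 - x) = \<Sum>\<^sub>n x\<^sup>n / n\<close> for \<open>x = X\<^sup>\<mu> \<otimes> H\<^sub>\<mu>\<close>, with products of the \<open>H\<close> taken in \<open>L\<close>, then the
  exponent is \<open>\<Sum>\<^sub>i log (1 - x\<^sub>i)\<close> (\<open>exponent_mult\<close>), whose exponential is the product.  To prove the last
  step without composing series, both sides are compared by the Euler operator, the derivation that
  multiplies by the degree in \<open>X\<close>.  With the power sums \<open>p\<^sub>n = \<Sum>\<^sub>i x\<^sub>i\<^sup>n\<close> both are solutions of
  \<open>deg F = - (\<Sum>\<^sub>n p\<^sub>n) F\<close> (\<open>cocycle_euler\<close>, \<open>log_pow_euler\<close>), and in characteristic zero a solution is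
  determined by its part of degree zero (\<open>exp_log_eq_cocycle\<close>).

  \<^emph>\<open>Membership.\<close>  Since \<open>p\<^sub>n = X\<^sup>\<mu>\<^sup>1 \<cdots> X\<^sup>\<mu>\<^sup>n \<otimes> H\<^sub>\<mu>\<^sub>1 \<cdots> H\<^sub>\<mu>\<^sub>n\<close> with the second factor in \<open>L\<close>, every term of
  the exponential series lies in \<open>U(L\<^sup>*) \<otimes> U(L)\<close>, and each component of the series is a finite sum
  (\<open>env_tensor_cocycle\<close>).
\<close>

section \<open>Associative multiplication from structure constants\<close>

lemma sum_rotate3:
  "(\<Sum>a\<in>A. \<Sum>b\<in>B. \<Sum>c\<in>C. f a b c) = (\<Sum>b\<in>B. \<Sum>c\<in>C. \<Sum>a\<in>A. f a b c)"
  by (simp only: sum.swap[where A = A])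

lemma sum_of_bool_pick:
  fixes f :: "'i \<Rightarrow> 'k::comm_ring_1"
  assumes "finite A" "x \<in> A"
  shows "(\<Sum>i\<in>A. of_bool (i = x) * f i) = f x"
proof -
  have "(\<Sum>i\<in>A. of_bool (i = x) * f i) = (\<Sum>i\<in>A. if i = x then f i else 0)"
    by (intro sum.cong) auto
  then show ?thesis using assms by simp
qed

lemma sum_rotate:
  "(\<Sum>a\<in>A. \<Sum>b\<in>B. \<Sum>c\<in>C. \<Sum>d\<in>D. f a b c d) = (\<Sum>b\<in>B. \<Sum>c\<in>C. \<Sum>d\<in>D. \<Sum>a\<in>A. f a b c d)"
  by (simp only: sum.swap[where A = A])

text \<open>
  \<open>K m\<close> is a finite set of basis elements that contains the two factors of every product in which
  \<open>m\<close> occurs, and it is the same set for all of its members.  The coordinate at \<open>m\<close> of an iterated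
  product is therefore a finite sum over \<open>K m\<close>, however many coordinates of the factors are nonzero:
  this is what makes the completed products associative.  In the tensor powers of \<open>R\<close>, \<open>K\<close> consists
  of the words with the same lengths.
\<close>

locale locally_finite_algebra =
  fixes c :: "'i \<Rightarrow> 'i \<Rightarrow> 'i \<Rightarrow> 'k::comm_ring_1" and K :: "'i \<Rightarrow> 'i set"
  assumes finite_K: "finite (K m)"
    and supp: "c i j m \<noteq> 0 \<Longrightarrow> i \<in> K m \<and> j \<in> K m"
    and K_eq: "l \<in> K m \<Longrightarrow> K l = K m"
    and assoc: "(\<Sum>l\<in>K m. c i j l * c l k m) = (\<Sum>l\<in>K m. c j k l * c i l m)"
begin

lemma basis_mult_eq_sum: "basis_mult c f g m = (\<Sum>i\<in>K m. \<Sum>j\<in>K m. f i * g j * c i j m)"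
proof -
  have "basis_mult c f g m = (\<Sum>(i, j)\<in>K m \<times> K m. f i * g j * c i j m)"
    unfolding basis_mult_def
  proof (rule Sum_any.expand_superset)
    show "{a. (case a of (i, j) \<Rightarrow> f i * g j * c i j m) \<noteq> 0} \<subseteq> K m \<times> K m"
      by auto (metis mult_zero_right supp)+
  qed (simp add: finite_K)
  then show ?thesis by (simp add: sum.cartesian_product)
qed

lemma basis_mult_cong:
  assumes "\<And>i. i \<in> K m \<Longrightarrow> f i = f' i" "\<And>j. j \<in> K m \<Longrightarrow> g j = g' j"
  shows "basis_mult c f g m = basis_mult c f' g' m"
  using assms by (simp add: basis_mult_eq_sum)

lemma basis_mult_assoc:
  "basis_mult c (basis_mult c f g) h = basis_mult c f (basis_mult c g h)"
proof
  fix m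
  let ?K = "K m"
  have inner: "basis_mult c f g l = (\<Sum>i\<in>?K. \<Sum>j\<in>?K. f i * g j * c i j l)"
    if "l \<in> ?K" for f g l
    using K_eq[OF that] by (simp add: basis_mult_eq_sum)
  have "basis_mult c (basis_mult c f g) h m
      = (\<Sum>l\<in>?K. \<Sum>k\<in>?K. (\<Sum>i\<in>?K. \<Sum>j\<in>?K. f i * g j * c i j l) * h k * c l k m)"
    by (simp add: basis_mult_eq_sum[of _ _ m] inner)
  also have "\<dots> = (\<Sum>l\<in>?K. \<Sum>k\<in>?K. \<Sum>i\<in>?K. \<Sum>j\<in>?K. f i * g j * h k * (c i j l * c l k m))"
    by (simp add: sum_distrib_left sum_distrib_right mult_ac)
  also have "\<dots> = (\<Sum>k\<in>?K. \<Sum>i\<in>?K. \<Sum>j\<in>?K. \<Sum>l\<in>?K. f i * g j * h k * (c i j l * c l k m))"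
    by (rule sum_rotate)
  also have "\<dots> = (\<Sum>k\<in>?K. \<Sum>i\<in>?K. \<Sum>j\<in>?K. \<Sum>l\<in>?K. f i * g j * h k * (c j k l * c i l m))"
    by (simp add: sum_distrib_left[symmetric] assoc)
  also have "\<dots> = (\<Sum>i\<in>?K. \<Sum>j\<in>?K. \<Sum>l\<in>?K. \<Sum>k\<in>?K. f i * g j * h k * (c j k l * c i l m))"
    by (rule sum_rotate)
  also have "\<dots> = (\<Sum>i\<in>?K. \<Sum>l\<in>?K. \<Sum>j\<in>?K. \<Sum>k\<in>?K. f i * g j * h k * (c j k l * c i l m))"
    by (rule sum.cong[OF refl], rule sum.swap)
  also have "\<dots> = (\<Sum>i\<in>?K. \<Sum>l\<in>?K. f i * (\<Sum>j\<in>?K. \<Sum>k\<in>?K. g j * h k * c j k l) * c i l m)"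
    by (simp add: sum_distrib_left sum_distrib_right mult_ac)
  also have "\<dots> = basis_mult c f (basis_mult c g h) m"
    by (simp add: basis_mult_eq_sum[of _ _ m] inner)
  finally show "basis_mult c (basis_mult c f g) h m = basis_mult c f (basis_mult c g h) m" .
qed

end

lemma sum_listset_Cons:
  "(\<Sum>l\<in>listset (A # As). f l) = (\<Sum>a\<in>A. \<Sum>l\<in>listset As. f (a # l))"
proof -
  have "listset (A # As) = (\<lambda>(a, l). a # l) ` (A \<times> listset As)"
    by (auto simp: set_Cons_def image_iff)
  moreover have "inj_on (\<lambda>(a, l). a # l) (A \<times> listset As)"
    by (auto simp: inj_on_def)
  ultimately show ?thesis
    by (simp add: sum.reindex sum.cartesian_product split_def)
qed

lemma finite_listset: "(\<And>A. A \<in> set As \<Longrightarrow> finite A) \<Longrightarrow> finite (listset As)"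
proof (induction As)
  case (Cons A As)
  have "listset (A # As) = (\<lambda>(a, l). a # l) ` (A \<times> listset As)"
    by (auto simp: set_Cons_def image_iff)
  then show ?case using Cons by simp
qed simp

lemma tensor_const_Nil [simp]:
  "tensor_const c u v [] = of_bool (u = [] \<and> v = [])"
  "tensor_const c [] v (a # w) = 0"
  "tensor_const c u [] (a # w) = 0"
  by (auto simp: tensor_const_def)

context locally_finite_algebra
begin

lemma tensor_assoc:
  "(\<Sum>l\<in>listset (map K w). tensor_const c u v l * tensor_const c l t w)
    = (\<Sum>l\<in>listset (map K w). tensor_const c v t l * tensor_const c u l w)"
proof (induction w arbitrary: u v t)
  case Nil
  show ?case by (cases u; cases v; cases t) simp_all
next
  case (Cons a w)
  show ?case
  proof (cases "u = [] \<or> v = [] \<or> t = []")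
    case True
    then show ?thesis
      by (auto simp: sum_listset_Cons simp del: listset.simps)
  next
    case False
    then obtain i u' j v' k t' where [simp]: "u = i # u'" "v = j # v'" "t = k # t'"
      by (meson neq_Nil_conv)
    have "(\<Sum>l\<in>listset (map K (a # w)). tensor_const c u v l * tensor_const c l t (a # w))
      = (\<Sum>b\<in>K a. c i j b * c b k a) *
        (\<Sum>l\<in>listset (map K w). tensor_const c u' v' l * tensor_const c l t' w)"
      by (simp add: sum_listset_Cons tensor_const_Cons sum_product mult_ac del: listset.simps)
    also have "\<dots> = (\<Sum>b\<in>K a. c j k b * c i b a) *
        (\<Sum>l\<in>listset (map K w). tensor_const c v' t' l * tensor_const c u' l w)"
      by (simp only: Cons.IH assoc)
    also have "\<dots> = (\<Sum>l\<in>listset (map K (a # w)). tensor_const c v t l * tensor_const c u l (a # w))"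
      by (simp add: sum_listset_Cons tensor_const_Cons sum_product mult_ac del: listset.simps)
    finally show ?thesis .
  qed
qed

lemma listset_K_eq: "l \<in> listset (map K w) \<Longrightarrow> listset (map K l) = listset (map K w)"
  by (induction w arbitrary: l) (auto simp: set_Cons_def K_eq)

lemma tensor_supp:
  "tensor_const c u v w \<noteq> 0 \<Longrightarrow> u \<in> listset (map K w) \<and> v \<in> listset (map K w)"
proof (induction w arbitrary: u v)
  case (Cons a w)
  then obtain i u' j v' where "u = i # u'" "v = j # v'"
    by (metis neq_Nil_conv tensor_const_Nil(2,3))
  then show ?case
    using Cons.IH[of u' v'] Cons.prems supp[of i j a]
    by (cases "c i j a = 0"; cases "tensor_const c u' v' w = 0")
       (auto simp: tensor_const_Cons set_Cons_def)
qed (auto split: if_splits)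

text \<open>
  Tensor powers inherit the locale, so that it applies to \<open>R\<close>, to words over \<open>R\<close> and to lists of
  such words alike.
\<close>

lemma tensor: "locally_finite_algebra (tensor_const c) (\<lambda>w. listset (map K w))"
proof
  show "finite (listset (map K w))" for w
    by (rule finite_listset) (auto simp: finite_K)
qed (use tensor_supp listset_K_eq tensor_assoc in auto)

lemma basis_mult_tensor_Nil: "basis_mult (tensor_const c) F G [] = F [] * G []"
  by (simp add: locally_finite_algebra.basis_mult_eq_sum[OF tensor])

text \<open>
  Splitting off the first tensor factor turns statements about words into inductions.
\<close>

lemma basis_mult_tensor_Cons:
  "basis_mult (tensor_const c) F G (a # w) = (\<Sum>i\<in>K a. \<Sum>j\<in>K a. c i j a *
     basis_mult (tensor_const c) (\<lambda>u. F (i # u)) (\<lambda>v. G (j # v)) w)"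
proof -
  have "basis_mult (tensor_const c) F G (a # w) =
    (\<Sum>i\<in>K a. \<Sum>u\<in>listset (map K w). \<Sum>j\<in>K a. \<Sum>v\<in>listset (map K w).
       c i j a * (F (i # u) * G (j # v) * tensor_const c u v w))"
    by (simp add: locally_finite_algebra.basis_mult_eq_sum[OF tensor] sum_listset_Cons
        tensor_const_Cons mult_ac del: listset.simps)
  also have "\<dots> = (\<Sum>i\<in>K a. \<Sum>j\<in>K a. c i j a *
     basis_mult (tensor_const c) (\<lambda>u. F (i # u)) (\<lambda>v. G (j # v)) w)"
    unfolding locally_finite_algebra.basis_mult_eq_sum[OF tensor] sum_distrib_left
    by (intro sum.cong refl) (rule sum.swap)
  finally show ?thesis .
qed

end

section \<open>Multiplication in the tensor powers of R\<close>

context locally_finite_algebra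
begin

lemma basis_mult_sum_left:
  "basis_mult c (\<lambda>i. \<Sum>t\<in>S. a t * f t i) g m = (\<Sum>t\<in>S. a t * basis_mult c (f t) g m)"
proof -
  have "basis_mult c (\<lambda>i. \<Sum>t\<in>S. a t * f t i) g m
      = (\<Sum>i\<in>K m. \<Sum>j\<in>K m. \<Sum>t\<in>S. a t * (f t i * g j * c i j m))"
    by (simp add: basis_mult_eq_sum sum_distrib_right sum_distrib_left mult_ac)
  also have "\<dots> = (\<Sum>t\<in>S. \<Sum>i\<in>K m. \<Sum>j\<in>K m. a t * (f t i * g j * c i j m))"
    by (simp only: sum.swap[where B = S])
  finally show ?thesis by (simp add: basis_mult_eq_sum sum_distrib_left)
qed

lemma basis_mult_sum_right:
  "basis_mult c f (\<lambda>j. \<Sum>t\<in>S. a t * g t j) m = (\<Sum>t\<in>S. a t * basis_mult c f (g t) m)"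
proof -
  have "basis_mult c f (\<lambda>j. \<Sum>t\<in>S. a t * g t j) m
      = (\<Sum>i\<in>K m. \<Sum>j\<in>K m. \<Sum>t\<in>S. a t * (f i * g t j * c i j m))"
    by (simp add: basis_mult_eq_sum sum_distrib_right sum_distrib_left mult_ac)
  also have "\<dots> = (\<Sum>t\<in>S. \<Sum>i\<in>K m. \<Sum>j\<in>K m. a t * (f i * g t j * c i j m))"
    by (simp only: sum.swap[where B = S])
  finally show ?thesis by (simp add: basis_mult_eq_sum sum_distrib_left)
qed

lemma basis_mult_lin_left:
  "basis_mult c (\<lambda>i. a * f i + b * f' i) g m = a * basis_mult c f g m + b * basis_mult c f' g m"
  by (simp add: basis_mult_eq_sum sum_distrib_left sum.distrib algebra_simps)

end

lemma rconst_rbasis: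
  "rconst d B i j m \<noteq> 0 \<Longrightarrow> i \<in> rbasis d \<and> j \<in> rbasis d \<and> m \<in> rbasis d"
  by (auto simp: rconst_def split: if_splits)

lemma rconst_Ehat_left: "rconst d B Ehat b a = of_bool (a = b \<and> a \<in> rbasis d)"
  by (auto simp: rconst_def)

lemma rconst_Ehat_right: "rconst d B b Ehat a = of_bool (a = b \<and> a \<in> rbasis d)"
  by (cases b) (auto simp: rconst_def)

lemma listset_replicate: "listset (map (\<lambda>_. A) w) = {u. set u \<subseteq> A \<and> length u = length w}"
proof (induction w)
  case (Cons a w)
  then show ?case by (auto simp: set_Cons_def length_Suc_conv)
qed auto

lemma T_one_Cons: "T_one (a # w) = of_bool (a = Ehat) * T_one w"
  by (simp add: T_one_def)

lemma T_one_Nil [simp]: "T_one [] = 1"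
  by (simp add: T_one_def)

lemma lmult_scale: "lmult d B x (\<lambda>w. c * f w) w = c * lmult d B x f w"
  using lmult_lin[of d B x "\<lambda>_. 0" c f w] by (simp add: lmult_zero)

lemma lmult_cong:
  assumes "set w \<subseteq> rbasis d" "\<And>u. set u \<subseteq> rbasis d \<Longrightarrow> length u = length w \<Longrightarrow> f u = g u"
  shows "lmult d B x f w = lmult d B x g w"
  using assms
proof (induction w arbitrary: f g)
  case (Cons a w)
  have "lmult d B x (\<lambda>v. f (a # v)) w = lmult d B x (\<lambda>v. g (a # v)) w"
    using Cons.prems by (intro Cons.IH) auto
  moreover have "(\<Sum>b\<in>rbasis d. rconst d B (hat x) b a * f (b # w))
      = (\<Sum>b\<in>rbasis d. rconst d B (hat x) b a * g (b # w))"
    using Cons.prems by (intro sum.cong) auto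
  ultimately show ?case by simp
qed simp

text \<open>
  Functions of two words are elements of \<open>T(R) \<otimes> T(R)\<close>; multiplications in different factors commute.
\<close>

lemma lmult_legs_commute:
  "lmult d B x (\<lambda>u. lmult d B y (F u) v) u = lmult d B y (\<lambda>v. lmult d B x (\<lambda>u. F u v) u) v"
proof (induction u arbitrary: F)
  case Nil
  then show ?case by (simp add: lmult_zero)
next
  case (Cons a u)
  have "lmult d B y (\<lambda>v. (\<Sum>b\<in>rbasis d. rconst d B (hat x) b a * F (b # u) v)
         + lmult d B x (\<lambda>u. F (a # u) v) u) v
      = (\<Sum>b\<in>rbasis d. rconst d B (hat x) b a * lmult d B y (F (b # u)) v)
         + lmult d B y (\<lambda>v. lmult d B x (\<lambda>u. F (a # u) v) u) v"
    using lmult_lin[of d B y "\<lambda>v. \<Sum>b\<in>rbasis d. rconst d B (hat x) b a * F (b # u) v" 1]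
    by (simp add: lmult_sum)
  then show ?case by (simp add: Cons.IH)
qed

lemma phi_free_word_Nil: "phi_free d B (word []) = T_one"
proof
  fix w :: "ridx list"
  show "phi_free d B (word []) w = T_one w"
  proof (induction w)
    case Nil
    then show ?case by (simp add: phi_free_Nil word_def)
  next
    case (Cons a w)
    have b: "bounded_supp d 0 (word [] :: gen list \<Rightarrow> 'a)"
      using bounded_supp_word[of "[]" d] by simp
    have "bounded_words d 0 = {[]}" by (auto simp: bounded_words_def)
    moreover have "cop (word [] :: gen list \<Rightarrow> 'a) [] = word []"
      using calculation by (simp add: fun_eq_iff cop_eq_sum[OF b] word_def)
    ultimately show ?case
      using Cons by (simp add: phi_free_Cons[OF b] T_one_Cons R_alg_def basis_alg_def)
  qed
qed

context fin_dim_assoc_algebra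
begin

lemma phi_gen_eq_lmult:
  assumes "x \<in> lie_basis d"
  shows "phi_gen d B x = lmult d B x T_one"
proof -
  have "word [x] \<in> (free_alg (lie_basis d) :: (gen list \<Rightarrow> 'k) set)"
    using assms by (auto simp: free_alg_def word_def)
  then show ?thesis
    using phi_free_word_Cons[of "[]" d x B] assms
    by (simp add: phi_gen_def phi_uea_class phi_free_word_Nil fun_eq_iff)
qed

text \<open>
  \<open>R\<close> is associative because \<open>L\<close> is and because \<open>X\<^sup>\<nu> H\<^sub>\<mu>\<close> is the right action of \<open>L\<close> on its dual.
\<close>

lemma rconst_assoc:
  "(\<Sum>l\<in>rbasis d. rconst d B i j l * rconst d B l k m)
    = (\<Sum>l\<in>rbasis d. rconst d B j k l * rconst d B i l m)"
proof (cases "{i, j, k, m} \<subseteq> rbasis d")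
  case True
  have "(\<Sum>l\<in>rbasis d. rconst d B i j l * rconst d B l k m)
      = (\<Sum>l\<in>rbasis d. rconst0 B i j l * rconst0 B l k m)"
    "(\<Sum>l\<in>rbasis d. rconst d B j k l * rconst d B i l m)
      = (\<Sum>l\<in>rbasis d. rconst0 B j k l * rconst0 B i l m)"
    using True by (auto intro!: sum.cong simp: rconst_def)
  moreover have "(\<Sum>l\<in>rbasis d. rconst0 B i j l * rconst0 B l k m)
      = (\<Sum>l\<in>rbasis d. rconst0 B j k l * rconst0 B i l m)"
    using True
    apply (cases i; cases j; cases k; cases m)
    apply (simp_all add: sum_rbasis)
    apply (rule B_assoc[symmetric]; simp)
    apply (rule B_assoc'; simp)
    done
  ultimately show ?thesis by simp
next
  case False
  then have "rconst d B i j l * rconst d B l k m = 0" "rconst d B j k l * rconst d B i l m = 0" for l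
    using rconst_rbasis by (metis empty_subsetI insert_subset mult_eq_0_iff)+
  then show ?thesis by (simp only: sum.neutral_const)
qed

sublocale R: locally_finite_algebra "rconst d B" "\<lambda>_. rbasis d"
  by standard (use rconst_rbasis[of d B] rconst_assoc in auto)

abbreviation mul where "mul \<equiv> basis_mult (tensor_const (rconst d B))"

abbreviation mul2 where "mul2 \<equiv> basis_mult (tensor_const (tensor_const (rconst d B)))"

abbreviation words :: "ridx list \<Rightarrow> ridx list set"
  where "words w \<equiv> {u. set u \<subseteq> rbasis d \<and> length u = length w}"

sublocale T: locally_finite_algebra "tensor_const (rconst d B)" words
  using R.tensor by (simp only: listset_replicate)

sublocale T2: locally_finite_algebra "tensor_const (tensor_const (rconst d B))" "\<lambda>W. listset (map words W)"
  by (rule T.tensor)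

text \<open>
  The product in \<open>T(R) \<otimes> T(R)\<close>, written through products in the second factor.
\<close>

lemma mul2_pair:
  "mul2 F G [u, v] =
    (\<Sum>u1\<in>words u. \<Sum>u2\<in>words u. tensor_const (rconst d B) u1 u2 u *
      mul (\<lambda>v. F [u1, v]) (\<lambda>v. G [u2, v]) v)"
  by (simp add: T.basis_mult_tensor_Cons T.basis_mult_tensor_Nil T.basis_mult_eq_sum[of _ _ v] mult_ac)

lemma mul_T_one_left:
  assumes "set w \<subseteq> rbasis d"
  shows "mul T_one f w = f w"
  using assms
proof (induction w arbitrary: f)
  case (Cons a w)
  have "mul T_one f (a # w) = (\<Sum>i\<in>rbasis d. \<Sum>j\<in>rbasis d. rconst d B i j a *
      (of_bool (i = Ehat) * f (j # w)))"
    using Cons T.basis_mult_sum_left[of "\<lambda>_. of_bool (_ = Ehat)" "\<lambda>_. T_one" "{()}"]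
    by (simp add: R.basis_mult_tensor_Cons T_one_Cons)
  also have "\<dots> = f (a # w)"
    using Cons.prems by (simp add: sum.swap[of _ "rbasis d" "rbasis d"] of_bool_def
        if_distrib[of "\<lambda>t. _ * t"] if_distrib[of "\<lambda>t. t * _"] rconst_Ehat_left cong: if_cong)
  finally show ?case .
qed (simp add: R.basis_mult_tensor_Nil)

lemma mul_T_one_right:
  assumes "set w \<subseteq> rbasis d"
  shows "mul f T_one w = f w"
  using assms
proof (induction w arbitrary: f)
  case (Cons a w)
  have "mul f T_one (a # w) = (\<Sum>i\<in>rbasis d. \<Sum>j\<in>rbasis d. rconst d B i j a *
      (of_bool (j = Ehat) * f (i # w)))"
    using Cons T.basis_mult_sum_right[of _ "\<lambda>_. of_bool (_ = Ehat)" "\<lambda>_. T_one" "{()}"]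
    by (simp add: R.basis_mult_tensor_Cons T_one_Cons)
  also have "\<dots> = f (a # w)"
    using Cons.prems by (simp add: of_bool_def
        if_distrib[of "\<lambda>t. _ * t"] if_distrib[of "\<lambda>t. t * _"] rconst_Ehat_right cong: if_cong)
  finally show ?case .
qed (simp add: R.basis_mult_tensor_Nil)

text \<open>
  The image of a generator in \<open>T(R)\<close> is \<open>lmult d B x T_one\<close> (\<open>phi_gen_eq_lmult\<close>), so the recursively
  defined \<open>lmult\<close> is multiplication by this image.  With associativity it moves through products.
\<close>

lemma mul_lmult_T_one:
  assumes "set w \<subseteq> rbasis d" "x \<in> lie_basis d"
  shows "mul (lmult d B x T_one) f w = lmult d B x f w"
  using assms(1)
proof (induction w arbitrary: f)
  case (Cons a w)
  let ?r = "rconst d B"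
  have hx: "hat x \<in> rbasis d" by (rule hat_rbasis[OF assms(2)])
  have 1: "lmult d B x T_one (i # u) = of_bool (i = hat x) * T_one u + of_bool (i = Ehat) * lmult d B x T_one u"
    for i u
    using hx by (simp add: T_one_Cons lmult_scale rconst_Ehat_right lmult_zero
        of_bool_def if_distrib[of "\<lambda>t. _ * t"] if_distrib[of "\<lambda>t. t * _"] cong: if_cong)
  have "mul (lmult d B x T_one) f (a # w) = (\<Sum>i\<in>rbasis d. \<Sum>j\<in>rbasis d. ?r i j a *
      (of_bool (i = hat x) * f (j # w) + of_bool (i = Ehat) * lmult d B x (\<lambda>v. f (j # v)) w))"
    using Cons by (simp add: R.basis_mult_tensor_Cons 1 T.basis_mult_lin_left mul_T_one_left del: lmult.simps)
  also have "\<dots> = (\<Sum>j\<in>rbasis d. \<Sum>i\<in>rbasis d. 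
      of_bool (i = hat x) * (?r i j a * f (j # w)) + of_bool (i = Ehat) * (?r i j a * lmult d B x (\<lambda>v. f (j # v)) w))"
    by (subst sum.swap) (simp add: algebra_simps)
  also have "\<dots> = (\<Sum>j\<in>rbasis d. ?r (hat x) j a * f (j # w) + ?r Ehat j a * lmult d B x (\<lambda>v. f (j # v)) w)"
    using hx by (simp add: sum.distrib of_bool_def if_distrib[of "\<lambda>t. t * _"] cong: if_cong)
  also have "\<dots> = lmult d B x f (a # w)"
    using Cons.prems by (simp add: sum.distrib rconst_Ehat_left of_bool_def if_distrib[of "\<lambda>t. t * _"] cong: if_cong)
  finally show ?case .
qed (simp add: R.basis_mult_tensor_Nil)

lemma lmult_mul:
  assumes "set w \<subseteq> rbasis d" "x \<in> lie_basis d"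
  shows "lmult d B x (mul f g) w = mul (lmult d B x f) g w"
proof -
  have "lmult d B x (mul f g) w = mul (mul (lmult d B x T_one) f) g w"
    using assms by (simp add: mul_lmult_T_one[symmetric] T.basis_mult_assoc)
  also have "\<dots> = mul (lmult d B x f) g w"
    using assms by (intro T.basis_mult_cong) (simp_all add: mul_lmult_T_one)
  finally show ?thesis .
qed

end

section \<open>The cocycle as a product of linear factors\<close>

lemma lmult_minus: "lmult d B x (\<lambda>w. - f w) w = - lmult d B x f w"
  using lmult_scale[of d B x "- 1" f w] by simp

lemma lmult_diff: "lmult d B x (\<lambda>w. f w - g w) w = lmult d B x f w - lmult d B x g w"
  using lmult_lin[of d B x f "- 1" g w] by simp

lemma lmult_T_one_Cons:
  assumes "x \<in> lie_basis d"
  shows "lmult d B x T_one (a # w) =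
    of_bool (a = hat x) * T_one w + of_bool (a = Ehat) * lmult d B x T_one w"
proof -
  have "hat x \<in> rbasis d"
    using assms by (auto simp: lie_basis_def)
  then show ?thesis
    by (simp add: T_one_Cons lmult_scale rconst_Ehat_right lmult_zero
        of_bool_def if_distrib[of "\<lambda>t. _ * t"] if_distrib[of "\<lambda>t. t * _"] cong: if_cong)
qed

lemma T_one_append: "T_one (u @ v) = T_one u * T_one v"
  by (simp add: T_one_def)

lemma hat_neq_Ehat [simp]: "hat x \<noteq> Ehat" "Ehat \<noteq> hat x"
  by (cases x; simp)+

lemma lmult_T_one_append:
  assumes "x \<in> lie_basis d"
  shows "lmult d B x T_one (u @ v) =
    lmult d B x T_one u * T_one v + T_one u * lmult d B x T_one v"
proof (induction u)
  case (Cons a u)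
  show ?case
    by (cases "a = Ehat"; cases "a = hat x")
       (simp_all add: lmult_T_one_Cons[OF assms] T_one_Cons Cons T_one_append del: lmult.simps)
qed simp

text \<open>
  The coordinates of \<open>\<Prod>\<^sub>i (1 - x\<^sub>i)\<close> with \<open>x\<^sub>i = X\<^sup>\<nu> \<otimes> (H\<^sub>\<nu>)\<^sub>i\<close>, by recursion on the second word: its
  first letter says whether the factor \<open>i = 1\<close> contributes \<open>1\<close> or \<open>- x\<^sub>1\<close>.
\<close>

fun cocycle ::
    "nat \<Rightarrow> (nat \<Rightarrow> nat \<Rightarrow> nat \<Rightarrow> 'k::field_char_0) \<Rightarrow> ridx list \<Rightarrow> ridx list \<Rightarrow> 'k"
  where
    "cocycle d B u [] = T_one u"
  | "cocycle d B u (Ehat # v) = cocycle d B u v"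
  | "cocycle d B u (Hhat \<sigma> # v) = - lmult d B (GenX \<sigma>) (\<lambda>u. cocycle d B u v) u"
  | "cocycle d B u (Xhat \<sigma> # v) = 0"

lemma rconst_Xhat_zero: "a \<notin> Xhat ` {..<d} \<Longrightarrow> rconst d B (Xhat \<sigma>) b a = 0"
  by (cases b; cases a) (auto simp: rconst_def)

lemma rconst_Hhat_zero: "a \<notin> Hhat ` {..<d} \<Longrightarrow> rconst d B (Hhat \<sigma>) b a = 0"
  by (cases b; cases a) (auto simp: rconst_def)

lemma cocycle_Nil: "cocycle d B [] v = T_one v"
proof (induction v)
  case (Cons b v)
  then show ?case by (cases b) (simp_all add: T_one_Cons)
qed simp

text \<open>
  The next three lemmas expand the product by the first letter of the first word instead, which is how
  the twisting equation determines its solution.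
\<close>

lemma cocycle_Ehat: "cocycle d B (Ehat # u) v = cocycle d B u v"
proof (induction v arbitrary: u)
  case (Cons b v)
  then show ?case by (cases b) (simp_all add: rconst_Xhat_zero image_iff)
qed (simp add: T_one_Cons)

lemma cocycle_zero:
  assumes "a \<noteq> Ehat" "a \<notin> Xhat ` {..<d}"
  shows "cocycle d B (a # u) v = 0"
proof (induction v arbitrary: u)
  case (Cons b v)
  then show ?case using assms by (cases b) (simp_all add: rconst_Xhat_zero lmult_zero)
qed (use assms in \<open>simp add: T_one_Cons\<close>)

context fin_dim_assoc_algebra
begin

text \<open>
  The coefficient of \<open>X\<^sup>\<nu>\<close> in the first factor is \<open>- \<Sum>\<^sub>i (H\<^sub>\<nu>)\<^sub>i \<Prod>\<^sub>j\<^sub>\<noteq>\<^sub>i (1 - x\<^sub>j)\<close>, because \<open>X\<^sup>\<nu>\<close> squares to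
  zero there.  It equals \<open>- [H\<^sub>\<nu> \<otimes> 1, \<Phi>] - (1 \<otimes> H\<^sub>\<nu>) \<Phi>\<close>: the bracket is a derivation, and
  \<open>[H\<^sub>\<nu> \<otimes> 1, x\<^sub>i] = - (H\<^sub>\<nu>)\<^sub>i x\<^sub>i\<close> cancels the quadratic terms of \<open>(H\<^sub>\<nu>)\<^sub>i (1 - x\<^sub>i)\<close>.
\<close>

lemma cocycle_Xhat:
  assumes "\<nu> < d" "set u \<subseteq> rbasis d" "set v \<subseteq> rbasis d"
  shows "cocycle d B (Xhat \<nu> # u) v =
    mul (\<lambda>u. cocycle d B u v) (lmult d B (GenH \<nu>) T_one) u
    - lmult d B (GenH \<nu>) (\<lambda>u. cocycle d B u v) u - lmult d B (GenH \<nu>) (cocycle d B u) v"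
  using assms(2,3)
proof (induction v arbitrary: u)
  case Nil
  then show ?case
    using assms(1) by (simp add: T_one_Cons mul_T_one_left)
next
  case (Cons b v)
  let ?h = "lmult d B (GenH \<nu>) T_one"
  show ?case
  proof (cases b)
    case Ehat
    have "(\<Sum>b\<in>rbasis d. rconst d B (Hhat \<nu>) b Ehat * cocycle d B u (b # v)) = 0"
      by (simp add: rconst_Hhat_zero image_iff)
    then show ?thesis
      using Cons Ehat by simp
  next
    case (Xhat \<sigma>)
    have "(\<Sum>b\<in>rbasis d. rconst d B (Hhat \<nu>) b (Xhat \<sigma>) * cocycle d B u (b # v)) = 0"
      by (simp add: rconst_Hhat_zero image_iff)
    then show ?thesis
      using Xhat lmult_zero
      by (simp add: T.basis_mult_eq_sum lmult_zero)
  next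
    case (Hhat \<sigma>)
    then have \<sigma>: "\<sigma> < d" and v: "set v \<subseteq> rbasis d" using Cons.prems by auto
    let ?X = "lmult d B (GenX \<sigma>)" and ?H = "lmult d B (GenH \<nu>)" and ?g = "\<lambda>u. cocycle d B u v"
    have "(\<Sum>b\<in>rbasis d. rconst d B (Xhat \<sigma>) b (Xhat \<nu>) * cocycle d B (b # u) v)
        = of_bool (\<sigma> = \<nu>) * ?g u"
      using \<sigma> assms(1) by (auto simp: sum_rbasis cocycle_Ehat cocycle_zero image_iff rconst_def)
    moreover have "?X (\<lambda>u. cocycle d B (Xhat \<nu> # u) v) u
        = ?X (\<lambda>u. mul ?g ?h u - ?H ?g u - ?H (cocycle d B u) v) u"
      using Cons.prems by (intro lmult_cong Cons.IH v) auto
    ultimately have lhs: "cocycle d B (Xhat \<nu> # u) (b # v)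
        = - (of_bool (\<sigma> = \<nu>) * ?g u + mul (?X ?g) ?h u - ?X (?H ?g) u
            - ?H (\<lambda>v. ?X (\<lambda>u. cocycle d B u v) u) v)"
      using Hhat Cons.prems \<sigma>
      by (simp add: lmult_diff lmult_mul lmult_legs_commute[of d B "GenX \<sigma>"])
    \<comment> \<open>the terms with structure constants in \<open>br\<close> and \<open>rhs\<close> cancel\<close>
    have br: "?X (?H ?g) u = ?H (?X ?g) u + (\<Sum>\<mu><d. B \<nu> \<mu> \<sigma> * lmult d B (GenX \<mu>) ?g u)"
      using lmult_bracket[of "GenH \<nu>" "GenX \<sigma>" ?g u] \<sigma> assms(1)
      by (simp add: sum_lie_basis sum_negf algebra_simps)
    have "(\<Sum>b\<in>rbasis d. rconst d B (Hhat \<nu>) b (Hhat \<sigma>) * cocycle d B u (b # v))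
        = of_bool (\<sigma> = \<nu>) * ?g u - (\<Sum>\<mu><d. B \<nu> \<mu> \<sigma> * lmult d B (GenX \<mu>) ?g u)"
      using \<sigma> assms(1) by (auto simp: sum_rbasis rconst_def sum_negf)
    then have rhs: "?H (cocycle d B u) (b # v) = of_bool (\<sigma> = \<nu>) * ?g u
        - (\<Sum>\<mu><d. B \<nu> \<mu> \<sigma> * lmult d B (GenX \<mu>) ?g u)
        - ?H (\<lambda>v. ?X (\<lambda>u. cocycle d B u v) u) v"
      using Hhat by (simp add: lmult_minus)
    have "mul (\<lambda>u. - ?X ?g u) ?h u = - mul (?X ?g) ?h u"
      by (simp add: T.basis_mult_eq_sum sum_negf)
    then show ?thesis
      unfolding lhs rhs using Hhat by (simp add: lmult_minus br)
  qed
qed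

end

section \<open>The twisting equation determines the cocycle\<close>

lemma sum_singleton_words:
  "(\<Sum>w | set w \<subseteq> A \<and> length w = Suc 0. f w) = (\<Sum>a\<in>A. f [a])"
proof -
  have "{w. set w \<subseteq> A \<and> length w = Suc 0} = (\<lambda>a. [a]) ` A"
    by (auto simp: length_Suc_conv)
  then show ?thesis by (simp add: sum.reindex inj_on_def)
qed

lemma T_one_eq_replicate: "T_one w = of_bool (w = replicate (length w) Ehat)"
  by (induction w) (simp_all add: T_one_Cons)

lemma list_update_replicate_eq_iff:
  assumes "j < k" "length v = k"
  shows "v = (replicate k e)[j := x] \<longleftrightarrow> v ! j = x \<and> (\<forall>l<k. l \<noteq> j \<longrightarrow> v ! l = e)"
  using assms by (auto simp: list_eq_iff_nth_eq nth_list_update)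

text \<open>
  Every word in \<open>\<Phi>\<^sup>1\<^sup>,\<^sup>1\<^sub>1\<^sub>j\<close> other than the unit has one \<open>X\<^sup>\<nu>\<close>, at its head, and one \<open>H\<^sub>\<nu>\<close>; this is the form
  that the product of these elements keeps (\<open>foldr_place\<close>).
\<close>

lemma place_Phi11:
  assumes "j < k" "length v = k"
  shows "place (Suc k) 0 (Suc j) (Phi11 d) (a # v) = of_bool (a = Ehat) * T_one v
    - (\<Sum>\<nu><d. of_bool (a = Xhat \<nu>) * of_bool (v = (replicate k Ehat)[j := Hhat \<nu>]))"
proof -
  have "(\<Prod>l\<in>{..<Suc k} - {0, Suc j}. of_bool ((a # v) ! l = Ehat) :: 'a)
      = (\<Prod>l\<in>Suc ` ({..<k} - {j}). of_bool ((a # v) ! l = Ehat))"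
    by (intro prod.cong) (auto simp: image_iff gr0_conv_Suc less_Suc_eq_0_disj)
  also have "\<dots> = (\<Prod>l\<in>{..<k} - {j}. of_bool (v ! l = Ehat))"
    by (simp add: prod.reindex)
  also have "\<dots> = of_bool (\<forall>l<k. l \<noteq> j \<longrightarrow> v ! l = Ehat)"
  proof (cases "\<forall>l<k. l \<noteq> j \<longrightarrow> v ! l = Ehat")
    case False
    then obtain l where "l \<in> {..<k} - {j}" "v ! l \<noteq> Ehat" by auto
    then have "(\<Prod>l\<in>{..<k} - {j}. of_bool (v ! l = Ehat) :: 'a) = 0"
      by (intro prod_zero) auto
    then show ?thesis using False by simp
  qed auto
  finally have 1: "(\<Prod>l\<in>{..<Suc k} - {0, Suc j}. of_bool ((a # v) ! l = Ehat) :: 'a)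
      = of_bool (\<forall>l<k. l \<noteq> j \<longrightarrow> v ! l = Ehat)" .
  have 2: "T_one v = (of_bool (v = (replicate k Ehat)[j := Ehat]) :: 'a)"
  proof -
    have "(replicate k Ehat)[j := Ehat] = replicate k Ehat"
      using assms by (simp add: list_eq_iff_nth_eq nth_list_update)
    then show ?thesis using assms by (simp add: T_one_eq_replicate)
  qed
  show ?thesis
    using assms unfolding place_def 1 2 list_update_replicate_eq_iff[OF assms] Phi11_def
    by (simp only: left_diff_distrib sum_distrib_right of_bool_conj mult.assoc nth_Cons_0
        nth_Cons_Suc length_Cons simp_thms if_True)
qed

text \<open>
  The generator \<open>H\<^sub>\<nu>\<close> is primitive: its image in a tensor power of \<open>R\<close> is the sum of the \<open>(H\<^sub>\<nu>)\<^sub>j\<close>.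
\<close>

lemma sum_sites_eq_lmult:
  assumes "\<nu> < d"
  shows "(\<Sum>j<length v. of_bool (v = (replicate (length v) Ehat)[j := Hhat \<nu>]))
    = lmult d B (GenH \<nu>) T_one v"
proof (induction v)
  case (Cons a v)
  have "(\<Sum>j<length (a # v). of_bool (a # v = (replicate (length (a # v)) Ehat)[j := Hhat \<nu>]) :: 'a)
      = of_bool (a = Hhat \<nu>) * T_one v + of_bool (a = Ehat) *
        (\<Sum>j<length v. of_bool (v = (replicate (length v) Ehat)[j := Hhat \<nu>]))"
    by (simp add: sum.lessThan_Suc_shift T_one_eq_replicate sum_distrib_left of_bool_conj del: sum.lessThan_Suc)
  then show ?case
    using assms by (simp add: Cons lmult_T_one_Cons del: lmult.simps)
qed simp

context fin_dim_assoc_algebra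
begin

text \<open>
  In the product of the \<open>\<Phi>\<^sup>1\<^sup>,\<^sup>1\<^sub>1\<^sub>j\<close> all terms with two or more factors \<open>X\<close> vanish, since \<open>X\<^sup>\<mu> X\<^sup>\<nu> = 0\<close> in
  \<open>R\<close>; hence the linear terms just add up.
\<close>

lemma foldr_place:
  assumes "set js \<subseteq> {..<k}" "length v = k" "set v \<subseteq> rbasis d" "a \<in> rbasis d"
  shows "foldr (\<lambda>j t. place (k + 1) 0 j (Phi11 d) \<otimes>\<^bsub>R_pow d B (k + 1)\<^esub> t) (map Suc js)
      \<one>\<^bsub>R_pow d B (k + 1)\<^esub> (a # v) = of_bool (a = Ehat) * T_one v
      - (\<Sum>\<nu><d. of_bool (a = Xhat \<nu>) * (\<Sum>j\<leftarrow>js. of_bool (v = (replicate k Ehat)[j := Hhat \<nu>])))"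
  using assms
proof (induction js arbitrary: a v)
  case Nil
  then have "T_one v = (of_bool (v = replicate k Ehat) :: 'k)"
    by (simp add: T_one_eq_replicate)
  then show ?case
    by (simp add: R_pow_def basis_alg_def)
next
  case (Cons j js)
  define t where "t = foldr (\<lambda>j t. place (k + 1) 0 j (Phi11 d) \<otimes>\<^bsub>R_pow d B (k + 1)\<^esub> t) (map Suc js)
      \<one>\<^bsub>R_pow d B (k + 1)\<^esub>"
  define s where "s j \<nu> v = (of_bool (v = (replicate k Ehat)[j := Hhat \<nu>]) :: 'k)" for j \<nu> v
  have t: "t (a # v) = of_bool (a = Ehat) * T_one v
      - (\<Sum>\<nu><d. of_bool (a = Xhat \<nu>) * (\<Sum>j\<leftarrow>js. s j \<nu> v))"
    if "length v = k" "set v \<subseteq> rbasis d" "a \<in> rbasis d" for a v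
    using Cons.IH[OF _ that] Cons.prems(1) by (simp add: t_def s_def)
  have tE: "mul (s j \<nu>) (\<lambda>v. t (Ehat # v)) v = s j \<nu> v" for \<nu>
  proof -
    have "mul (s j \<nu>) (\<lambda>v. t (Ehat # v)) v = mul (s j \<nu>) T_one v"
      using Cons.prems by (intro T.basis_mult_cong) (auto simp: t)
    then show ?thesis using Cons.prems by (simp add: mul_T_one_right)
  qed
  have tH: "mul f (\<lambda>v. t (Hhat \<mu> # v)) v = 0" if "\<mu> < d" for f \<mu>
  proof -
    have "mul f (\<lambda>v. t (Hhat \<mu> # v)) v = mul f (\<lambda>_. 0) v"
      using Cons.prems that by (intro T.basis_mult_cong) (auto simp: t)
    then show ?thesis by (simp add: T.basis_mult_eq_sum)
  qed
  have p: "mul (\<lambda>u. place (k + 1) 0 (Suc j) (Phi11 d) (i # u)) g v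
      = of_bool (i = Ehat) * g v + (\<Sum>\<nu><d. (- of_bool (i = Xhat \<nu>)) * mul (s j \<nu>) g v)" for i g
  proof -
    have "mul (\<lambda>u. place (k + 1) 0 (Suc j) (Phi11 d) (i # u)) g v =
      mul (\<lambda>u. of_bool (i = Ehat) * T_one u + 1 * (\<Sum>\<nu><d. (- of_bool (i = Xhat \<nu>)) * s j \<nu> u)) g v"
      using Cons.prems by (intro T.basis_mult_cong) (auto simp: place_Phi11 s_def sum_negf)
    then show ?thesis
      using Cons.prems by (simp only: T.basis_mult_lin_left T.basis_mult_sum_left mul_T_one_left) simp
  qed
  have X: "(\<Sum>c\<in>rbasis d. rconst d B (Xhat \<nu>) c a * mul (s j \<nu>) (\<lambda>v. t (c # v)) v)
      = of_bool (a = Xhat \<nu>) * s j \<nu> v" if "\<nu> < d" for \<nu>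
    using that Cons.prems by (auto simp: sum_rbasis tE tH rconst_def)
  have "mul (place (k + 1) 0 (Suc j) (Phi11 d)) t (a # v)
      = (\<Sum>i\<in>rbasis d. \<Sum>c\<in>rbasis d. rconst d B i c a *
         (of_bool (i = Ehat) * t (c # v) + (\<Sum>\<nu><d. (- of_bool (i = Xhat \<nu>)) * mul (s j \<nu>) (\<lambda>v. t (c # v)) v)))"
    unfolding R.basis_mult_tensor_Cons p ..
  also have "\<dots> = (\<Sum>c\<in>rbasis d. rconst d B Ehat c a * t (c # v))
      - (\<Sum>\<nu><d. \<Sum>c\<in>rbasis d. rconst d B (Xhat \<nu>) c a * mul (s j \<nu>) (\<lambda>v. t (c # v)) v)"
  proof -
    let ?m = "\<lambda>\<nu> c. mul (s j \<nu>) (\<lambda>v. t (c # v)) v"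
    have "(\<Sum>i\<in>rbasis d. \<Sum>c\<in>rbasis d. rconst d B i c a *
         (of_bool (i = Ehat) * t (c # v) + (\<Sum>\<nu><d. (- of_bool (i = Xhat \<nu>)) * ?m \<nu> c)))
       = (\<Sum>i\<in>rbasis d. \<Sum>c\<in>rbasis d. of_bool (i = Ehat) * (rconst d B i c a * t (c # v)))
       - (\<Sum>i\<in>rbasis d. \<Sum>c\<in>rbasis d. \<Sum>\<nu><d. of_bool (i = Xhat \<nu>) * (rconst d B i c a * ?m \<nu> c))"
      by (simp add: distrib_left sum.distrib sum_distrib_left sum_negf mult_ac
          right_diff_distrib sum_subtractf del: sum_of_bool_mult_eq sum_mult_of_bool_eq)
    also have "(\<Sum>i\<in>rbasis d. \<Sum>c\<in>rbasis d. of_bool (i = Ehat) * (rconst d B i c a * t (c # v)))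
       = (\<Sum>c\<in>rbasis d. rconst d B Ehat c a * t (c # v))"
      by (subst sum.swap) (simp only: sum_of_bool_pick finite_rbasis basis_mem)
    also have "(\<Sum>i\<in>rbasis d. \<Sum>c\<in>rbasis d. \<Sum>\<nu><d. of_bool (i = Xhat \<nu>) * (rconst d B i c a * ?m \<nu> c))
       = (\<Sum>c\<in>rbasis d. \<Sum>\<nu><d. \<Sum>i\<in>rbasis d. of_bool (i = Xhat \<nu>) * (rconst d B i c a * ?m \<nu> c))"
      by (rule sum_rotate3)
    also have "\<dots> = (\<Sum>c\<in>rbasis d. \<Sum>\<nu><d. rconst d B (Xhat \<nu>) c a * ?m \<nu> c)"
      by (intro sum.cong refl) (simp only: sum_of_bool_pick finite_rbasis basis_mem lessThan_iff)
    also have "\<dots> = (\<Sum>\<nu><d. \<Sum>c\<in>rbasis d. rconst d B (Xhat \<nu>) c a * ?m \<nu> c)"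
      by (rule sum.swap)
    finally show ?thesis .
  qed
  also have "\<dots> = t (a # v) - (\<Sum>\<nu><d. of_bool (a = Xhat \<nu>) * s j \<nu> v)"
    using Cons.prems by (simp add: X rconst_Ehat_left of_bool_def if_distrib[of "\<lambda>t. t * _"] cong: if_cong)
  finally show ?case
    using Cons.prems t[of v a] unfolding t_def[symmetric]
    by (simp add: R_pow_def basis_alg_def t_def s_def sum.distrib distrib_left)
qed

lemma Phi1_Cons:
  assumes "set v \<subseteq> rbasis d" "a \<in> rbasis d"
  shows "Phi1 d B (length v) (a # v) = of_bool (a = Ehat) * T_one v
      - (\<Sum>\<nu><d. of_bool (a = Xhat \<nu>) * lmult d B (GenH \<nu>) T_one v)"
proof -
  have eq: "[1..<length v + 1] = map Suc [0..<length v]"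
    by (simp add: map_Suc_upt)
  have "{0..<length v} = {..<length v}" by auto
  moreover have "(\<Sum>\<nu><d. of_bool (a = Xhat \<nu>) *
        (\<Sum>j<length v. of_bool (v = (replicate (length v) Ehat)[j := Hhat \<nu>])))
      = (\<Sum>\<nu><d. of_bool (a = Xhat \<nu>) * lmult d B (GenH \<nu>) T_one v)"
    by (intro sum.cong refl) (simp only: sum_sites_eq_lmult[where B = B] lessThan_iff)
  ultimately show ?thesis
    using foldr_place[OF _ refl assms, of "[0..<length v]"]
    unfolding Phi1_def eq
    by (simp add: sum_list_distinct_conv_sum_set
        del: sum_of_bool_mult_eq sum_mult_of_bool_eq sum_of_bool_eq)
qed


lemma mul2_product:
  assumes "\<And>u v. F [u, v] = f u * g v"
  shows "mul2 F G [u, v] =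
    mul f (\<lambda>u. mul g (\<lambda>v. G [u, v]) v) u"
proof -
  have "mul (\<lambda>v. F [u1, v]) (\<lambda>v. G [u2, v]) v = f u1 * mul g (\<lambda>v. G [u2, v]) v" for u1 u2
    by (simp add: assms T.basis_mult_eq_sum sum_distrib_left mult_ac)
  then show ?thesis
    by (simp add: mul2_pair T.basis_mult_eq_sum[of _ _ u] mult_ac)
qed

text \<open>
  Only the components of the twisting equation whose first word is a single letter are needed; this
  lemma splits it off.
\<close>

lemma mul3_Cons:
  "mul2 F G ([a] # W) =
    (\<Sum>i\<in>rbasis d. \<Sum>c\<in>rbasis d. rconst d B i c a *
      mul2
        (\<lambda>W. F ([i] # W)) (\<lambda>W. G ([c] # W)) W)"
proof -
  have "tensor_const (rconst d B) [i] [c] [a] = rconst d B i c a" for i c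
    by (simp add: tensor_const_Cons)
  then show ?thesis
    by (simp add: T.basis_mult_tensor_Cons sum_singleton_words)
qed

context
  fixes \<Phi> :: "ridx list list \<Rightarrow> 'k"
  assumes normalized: "normalized \<Phi>"
    and twisting: "twisting_equation d B \<Phi>"
    and expands: "expands_Phi11 d B \<Phi>"
begin

lemma expansion_single:
  assumes "set v \<subseteq> rbasis d" "a \<in> rbasis d"
  shows "\<Phi> [[a], v] = of_bool (a = Ehat) * T_one v
      - (\<Sum>\<nu><d. of_bool (a = Xhat \<nu>) * lmult d B (GenH \<nu>) T_one v)"
proof (cases "v = []")
  case True
  have "\<Phi> [[a], []] = T_one [a]"
    using normalized unfolding normalized_def by metis
  then show ?thesis using True by (simp add: T_one_Cons)
next
  case False
  then have "length v \<ge> 1" by (cases v) auto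
  then have "\<Phi> [[a], v] = Phi1 d B (length v) ([a] @ v)"
    using expands unfolding expands_Phi11_def by simp
  then show ?thesis
    using Phi1_Cons[OF assms] by simp
qed

text \<open>
  The two sides of the twisting equation when the first word is a single letter \<open>a\<close>.  On the left,
  \<open>\<Phi>\<^sub>1\<^sub>2\<close> is then \<open>1 - X\<^sup>\<nu> \<otimes> H\<^sub>\<nu>\<close>, and since \<open>H X = X X = 0\<close> the letter \<open>X\<^sup>\<nu>\<close> survives only after
  the unit.
\<close>

lemma twisting_lhs:
  assumes "a \<in> rbasis d" "set u \<subseteq> rbasis d" "set v \<subseteq> rbasis d"
  shows "mul2 (Delta_id \<Phi>) (leg12 \<Phi>) [[a], u, v] =
    \<Phi> [a # u, v] - (\<Sum>\<nu><d. of_bool (a = Xhat \<nu>) *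
      mul (\<lambda>u. \<Phi> [Ehat # u, v]) (lmult d B (GenH \<nu>) T_one) u)"
proof -
  have inner: "mul2
        (\<lambda>W. Delta_id \<Phi> ([i] # W)) (\<lambda>W. leg12 \<Phi> ([c] # W)) [u, v]
      = mul (\<lambda>u. \<Phi> [i # u, v]) (\<lambda>u. \<Phi> [[c], u]) u" for i c
  proof -
    have "mul (\<lambda>v. \<Phi> [i # u1, v]) (\<lambda>v. \<Phi> [[c], u2] * T_one v) v = \<Phi> [i # u1, v] * \<Phi> [[c], u2]" for u1 u2
      using T.basis_mult_sum_right[of "\<lambda>v. \<Phi> [i # u1, v]" "\<lambda>_. \<Phi> [[c], u2]" "\<lambda>_. T_one" "{()}" v]
        mul_T_one_right[OF assms(3)] by (simp add: mult.commute)
    then show ?thesis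
      by (simp add: mul2_pair Delta_id_def leg12_def T.basis_mult_eq_sum[of _ _ u] mult_ac)
  qed
  have E: "mul f (\<lambda>u. \<Phi> [[Ehat], u]) u = f u" for f
  proof -
    have "mul f (\<lambda>u. \<Phi> [[Ehat], u]) u = mul f T_one u"
      by (rule T.basis_mult_cong) (auto simp: expansion_single)
    then show ?thesis using mul_T_one_right[OF assms(2)] by simp
  qed
  have H: "mul f (\<lambda>u. \<Phi> [[Hhat \<nu>], u]) u = 0" if "\<nu> < d" for f \<nu>
  proof -
    have "mul f (\<lambda>u. \<Phi> [[Hhat \<nu>], u]) u = mul f (\<lambda>_. 0) u"
      by (rule T.basis_mult_cong) (auto simp: expansion_single that)
    then show ?thesis by (simp add: T.basis_mult_eq_sum)
  qed
  have X: "mul f (\<lambda>u. \<Phi> [[Xhat \<nu>], u]) u = - mul f (lmult d B (GenH \<nu>) T_one) u" if "\<nu> < d" for f \<nu>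
  proof -
    have "mul f (\<lambda>u. \<Phi> [[Xhat \<nu>], u]) u = mul f (\<lambda>u. - lmult d B (GenH \<nu>) T_one u) u"
    proof (rule T.basis_mult_cong)
      fix w assume "w \<in> words u"
      then have "\<Phi> [[Xhat \<nu>], w] = - (\<Sum>\<mu><d. of_bool (\<mu> = \<nu>) * lmult d B (GenH \<mu>) T_one w)"
        using that by (simp add: expansion_single eq_commute[of \<nu>] del: sum_of_bool_mult_eq sum_mult_of_bool_eq)
      then show "\<Phi> [[Xhat \<nu>], w] = - lmult d B (GenH \<nu>) T_one w"
        using that by (simp only: sum_of_bool_pick finite_lessThan lessThan_iff)
    qed simp
    then show ?thesis by (simp add: T.basis_mult_eq_sum sum_negf)
  qed
  have XR: "(\<Sum>i\<in>rbasis d. rconst d B i (Xhat \<nu>) a * f i) = of_bool (a = Xhat \<nu>) * f Ehat"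
    if "\<nu> < d" for f \<nu>
  proof -
    have "(\<Sum>i\<in>rbasis d. rconst d B i (Xhat \<nu>) a * f i)
        = (\<Sum>i\<in>rbasis d. of_bool (i = Ehat) * (of_bool (a = Xhat \<nu>) * f i))"
    proof (intro sum.cong refl)
      fix i assume "i \<in> rbasis d"
      then show "rconst d B i (Xhat \<nu>) a * f i = of_bool (i = Ehat) * (of_bool (a = Xhat \<nu>) * f i)"
        using that assms(1) by (cases i) (auto simp: rconst_def)
    qed
    then show ?thesis by (simp only: sum_of_bool_pick finite_rbasis basis_mem)
  qed
  have ER: "(\<Sum>i\<in>rbasis d. rconst d B i Ehat a * f i) = f a" for f
    using assms(1) by (simp add: rconst_Ehat_right of_bool_def if_distrib[of "\<lambda>t. t * _"] cong: if_cong)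
  have "mul2 (Delta_id \<Phi>) (leg12 \<Phi>) [[a], u, v] =
     (\<Sum>c\<in>rbasis d. \<Sum>i\<in>rbasis d. rconst d B i c a * mul (\<lambda>u. \<Phi> [i # u, v]) (\<lambda>u. \<Phi> [[c], u]) u)"
    by (subst sum.swap) (simp only: mul3_Cons inner)
  also have "\<dots> = \<Phi> [a # u, v] - (\<Sum>\<nu><d. of_bool (a = Xhat \<nu>) *
      mul (\<lambda>u. \<Phi> [Ehat # u, v]) (lmult d B (GenH \<nu>) T_one) u)"
    by (subst sum_rbasis) (simp add: E H X ER XR sum_negf
        del: sum_of_bool_mult_eq sum_mult_of_bool_eq)
  finally show ?thesis .
qed

text \<open>
  Here \<open>\<Phi>\<^sub>2\<^sub>3\<close> does not touch the first word, and \<open>H\<^sub>\<nu>\<close> acts on the concatenation of the other two by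
  acting on each of them.
\<close>

lemma twisting_rhs:
  assumes "a \<in> rbasis d" "set u \<subseteq> rbasis d" "set v \<subseteq> rbasis d"
  shows "mul2 (id_Delta \<Phi>) (leg23 \<Phi>) [[a], u, v] =
    of_bool (a = Ehat) * \<Phi> [u, v] - (\<Sum>\<nu><d. of_bool (a = Xhat \<nu>) *
      (lmult d B (GenH \<nu>) (\<lambda>u. \<Phi> [u, v]) u + lmult d B (GenH \<nu>) (\<lambda>v. \<Phi> [u, v]) v))"
proof -
  let ?h = "\<lambda>\<nu>. lmult d B (GenH \<nu>) T_one"
  have leg: "mul2 F (\<lambda>W. leg23 \<Phi> ([c] # W)) [u, v] = of_bool (c = Ehat) * mul2 F \<Phi> [u, v]" for F c
    by (cases "c = Ehat") (simp_all add: mul2_pair leg23_def T_one_Cons T.basis_mult_eq_sum)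
  have E: "mul2 (\<lambda>W. T_tensor T_one T_one W) \<Phi> [u, v] = \<Phi> [u, v]"
    using assms by (simp add: mul2_product[of _ T_one T_one] T_tensor_def mul_T_one_left)
  have H1: "mul2 (\<lambda>W. T_tensor (?h \<nu>) T_one W) \<Phi> [u, v] = lmult d B (GenH \<nu>) (\<lambda>u. \<Phi> [u, v]) u"
    if "\<nu> < d" for \<nu>
    using assms that
    by (simp add: mul2_product[of _ "?h \<nu>" T_one] T_tensor_def mul_T_one_left mul_lmult_T_one)
  have H2: "mul2 (\<lambda>W. T_tensor T_one (?h \<nu>) W) \<Phi> [u, v] = lmult d B (GenH \<nu>) (\<lambda>v. \<Phi> [u, v]) v"
    if "\<nu> < d" for \<nu>
    using assms that
    by (simp add: mul2_product[of _ T_one "?h \<nu>"] T_tensor_def mul_T_one_left mul_lmult_T_one)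
  define D where "D = (\<lambda>W. (- 1) * (\<Sum>\<nu><d. of_bool (a = Xhat \<nu>) *
      (1 * T_tensor (?h \<nu>) T_one W + 1 * T_tensor T_one (?h \<nu>) W)))"
  have "mul2 (id_Delta \<Phi>) (leg23 \<Phi>) [[a], u, v]
      = (\<Sum>i\<in>rbasis d. \<Sum>c\<in>rbasis d. of_bool (c = Ehat) *
          (rconst d B i c a * mul2 (\<lambda>W. id_Delta \<Phi> ([i] # W)) \<Phi> [u, v]))"
    by (simp only: mul3_Cons leg mult_ac)
  also have "\<dots> = (\<Sum>i\<in>rbasis d. rconst d B i Ehat a * mul2 (\<lambda>W. id_Delta \<Phi> ([i] # W)) \<Phi> [u, v])"
    by (intro sum.cong refl) (simp only: sum_of_bool_pick finite_rbasis basis_mem)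
  also have "\<dots> = mul2 (\<lambda>W. id_Delta \<Phi> ([a] # W)) \<Phi> [u, v]"
    using assms(1) by (simp add: rconst_Ehat_right of_bool_def if_distrib[of "\<lambda>t. t * _"] cong: if_cong)
  also have "\<dots> = mul2 (\<lambda>W. of_bool (a = Ehat) * T_tensor T_one T_one W + 1 * D W) \<Phi> [u, v]"
  proof (rule T2.basis_mult_cong)
    fix W assume "W \<in> listset (map words [u, v])"
    then obtain u' v' where W: "W = [u', v']" "set u' \<subseteq> rbasis d" "set v' \<subseteq> rbasis d"
      by (auto simp: set_Cons_def)
    then show "id_Delta \<Phi> ([a] # W) = of_bool (a = Ehat) * T_tensor T_one T_one W + 1 * D W"
      using assms(1) by (simp add: id_Delta_def expansion_single T_tensor_def D_def T_one_append
          lmult_T_one_append del: sum_of_bool_mult_eq sum_mult_of_bool_eq)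
  qed simp
  also have "\<dots> = of_bool (a = Ehat) * \<Phi> [u, v] + 1 * mul2 D \<Phi> [u, v]"
    by (simp only: T2.basis_mult_lin_left E)
  also have "mul2 D \<Phi> [u, v] = (- 1) * (\<Sum>\<nu><d. of_bool (a = Xhat \<nu>) *
      (1 * lmult d B (GenH \<nu>) (\<lambda>u. \<Phi> [u, v]) u + 1 * lmult d B (GenH \<nu>) (\<lambda>v. \<Phi> [u, v]) v))"
  proof -
    have "mul2 D \<Phi> [u, v] = (- 1) * mul2 (\<lambda>W. \<Sum>\<nu><d. of_bool (a = Xhat \<nu>) *
      (1 * T_tensor (?h \<nu>) T_one W + 1 * T_tensor T_one (?h \<nu>) W)) \<Phi> [u, v]"
      unfolding D_def using T2.basis_mult_sum_left[of "\<lambda>_. - 1" _ "{()}"] by simp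
    also have "\<dots> = (- 1) * (\<Sum>\<nu><d. of_bool (a = Xhat \<nu>) *
      (1 * mul2 (T_tensor (?h \<nu>) T_one) \<Phi> [u, v] + 1 * mul2 (T_tensor T_one (?h \<nu>)) \<Phi> [u, v]))"
      by (simp only: T2.basis_mult_sum_left T2.basis_mult_lin_left)
    finally show ?thesis
      using H1 H2 by simp
  qed
  finally show ?thesis
    by simp
qed

text \<open>
  Comparing both sides gives \<open>\<Phi>\<close> on a first word of length \<open>m + 1\<close> in terms of first words of length
  \<open>m\<close> and of \<open>\<Phi> [Ehat # u, v]\<close>.  The latter is \<open>\<Phi> [u, v]\<close>, by the case \<open>a = Ehat\<close>.
\<close>

lemma twisting_recursion:
  assumes "a \<in> rbasis d" "set u \<subseteq> rbasis d" "set v \<subseteq> rbasis d"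
  shows "\<Phi> [a # u, v] = of_bool (a = Ehat) * \<Phi> [u, v] + (\<Sum>\<nu><d. of_bool (a = Xhat \<nu>) *
     (mul (\<lambda>u. \<Phi> [Ehat # u, v]) (lmult d B (GenH \<nu>) T_one) u
      - lmult d B (GenH \<nu>) (\<lambda>u. \<Phi> [u, v]) u - lmult d B (GenH \<nu>) (\<lambda>v. \<Phi> [u, v]) v))"
proof -
  have "mul2 (Delta_id \<Phi>) (leg12 \<Phi>)
      = mul2 (id_Delta \<Phi>) (leg23 \<Phi>)"
    using twisting by (simp add: twisting_equation_def T_pow_def basis_alg_def)
  then show ?thesis
    using twisting_lhs[OF assms] twisting_rhs[OF assms]
    by (simp add: algebra_simps sum.distrib sum_subtractf del: sum_of_bool_mult_eq sum_mult_of_bool_eq)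
qed

lemma twisting_solution:
  assumes "set u \<subseteq> rbasis d" "set v \<subseteq> rbasis d"
  shows "\<Phi> [u, v] = cocycle d B u v"
  using assms
proof (induction n \<equiv> "length u" arbitrary: u v)
  case 0
  then show ?case
    using normalized unfolding normalized_def by (metis cocycle_Nil length_0_conv)
next
  case (Suc n)
  then obtain a u' where u: "u = a # u'" "length u' = n" "a \<in> rbasis d" "set u' \<subseteq> rbasis d"
    by (metis Suc_length_conv insert_subset list.simps(15))
  have IH: "\<Phi> [w, v] = cocycle d B w v" if "w \<in> words u'" "set v \<subseteq> rbasis d" for w v
    using Suc.hyps(1)[of w v] that u by simp
  have E: "\<Phi> [Ehat # w, v] = cocycle d B w v" if "w \<in> words u'" for w
    using twisting_recursion[of Ehat w v] that IH[OF that] Suc.prems by simp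
  show ?case
  proof (cases a)
    case Ehat
    then show ?thesis using u E by (simp add: cocycle_Ehat)
  next
    case (Hhat \<mu>)
    then show ?thesis
      using u Suc.prems twisting_recursion[of a u' v] cocycle_zero[of a d B u' v] by (auto simp: image_iff)
  next
    case (Xhat \<nu>)
    then have \<nu>: "\<nu> < d" using u by simp
    let ?t = "\<lambda>\<nu>. mul (\<lambda>u. \<Phi> [Ehat # u, v]) (lmult d B (GenH \<nu>) T_one) u'
      - lmult d B (GenH \<nu>) (\<lambda>u. \<Phi> [u, v]) u' - lmult d B (GenH \<nu>) (\<lambda>v. \<Phi> [u', v]) v"
    have "\<Phi> [a # u', v] = (\<Sum>\<mu><d. of_bool (\<mu> = \<nu>) * ?t \<mu>)"
      using Suc.prems u Xhat twisting_recursion[of a u' v]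
      by (simp add: eq_commute[of \<nu>] del: sum_of_bool_mult_eq sum_mult_of_bool_eq)
    also have "\<dots> = ?t \<nu>"
      using \<nu> by (simp only: sum_of_bool_pick finite_lessThan lessThan_iff)
    also have "\<dots> = mul (\<lambda>u. cocycle d B u v) (lmult d B (GenH \<nu>) T_one) u'
        - lmult d B (GenH \<nu>) (\<lambda>u. cocycle d B u v) u' - lmult d B (GenH \<nu>) (cocycle d B u') v"
      using Suc.prems u E IH
      by (intro arg_cong2[where f = "(-)"] T.basis_mult_cong lmult_cong) auto
    also have "\<dots> = cocycle d B (a # u') v"
      using Suc.prems u \<nu> Xhat by (simp add: cocycle_Xhat)
    finally show ?thesis using u by simp
  qed
qed

end

end

section \<open>Power sums of the linear factors\<close>

text \<open>
  Multiplication by \<open>X\<^sup>\<mu>\<^sup>1 \<cdots> X\<^sup>\<mu>\<^sup>r\<close>.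
\<close>

definition X_mult :: "nat \<Rightarrow> (nat \<Rightarrow> nat \<Rightarrow> nat \<Rightarrow> 'k::field_char_0) \<Rightarrow> nat list \<Rightarrow>
    (ridx list \<Rightarrow> 'k) \<Rightarrow> ridx list \<Rightarrow> 'k"
  where "X_mult d B \<mu>s f = foldr (\<lambda>\<mu>. lmult d B (GenX \<mu>)) \<mu>s f"

lemma X_mult_simps [simp]: "X_mult d B [] f = f" "X_mult d B (\<mu> # \<mu>s) f = lmult d B (GenX \<mu>) (X_mult d B \<mu>s f)"
  by (simp_all add: X_mult_def)

lemma X_mult_lin: "X_mult d B \<mu>s (\<lambda>w. f w + c * g w) w = X_mult d B \<mu>s f w + c * X_mult d B \<mu>s g w"
proof (induction \<mu>s arbitrary: w)
  case (Cons \<mu> \<mu>s)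
  have "X_mult d B \<mu>s (\<lambda>w. f w + c * g w) = (\<lambda>w. X_mult d B \<mu>s f w + c * X_mult d B \<mu>s g w)"
    using Cons.IH by auto
  then show ?case by (simp add: lmult_lin)
qed simp

lemma X_mult_zero: "X_mult d B \<mu>s (\<lambda>w. 0) w = 0"
  using X_mult_lin[of d B \<mu>s "\<lambda>_. 0" "- 1" "\<lambda>_. 0" w] by simp

lemma X_mult_sum:
  "finite S \<Longrightarrow> X_mult d B \<mu>s (\<lambda>w. \<Sum>i\<in>S. c i * f i w) w = (\<Sum>i\<in>S. c i * X_mult d B \<mu>s (f i) w)"
proof (induction S rule: finite_induct)
  case (insert i S)
  then show ?case
    using X_mult_lin[of d B \<mu>s "\<lambda>w. \<Sum>i\<in>S. c i * f i w" "c i" "f i" w] by (simp add: add.commute)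
qed (simp add: X_mult_zero)

definition idx_words :: "nat \<Rightarrow> nat \<Rightarrow> nat list set"
  where "idx_words d n = {\<mu>s. set \<mu>s \<subseteq> {..<d} \<and> length \<mu>s = n}"

lemma finite_idx_words [simp]: "finite (idx_words d n)"
  unfolding idx_words_def by (rule finite_lists_length_eq) simp

lemma sum_idx_words_Suc:
  "(\<Sum>\<mu>s\<in>idx_words d (Suc n). f \<mu>s) = (\<Sum>\<sigma><d. \<Sum>\<mu>s\<in>idx_words d n. f (\<sigma> # \<mu>s))"
proof -
  have "idx_words d (Suc n) = (\<lambda>(\<sigma>, \<mu>s). \<sigma> # \<mu>s) ` ({..<d} \<times> idx_words d n)"
    by (auto simp: idx_words_def length_Suc_conv)
  moreover have "inj_on (\<lambda>(\<sigma>, \<mu>s). \<sigma> # \<mu>s) ({..<d} \<times> idx_words d n)"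
    by (auto simp: inj_on_def)
  ultimately show ?thesis by (simp add: sum.reindex sum.cartesian_product split_def)
qed

text \<open>
  The coefficient of \<open>H\<^sub>\<nu>\<close> in the product \<open>H\<^sub>\<mu>\<^sub>1 \<cdots> H\<^sub>\<mu>\<^sub>r\<close> in \<open>L\<close>; it is zero for the empty word, whose
  product is the unit of \<open>R\<close>.
\<close>

definition prod_coeff :: "nat \<Rightarrow> (nat \<Rightarrow> nat \<Rightarrow> nat \<Rightarrow> 'k::field_char_0) \<Rightarrow> nat list \<Rightarrow> nat \<Rightarrow> 'k"
  where "prod_coeff d B \<mu>s \<nu> = rho_word d B (map GenH \<mu>s) (Hhat \<nu>)"

text \<open>
  Multiplication by the power sum \<open>\<Sum>\<^sub>i x\<^sub>i\<^sup>n\<close> for \<open>n \<ge> 1\<close>, written so that it visibly lies in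
  \<open>U(L\<^sup>*) \<otimes> U(L)\<close>: it is multiplication by \<open>X\<^sup>\<mu>\<^sup>1 \<cdots> X\<^sup>\<mu>\<^sup>n \<otimes> H\<^sub>\<mu>\<^sub>1 \<cdots> H\<^sub>\<mu>\<^sub>n\<close>, with the \<open>H\<close> multiplied in \<open>L\<close>.
\<close>

definition power_sum_op :: "nat \<Rightarrow> (nat \<Rightarrow> nat \<Rightarrow> nat \<Rightarrow> 'k::field_char_0) \<Rightarrow> nat \<Rightarrow>
    (ridx list \<Rightarrow> ridx list \<Rightarrow> 'k) \<Rightarrow> ridx list \<Rightarrow> ridx list \<Rightarrow> 'k"
  where "power_sum_op d B n F u v = (\<Sum>(\<mu>s, \<nu>)\<in>idx_words d n \<times> {..<d}.
    prod_coeff d B \<mu>s \<nu> * X_mult d B \<mu>s (\<lambda>u. lmult d B (GenH \<nu>) (F u) v) u)"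

text \<open>
  Multiplication by \<open>x\<^sub>1\<close>, the linear factor that belongs to the first letter of the second word.
\<close>

fun head_op :: "nat \<Rightarrow> (nat \<Rightarrow> nat \<Rightarrow> nat \<Rightarrow> 'k::field_char_0) \<Rightarrow>
    (ridx list \<Rightarrow> ridx list \<Rightarrow> 'k) \<Rightarrow> ridx list \<Rightarrow> ridx list \<Rightarrow> 'k"
  where
    "head_op d B F u [] = 0"
  | "head_op d B F u (b # v) = (\<Sum>(\<sigma>, c)\<in>{..<d} \<times> rbasis d.
      rconst d B (Hhat \<sigma>) c b * lmult d B (GenX \<sigma>) (\<lambda>u. F u (c # v)) u)"

text \<open>
  Multiplication by \<open>\<Sum>\<^sub>i\<^sub>\<ge>\<^sub>2 x\<^sub>i\<^sup>n\<close>.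
\<close>

fun tail_op :: "nat \<Rightarrow> (nat \<Rightarrow> nat \<Rightarrow> nat \<Rightarrow> 'k::field_char_0) \<Rightarrow> nat \<Rightarrow>
    (ridx list \<Rightarrow> ridx list \<Rightarrow> 'k) \<Rightarrow> ridx list \<Rightarrow> ridx list \<Rightarrow> 'k"
  where
    "tail_op d B n F u [] = 0"
  | "tail_op d B n F u (b # v) = power_sum_op d B n (\<lambda>u v. F u (b # v)) u v"

definition linear_op :: "(('a \<Rightarrow> 'b \<Rightarrow> 'k::field_char_0) \<Rightarrow> 'a \<Rightarrow> 'b \<Rightarrow> 'k) \<Rightarrow> bool"
  where "linear_op T \<longleftrightarrow>
    (\<forall>F G c. T (\<lambda>u v. F u v + c * G u v) = (\<lambda>u v. T F u v + c * T G u v))"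

lemma linear_opD: "linear_op T \<Longrightarrow> T (\<lambda>u v. F u v + c * G u v) = (\<lambda>u v. T F u v + c * T G u v)"
  by (simp add: linear_op_def)

lemma linear_op_zero:
  assumes "linear_op T"
  shows "T (\<lambda>u v. 0) = (\<lambda>u v. 0)"
  using linear_opD[OF assms, of "\<lambda>_ _. 0" "- 1" "\<lambda>_ _. 0"] by simp

lemma linear_op_scale:
  assumes "linear_op T"
  shows "T (\<lambda>u v. c * F u v) = (\<lambda>u v. c * T F u v)"
  using linear_opD[OF assms, of "\<lambda>_ _. 0" c F] by (simp add: linear_op_zero[OF assms])

lemma linear_op_add:
  assumes "linear_op T"
  shows "T (\<lambda>u v. F u v + G u v) = (\<lambda>u v. T F u v + T G u v)"
  using linear_opD[OF assms, of F 1 G] by simp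

lemma linear_op_diff:
  assumes "linear_op T"
  shows "T (\<lambda>u v. F u v - G u v) = (\<lambda>u v. T F u v - T G u v)"
  using linear_opD[OF assms, of F "- 1" G] by simp

lemma linear_op_sum:
  assumes "linear_op T" "finite S"
  shows "T (\<lambda>u v. \<Sum>i\<in>S. c i * F i u v) = (\<lambda>u v. \<Sum>i\<in>S. c i * T (F i) u v)"
  using assms(2)
proof (induction S rule: finite_induct)
  case empty
  then show ?case by (simp add: linear_op_zero[OF assms(1)])
next
  case (insert i S)
  then show ?case
    using linear_opD[OF assms(1), of "\<lambda>u v. \<Sum>i\<in>S. c i * F i u v" "c i" "F i"]
    by (simp add: add.commute)
qed

lemma linear_op_sumI:
  fixes T :: "'i \<Rightarrow> ('a \<Rightarrow> 'b \<Rightarrow> 'k::field_char_0) \<Rightarrow> 'a \<Rightarrow> 'b \<Rightarrow> 'k"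
  assumes "\<And>i. i \<in> S \<Longrightarrow> linear_op (T i)"
  shows "linear_op (\<lambda>F u v. \<Sum>i\<in>S. c i * T i F u v)"
  unfolding linear_op_def
proof (intro allI ext)
  fix F G :: "'a \<Rightarrow> 'b \<Rightarrow> 'k" and a u v
  have "(\<Sum>i\<in>S. c i * T i (\<lambda>u v. F u v + a * G u v) u v)
      = (\<Sum>i\<in>S. c i * (T i F u v + a * T i G u v))"
    using assms by (intro sum.cong) (simp_all add: linear_opD)
  then show "(\<Sum>i\<in>S. c i * T i (\<lambda>u v. F u v + a * G u v) u v)
      = (\<Sum>i\<in>S. c i * T i F u v) + a * (\<Sum>i\<in>S. c i * T i G u v)"
    by (simp add: algebra_simps sum.distrib sum_distrib_left)
qed

lemma linear_op_funpow: "linear_op T \<Longrightarrow> linear_op (T ^^ n)"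
  by (induction n) (simp_all add: linear_op_def)

lemma linear_op_power_sum_op: "linear_op (power_sum_op d B n)"
proof -
  have "linear_op (\<lambda>F u v. X_mult d B \<mu>s (\<lambda>u. lmult d B (GenH \<nu>) (F u) v) u)" for \<mu>s \<nu>
    by (simp add: linear_op_def lmult_lin X_mult_lin)
  then have "linear_op (\<lambda>F u v. \<Sum>p\<in>idx_words d n \<times> {..<d}.
    prod_coeff d B (fst p) (snd p) * X_mult d B (fst p) (\<lambda>u. lmult d B (GenH (snd p)) (F u) v) u)"
    by (intro linear_op_sumI)
  then show ?thesis
    by (simp add: power_sum_op_def[abs_def] split_def)
qed

lemma linear_op_head_op: "linear_op (head_op d B)"
  unfolding linear_op_def
proof (intro allI ext)
  fix F G :: "ridx list \<Rightarrow> ridx list \<Rightarrow> 'a" and c u v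
  show "head_op d B (\<lambda>u v. F u v + c * G u v) u v = head_op d B F u v + c * head_op d B G u v"
    by (cases v) (simp_all add: lmult_lin split_def algebra_simps sum.distrib sum_distrib_left)
qed

lemma power_sum_op_Nil [simp]: "power_sum_op d B n F u [] = 0"
  by (simp add: power_sum_op_def X_mult_zero)

lemma head_op_pow_Nil: "n \<ge> 1 \<Longrightarrow> (head_op d B ^^ n) F u [] = 0"
  by (cases n) auto

context fin_dim_assoc_algebra
begin

lemma lmult_GenX_commute:
  assumes "\<sigma> < d" "\<tau> < d"
  shows "lmult d B (GenX \<sigma>) (lmult d B (GenX \<tau>) f) = lmult d B (GenX \<tau>) (lmult d B (GenX \<sigma>) f)"
proof
  fix w
  show "lmult d B (GenX \<sigma>) (lmult d B (GenX \<tau>) f) w = lmult d B (GenX \<tau>) (lmult d B (GenX \<sigma>) f) w"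
    using lmult_bracket[of "GenX \<sigma>" "GenX \<tau>" f w] assms by simp
qed

lemma lmult_X_mult_commute:
  assumes "\<sigma> < d" "set \<mu>s \<subseteq> {..<d}"
  shows "lmult d B (GenX \<sigma>) (X_mult d B \<mu>s f) = X_mult d B \<mu>s (lmult d B (GenX \<sigma>) f)"
  using assms(2) by (induction \<mu>s) (simp_all add: lmult_GenX_commute[OF assms(1)])

text \<open>
  Multiplication by \<open>X\<^sup>\<sigma>\<close> commutes with the power sums, whose components in the first factor are
  polynomials in the commuting \<open>X\<close>.
\<close>

lemma lmult_power_sum_op_commute:
  assumes "\<sigma> < d"
  shows "lmult d B (GenX \<sigma>) (\<lambda>u. power_sum_op d B n F u v) u
    = power_sum_op d B n (\<lambda>u v. lmult d B (GenX \<sigma>) (\<lambda>u. F u v) u) u v"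
proof -
  have "lmult d B (GenX \<sigma>) (X_mult d B \<mu>s (\<lambda>u. lmult d B (GenH \<nu>) (F u) v)) u
      = X_mult d B \<mu>s (\<lambda>u. lmult d B (GenH \<nu>) (\<lambda>v. lmult d B (GenX \<sigma>) (\<lambda>u. F u v) u) v) u"
    if "\<mu>s \<in> idx_words d n" for \<mu>s \<nu>
  proof -
    have "lmult d B (GenX \<sigma>) (\<lambda>u. lmult d B (GenH \<nu>) (F u) v)
        = (\<lambda>u. lmult d B (GenH \<nu>) (\<lambda>v. lmult d B (GenX \<sigma>) (\<lambda>u. F u v) u) v)"
      by (intro ext lmult_legs_commute)
    then show ?thesis
      using lmult_X_mult_commute[OF assms] that by (simp add: idx_words_def)
  qed
  then show ?thesis
    by (auto simp: power_sum_op_def split_def lmult_sum intro!: sum.cong)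
qed

lemma prod_coeff_assoc:
  "(\<Sum>e\<in>rbasis d. rho_word d B (map GenH (\<sigma> # \<mu>s)) e * rconst d B e c b)
    = (\<Sum>g\<in>rbasis d. rconst d B (Hhat \<sigma>) g b *
        (\<Sum>e\<in>rbasis d. rho_word d B (map GenH \<mu>s) e * rconst d B e c g))"
proof -
  let ?\<rho> = "rho_word d B (map GenH \<mu>s)" and ?r = "rconst d B"
  have "(\<Sum>e\<in>rbasis d. rho_word d B (map GenH (\<sigma> # \<mu>s)) e * ?r e c b)
      = (\<Sum>e\<in>rbasis d. \<Sum>g\<in>rbasis d. ?\<rho> g * (?r (Hhat \<sigma>) g e * ?r e c b))"
    by (simp add: rho_word_Cons sum_distrib_left mult_ac del: rho_word.simps)
  also have "\<dots> = (\<Sum>g\<in>rbasis d. ?\<rho> g * (\<Sum>e\<in>rbasis d. ?r (Hhat \<sigma>) g e * ?r e c b))"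
    by (subst sum.swap) (simp add: sum_distrib_left)
  also have "\<dots> = (\<Sum>g\<in>rbasis d. ?\<rho> g * (\<Sum>e\<in>rbasis d. ?r g c e * ?r (Hhat \<sigma>) e b))"
    by (simp only: rconst_assoc)
  also have "\<dots> = (\<Sum>e\<in>rbasis d. \<Sum>g\<in>rbasis d. ?\<rho> g * (?r g c e * ?r (Hhat \<sigma>) e b))"
    by (subst sum.swap) (simp add: sum_distrib_left)
  finally show ?thesis by (simp add: sum_distrib_left mult_ac)
qed

text \<open>
  Powers of \<open>x\<^sub>1\<close> are computed in \<open>R\<close>, where the \<open>H\<close> multiply as in \<open>L\<close>; the inner sum is the matrix of
  left multiplication by \<open>H\<^sub>\<mu>\<^sub>1 \<cdots> H\<^sub>\<mu>\<^sub>n\<close>.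
\<close>

lemma head_op_pow:
  assumes "n \<ge> 1 \<or> b \<in> rbasis d"
  shows "(head_op d B ^^ n) F u (b # v) = (\<Sum>\<mu>s\<in>idx_words d n. \<Sum>c\<in>rbasis d.
    (\<Sum>e\<in>rbasis d. rho_word d B (map GenH \<mu>s) e * rconst d B e c b) *
    X_mult d B \<mu>s (\<lambda>u. F u (c # v)) u)"
  using assms
proof (induction n arbitrary: u b)
  case 0
  have "idx_words d 0 = {[]}" by (auto simp: idx_words_def)
  moreover have "(\<Sum>e\<in>rbasis d. of_bool (e = Ehat) * rconst d B e c b) = rconst d B Ehat c b" for c
    by (simp only: sum_of_bool_pick finite_rbasis basis_mem)
  ultimately show ?case
    using 0 by (simp add: R_alg_def basis_alg_def rconst_Ehat_left of_bool_def
        if_distrib[of "\<lambda>t. t * _"] cong: if_cong)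
next
  case (Suc n)
  define M where "M \<mu>s c b = (\<Sum>e\<in>rbasis d. rho_word d B (map GenH \<mu>s) e * rconst d B e c b)" for \<mu>s c b
  let ?f = "\<lambda>c u. F u (c # v)"
  have IH: "lmult d B (GenX \<sigma>) (\<lambda>u. (head_op d B ^^ n) F u (c # v)) u
      = (\<Sum>\<mu>s\<in>idx_words d n. \<Sum>e\<in>rbasis d. M \<mu>s e c * X_mult d B (\<sigma> # \<mu>s) (?f e) u)"
    if "c \<in> rbasis d" for c \<sigma> u
  proof -
    have "lmult d B (GenX \<sigma>) (\<lambda>u. (head_op d B ^^ n) F u (c # v)) u
       = lmult d B (GenX \<sigma>) (\<lambda>u. \<Sum>(\<mu>s, e)\<in>idx_words d n \<times> rbasis d. M \<mu>s e c * X_mult d B \<mu>s (?f e) u) u"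
      using Suc.IH[of c] that by (simp add: sum.cartesian_product M_def)
    also have "\<dots> = (\<Sum>(\<mu>s, e)\<in>idx_words d n \<times> rbasis d. M \<mu>s e c * X_mult d B (\<sigma> # \<mu>s) (?f e) u)"
      by (simp add: split_def lmult_sum)
    finally show ?thesis by (simp add: sum.cartesian_product)
  qed
  have "(head_op d B ^^ Suc n) F u (b # v) = (\<Sum>\<sigma><d. \<Sum>c\<in>rbasis d. rconst d B (Hhat \<sigma>) c b *
      (\<Sum>\<mu>s\<in>idx_words d n. \<Sum>e\<in>rbasis d. M \<mu>s e c * X_mult d B (\<sigma> # \<mu>s) (?f e) u))"
    using IH by (simp add: sum.cartesian_product[symmetric] del: X_mult_simps)
  also have "\<dots> = (\<Sum>\<sigma><d. \<Sum>c\<in>rbasis d. \<Sum>\<mu>s\<in>idx_words d n. \<Sum>e\<in>rbasis d.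
      rconst d B (Hhat \<sigma>) c b * (M \<mu>s e c * X_mult d B (\<sigma> # \<mu>s) (?f e) u))"
    by (simp only: sum_distrib_left)
  also have "\<dots> = (\<Sum>\<sigma><d. \<Sum>\<mu>s\<in>idx_words d n. \<Sum>e\<in>rbasis d. \<Sum>c\<in>rbasis d.
      rconst d B (Hhat \<sigma>) c b * (M \<mu>s e c * X_mult d B (\<sigma> # \<mu>s) (?f e) u))"
    by (rule sum.cong[OF refl], rule sum_rotate3)
  also have "\<dots> = (\<Sum>\<sigma><d. \<Sum>\<mu>s\<in>idx_words d n. \<Sum>e\<in>rbasis d.
      M (\<sigma> # \<mu>s) e b * X_mult d B (\<sigma> # \<mu>s) (?f e) u)"
  proof -
    have "M (\<sigma> # \<mu>s) e b = (\<Sum>c\<in>rbasis d. rconst d B (Hhat \<sigma>) c b * M \<mu>s e c)" for \<sigma> \<mu>s e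
      unfolding M_def by (rule prod_coeff_assoc)
    then show ?thesis by (simp only: sum_distrib_right mult.assoc)
  qed
  finally show ?case
    by (simp only: sum_idx_words_Suc M_def)
qed

lemma rho_word_GenH_zero:
  "\<mu>s \<noteq> [] \<Longrightarrow> a \<notin> Hhat ` {..<d} \<Longrightarrow> rho_word d B (map GenH \<mu>s) a = 0"
  by (cases \<mu>s) (simp_all add: rho_word_Cons rconst_Hhat_zero del: rho_word.simps)

text \<open>
  This justifies the name: the operator splits as \<open>x\<^sub>1\<^sup>n + \<Sum>\<^sub>i\<^sub>\<ge>\<^sub>2 x\<^sub>i\<^sup>n\<close>.
\<close>

lemma power_sum_op_Cons:
  assumes "n \<ge> 1"
  shows "power_sum_op d B n F u (b # v) =
    (head_op d B ^^ n) F u (b # v) + power_sum_op d B n (\<lambda>u v. F u (b # v)) u v"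
proof -
  have 1: "(\<Sum>\<nu><d. prod_coeff d B \<mu>s \<nu> * rconst d B (Hhat \<nu>) c b)
      = (\<Sum>e\<in>rbasis d. rho_word d B (map GenH \<mu>s) e * rconst d B e c b)"
    if "\<mu>s \<in> idx_words d n" for \<mu>s c
  proof -
    have "\<mu>s \<noteq> []" using that assms by (auto simp: idx_words_def)
    then show ?thesis
      by (simp add: sum_rbasis rho_word_GenH_zero image_iff prod_coeff_def)
  qed
  have "power_sum_op d B n F u (b # v) = (\<Sum>\<mu>s\<in>idx_words d n. \<Sum>\<nu><d. prod_coeff d B \<mu>s \<nu> *
      ((\<Sum>c\<in>rbasis d. rconst d B (Hhat \<nu>) c b * X_mult d B \<mu>s (\<lambda>u. F u (c # v)) u)
        + X_mult d B \<mu>s (\<lambda>u. lmult d B (GenH \<nu>) (\<lambda>v. F u (b # v)) v) u))"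
    using X_mult_lin[of d B _ _ 1] by (simp add: power_sum_op_def sum.cartesian_product[symmetric] X_mult_sum)
  also have "\<dots> = (\<Sum>\<mu>s\<in>idx_words d n. \<Sum>\<nu><d. \<Sum>c\<in>rbasis d. 
        prod_coeff d B \<mu>s \<nu> * rconst d B (Hhat \<nu>) c b * X_mult d B \<mu>s (\<lambda>u. F u (c # v)) u)
      + power_sum_op d B n (\<lambda>u v. F u (b # v)) u v"
    by (simp add: power_sum_op_def sum.cartesian_product[symmetric] distrib_left sum.distrib
        sum_distrib_left mult.assoc)
  also have "(\<Sum>\<mu>s\<in>idx_words d n. \<Sum>\<nu><d. \<Sum>c\<in>rbasis d. 
        prod_coeff d B \<mu>s \<nu> * rconst d B (Hhat \<nu>) c b * X_mult d B \<mu>s (\<lambda>u. F u (c # v)) u)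
      = (\<Sum>\<mu>s\<in>idx_words d n. \<Sum>c\<in>rbasis d. \<Sum>\<nu><d.
        prod_coeff d B \<mu>s \<nu> * rconst d B (Hhat \<nu>) c b * X_mult d B \<mu>s (\<lambda>u. F u (c # v)) u)"
    by (rule sum.cong[OF refl], rule sum.swap)
  also have "\<dots> = (head_op d B ^^ n) F u (b # v)"
    using assms by (simp add: head_op_pow sum_distrib_right[symmetric] 1)
  finally show ?thesis .
qed

lemma power_sum_op_eq_head_tail:
  assumes "n \<ge> 1"
  shows "power_sum_op d B n F = (\<lambda>u v. (head_op d B ^^ n) F u v + tail_op d B n F u v)"
proof (intro ext)
  fix u v
  show "power_sum_op d B n F u v = (head_op d B ^^ n) F u v + tail_op d B n F u v"
    using assms by (cases v) (simp_all add: power_sum_op_Cons head_op_pow_Nil)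
qed

text \<open>
  The factors \<open>x\<^sub>1\<close> and \<open>x\<^sub>i\<close> with \<open>i \<ge> 2\<close> have commuting \<open>X\<close> in the first word and their \<open>H\<close> in
  different letters of the second.
\<close>

lemma head_tail_commute: "head_op d B (tail_op d B m F) = tail_op d B m (head_op d B F)"
proof (intro ext)
  fix u v
  show "head_op d B (tail_op d B m F) u v = tail_op d B m (head_op d B F) u v"
  proof (cases v)
    case (Cons b v)
    have "power_sum_op d B m (\<lambda>u v. \<Sum>p\<in>{..<d} \<times> rbasis d. rconst d B (Hhat (fst p)) (snd p) b *
          lmult d B (GenX (fst p)) (\<lambda>u. F u (snd p # v)) u)
      = (\<lambda>u v. \<Sum>p\<in>{..<d} \<times> rbasis d. rconst d B (Hhat (fst p)) (snd p) b *
          power_sum_op d B m (\<lambda>u v. lmult d B (GenX (fst p)) (\<lambda>u. F u (snd p # v)) u) u v)"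
      by (rule linear_op_sum[OF linear_op_power_sum_op]) simp
    then show ?thesis
      using Cons by (auto simp: split_def lmult_power_sum_op_commute intro!: sum.cong)
  qed simp
qed

lemma head_pow_tail_commute: "(head_op d B ^^ n) (tail_op d B m F) = tail_op d B m ((head_op d B ^^ n) F)"
  by (induction n) (simp_all add: head_tail_commute)

text \<open>
  Power sums of commuting elements commute, although the \<open>H\<close> in them do not: induction on the number of
  factors.
\<close>

lemma power_sum_op_commute:
  assumes "n \<ge> 1" "m \<ge> 1"
  shows "power_sum_op d B n (power_sum_op d B m F) u v = power_sum_op d B m (power_sum_op d B n F) u v"
proof (induction v arbitrary: u F)
  case (Cons b v)
  have *: "power_sum_op d B n (power_sum_op d B m F) u (b # v) = (head_op d B ^^ (n + m)) F u (b # v)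
      + tail_op d B m ((head_op d B ^^ n) F) u (b # v) + tail_op d B n ((head_op d B ^^ m) F) u (b # v)
      + power_sum_op d B n (power_sum_op d B m (\<lambda>u v. F u (b # v))) u v"
    if "n \<ge> 1" "m \<ge> 1" for n m
  proof -
    have "(head_op d B ^^ n) (power_sum_op d B m F) =
       (\<lambda>u v. (head_op d B ^^ (n + m)) F u v + tail_op d B m ((head_op d B ^^ n) F) u v)"
      by (simp only: power_sum_op_eq_head_tail[OF that(2)] linear_op_add[OF linear_op_funpow[OF linear_op_head_op]]
          head_pow_tail_commute funpow_add o_apply)
    moreover have "(\<lambda>u v. power_sum_op d B m F u (b # v)) =
       (\<lambda>u v. (head_op d B ^^ m) F u (b # v) + power_sum_op d B m (\<lambda>u v. F u (b # v)) u v)"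
      using that(2) by (simp add: power_sum_op_Cons)
    ultimately show ?thesis
      using that(1) by (simp add: power_sum_op_Cons linear_op_add[OF linear_op_power_sum_op])
  qed
  show ?case
    by (simp add: *[OF assms] *[OF assms(2,1)] Cons.IH add_ac)
qed simp

end

section \<open>The exponential via the Euler equation\<close>

lemma X_degree_Cons: "X_degree (a # w) = of_bool (a \<in> range Xhat) + X_degree w"
  by (simp add: X_degree_def)

lemma T_one_X_degree: "T_one u \<noteq> 0 \<Longrightarrow> X_degree u = 0"
  by (induction u) (auto simp: T_one_Cons X_degree_def)

lemma rconst_Xhat_degree: "rconst d B (Xhat \<sigma>) b a \<noteq> 0 \<Longrightarrow> a \<in> range Xhat \<and> b \<notin> range Xhat"
  by (cases a; cases b) (auto simp: rconst_def split: if_splits)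

text \<open>
  Multiplication by \<open>X\<^sup>\<sigma>\<close> raises the \<open>X\<close>-degree of the first word by one; so a coordinate of the result
  depends on coordinates of smaller degree only.  All series below are finite for this reason.
\<close>

lemma lmult_degree_cong:
  assumes "\<And>u. X_degree u < X_degree w \<Longrightarrow> f u = g u"
  shows "lmult d B (GenX \<sigma>) f w = lmult d B (GenX \<sigma>) g w"
  using assms
proof (induction w arbitrary: f g)
  case (Cons a w)
  have "lmult d B (GenX \<sigma>) (\<lambda>v. f (a # v)) w = lmult d B (GenX \<sigma>) (\<lambda>v. g (a # v)) w"
    using Cons.prems by (intro Cons.IH) (simp add: X_degree_Cons[of a])
  moreover have "rconst d B (Xhat \<sigma>) b a * f (b # w) = rconst d B (Xhat \<sigma>) b a * g (b # w)" for b
    using Cons.prems[of "b # w"] rconst_Xhat_degree[of d B \<sigma> b a]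
    by (cases "rconst d B (Xhat \<sigma>) b a = 0") (simp_all add: X_degree_Cons[of _ w])
  ultimately show ?case by (simp only: lmult.simps hat.simps)
qed simp

lemma X_mult_degree_cong:
  assumes "\<And>u. X_degree u + length \<mu>s \<le> X_degree w \<Longrightarrow> f u = g u"
  shows "X_mult d B \<mu>s f w = X_mult d B \<mu>s g w"
  using assms
proof (induction \<mu>s arbitrary: w)
  case (Cons \<mu> \<mu>s)
  show ?case
    unfolding X_mult_simps
    by (rule lmult_degree_cong, rule Cons.IH) (use Cons.prems in auto)
qed simp

lemma power_sum_op_degree_cong:
  assumes "n \<ge> 1" "\<And>u' v'. X_degree u' < X_degree u \<Longrightarrow> F u' v' = G u' v'"
  shows "power_sum_op d B n F u v = power_sum_op d B n G u v"
proof -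
  have "X_mult d B \<mu>s (\<lambda>u. lmult d B (GenH \<nu>) (F u) v) u = X_mult d B \<mu>s (\<lambda>u. lmult d B (GenH \<nu>) (G u) v) u"
    if "\<mu>s \<in> idx_words d n" for \<mu>s \<nu>
  proof (rule X_mult_degree_cong)
    fix u' assume "X_degree u' + length \<mu>s \<le> X_degree u"
    then have "X_degree u' < X_degree u" using that assms(1) by (simp add: idx_words_def)
    then have "F u' = G u'" using assms(2) by auto
    then show "lmult d B (GenH \<nu>) (F u') v = lmult d B (GenH \<nu>) (G u') v" by simp
  qed
  then show ?thesis by (auto simp: power_sum_op_def intro!: sum.cong)
qed

lemma head_op_pow_degree:
  "X_degree u < n \<Longrightarrow> (head_op d B ^^ n) F u v = 0"
proof (induction n arbitrary: u v)
  case (Suc n)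
  show ?case
  proof (cases v)
    case (Cons b v')
    have "lmult d B (GenX \<sigma>) (\<lambda>u. (head_op d B ^^ n) F u (c # v')) u = lmult d B (GenX \<sigma>) (\<lambda>_. 0) u"
      for \<sigma> c
      using Suc by (intro lmult_degree_cong) auto
    then show ?thesis using Cons by (simp add: lmult_zero split_def)
  qed simp
qed simp

text \<open>
  The Euler operator, multiplication by the \<open>X\<close>-degree, is a derivation of \<open>T(R)\<close>, and \<open>X\<^sup>\<sigma>\<close> is
  homogeneous of degree one.
\<close>

lemma lmult_euler:
  "of_nat (X_degree w) * lmult d B (GenX \<sigma>) f w =
    lmult d B (GenX \<sigma>) (\<lambda>u. of_nat (X_degree u) * f u) w + lmult d B (GenX \<sigma>) f w"
proof (induction w arbitrary: f)
  case (Cons a w)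
  let ?D = "\<lambda>w. of_nat (X_degree w) :: 'a" and ?r = "rconst d B (Xhat \<sigma>)" and ?L = "lmult d B (GenX \<sigma>)"
  have "?L (\<lambda>v. ?D (a # v) * f (a # v)) w
      = ?L (\<lambda>v. ?D v * f (a # v) + of_bool (a \<in> range Xhat) * f (a # v)) w"
    by (simp add: X_degree_Cons[of a] algebra_simps)
  also have "\<dots> = ?L (\<lambda>v. ?D v * f (a # v)) w + of_bool (a \<in> range Xhat) * ?L (\<lambda>v. f (a # v)) w"
    by (rule lmult_lin)
  finally have 1: "?L (\<lambda>v. ?D (a # v) * f (a # v)) w + ?L (\<lambda>v. f (a # v)) w = ?D (a # w) * ?L (\<lambda>v. f (a # v)) w"
    using Cons.IH[of "\<lambda>v. f (a # v)"] by (simp add: X_degree_Cons[of a w] algebra_simps)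
  have 2: "?D (a # w) * (?r b a * f (b # w)) = ?r b a * (?D (b # w) * f (b # w)) + ?r b a * f (b # w)" for b
    using rconst_Xhat_degree[of d B \<sigma> b a]
    by (cases "?r b a = 0") (simp_all add: X_degree_Cons[of _ w] algebra_simps)
  have "?D (a # w) * (\<Sum>b\<in>rbasis d. ?r b a * f (b # w))
      = (\<Sum>b\<in>rbasis d. ?r b a * (?D (b # w) * f (b # w))) + (\<Sum>b\<in>rbasis d. ?r b a * f (b # w))"
    by (simp only: sum_distrib_left 2 sum.distrib)
  then show ?case
    using 1 by (simp add: distrib_left)
qed simp

lemma X_mult_euler:
  "of_nat (X_degree w) * X_mult d B \<mu>s f w =
    X_mult d B \<mu>s (\<lambda>u. of_nat (X_degree u) * f u) w + of_nat (length \<mu>s) * X_mult d B \<mu>s f w"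
proof (induction \<mu>s arbitrary: w)
  case (Cons \<mu> \<mu>s)
  have "lmult d B (GenX \<mu>) (\<lambda>u. of_nat (X_degree u) * X_mult d B \<mu>s f u) w
      = lmult d B (GenX \<mu>) (\<lambda>u. X_mult d B \<mu>s (\<lambda>u. of_nat (X_degree u) * f u) u
          + of_nat (length \<mu>s) * X_mult d B \<mu>s f u) w"
    by (simp only: Cons.IH)
  then show ?case
    unfolding X_mult_simps lmult_euler lmult_lin by (simp add: algebra_simps)
qed simp

lemma power_sum_op_euler:
  "of_nat (X_degree u) * power_sum_op d B n F u v =
    power_sum_op d B n (\<lambda>u v. of_nat (X_degree u) * F u v) u v + of_nat n * power_sum_op d B n F u v"
proof -
  have "of_nat (X_degree u) * X_mult d B \<mu>s (\<lambda>u. lmult d B (GenH \<nu>) (F u) v) u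
      = X_mult d B \<mu>s (\<lambda>u. lmult d B (GenH \<nu>) (\<lambda>v. of_nat (X_degree u) * F u v) v) u
        + of_nat n * X_mult d B \<mu>s (\<lambda>u. lmult d B (GenH \<nu>) (F u) v) u"
    if "\<mu>s \<in> idx_words d n" for \<mu>s \<nu>
    using X_mult_euler[of u d B \<mu>s "\<lambda>u. lmult d B (GenH \<nu>) (F u) v"] that
    by (simp add: lmult_scale idx_words_def)
  then have "of_nat (X_degree u) * power_sum_op d B n F u v =
    (\<Sum>(\<mu>s, \<nu>)\<in>idx_words d n \<times> {..<d}. prod_coeff d B \<mu>s \<nu> *
      (X_mult d B \<mu>s (\<lambda>u. lmult d B (GenH \<nu>) (\<lambda>v. of_nat (X_degree u) * F u v) v) u
        + of_nat n * X_mult d B \<mu>s (\<lambda>u. lmult d B (GenH \<nu>) (F u) v) u))"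
    by (auto simp: power_sum_op_def sum_distrib_left mult.left_commute[of "of_nat (X_degree u)"] intro!: sum.cong)
  then show ?thesis
    by (simp add: power_sum_op_def split_def distrib_left sum.distrib sum_distrib_left mult_ac)
qed

text \<open>
  Multiplication by \<open>\<Sum>\<^sub>n w\<^sub>n p\<^sub>n\<close> with the power sums \<open>p\<^sub>n\<close>, cut off after \<open>n = N\<close>.  The cut-off is
  invisible on first words of \<open>X\<close>-degree at most \<open>N\<close>.
\<close>

definition series_op :: "nat \<Rightarrow> (nat \<Rightarrow> nat \<Rightarrow> nat \<Rightarrow> 'k::field_char_0) \<Rightarrow> nat \<Rightarrow> (nat \<Rightarrow> 'k) \<Rightarrow>
    (ridx list \<Rightarrow> ridx list \<Rightarrow> 'k) \<Rightarrow> ridx list \<Rightarrow> ridx list \<Rightarrow> 'k"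
  where "series_op d B N w F u v = (\<Sum>n\<in>{1..N}. w n * power_sum_op d B n F u v)"

lemma linear_op_series_op: "linear_op (series_op d B N w)"
  unfolding series_op_def[abs_def] by (intro linear_op_sumI linear_op_power_sum_op)

lemma series_op_Nil [simp]: "series_op d B N w F u [] = 0"
  by (simp add: series_op_def)

lemma series_op_degree_cong:
  assumes "\<And>u' v'. X_degree u' < X_degree u \<Longrightarrow> F u' v' = G u' v'"
  shows "series_op d B N w F u v = series_op d B N w G u v"
  unfolding series_op_def using assms
  by (intro sum.cong refl arg_cong2[where f = "(*)"] power_sum_op_degree_cong) auto

lemma series_op_euler:
  "of_nat (X_degree u) * series_op d B N w F u v =
    series_op d B N w (\<lambda>u v. of_nat (X_degree u) * F u v) u v
    + series_op d B N (\<lambda>n. w n * of_nat n) F u v"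
  by (simp add: series_op_def sum_distrib_left mult.left_commute[of "of_nat (X_degree u)"]
      power_sum_op_euler distrib_left sum.distrib mult.assoc)

context fin_dim_assoc_algebra
begin

lemma series_op_commute:
  "series_op d B N w (series_op d B M w' F) u v = series_op d B M w' (series_op d B N w F) u v"
proof -
  have *: "series_op d B N w (series_op d B M w' F) u v
      = (\<Sum>n\<in>{1..N}. \<Sum>m\<in>{1..M}. w n * (w' m * power_sum_op d B n (power_sum_op d B m F) u v))" for N M w w'
    by (simp add: series_op_def[abs_def] linear_op_sum[OF linear_op_power_sum_op] sum_distrib_left)
  have "(\<Sum>n\<in>{1..N}. \<Sum>m\<in>{1..M}. w n * (w' m * power_sum_op d B n (power_sum_op d B m F) u v))
      = (\<Sum>n\<in>{1..N}. \<Sum>m\<in>{1..M}. w' m * (w n * power_sum_op d B m (power_sum_op d B n F) u v))"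
    by (intro sum.cong refl) (simp add: power_sum_op_commute mult.left_commute)
  then show ?thesis
    unfolding * by (simp only: sum.swap[of _ "{1..N}" "{1..M}"])
qed

lemma lmult_series_op_commute:
  "\<sigma> < d \<Longrightarrow> lmult d B (GenX \<sigma>) (\<lambda>u. series_op d B N w F u v) u
    = series_op d B N w (\<lambda>u v. lmult d B (GenX \<sigma>) (\<lambda>u. F u v) u) u v"
  by (simp add: series_op_def lmult_sum lmult_power_sum_op_commute)

lemma series_op_Cons:
  "series_op d B N w F u (b # v) =
    (\<Sum>n\<in>{1..N}. w n * (head_op d B ^^ n) F u (b # v)) + series_op d B N w (\<lambda>u v. F u (b # v)) u v"
  by (simp add: series_op_def power_sum_op_Cons distrib_left sum.distrib)

lemma lmult_GenX_out: "\<not> \<sigma> < d \<Longrightarrow> lmult d B (GenX \<sigma>) f w = 0"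
  by (induction w arbitrary: f) (simp_all add: rconst_def)

text \<open>
  The product \<open>\<Prod>\<^sub>i\<^sub>\<ge>\<^sub>2 (1 - x\<^sub>i)\<close>: the cocycle without its first factor.  With it the geometric series
  \<open>\<Sum>\<^sub>n\<^sub>\<ge>\<^sub>1 x\<^sub>1\<^sup>n (1 - x\<^sub>1) = x\<^sub>1\<close> can be summed by telescoping.  The value for the empty second word
  is the one that makes \<open>cocycle_eq_unit_head\<close> hold there as well.
\<close>

definition cocycle_unit_head :: "ridx list \<Rightarrow> ridx list \<Rightarrow> 'k"
  where "cocycle_unit_head u w =
    (case w of [] \<Rightarrow> T_one u | b # v \<Rightarrow> of_bool (b = Ehat) * cocycle d B u v)"

lemma head_op_cocycle_unit_head:
  "head_op d B cocycle_unit_head u (b # v) =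
    (case b of Hhat \<tau> \<Rightarrow> lmult d B (GenX \<tau>) (\<lambda>u. cocycle d B u v) u | _ \<Rightarrow> 0)"
proof -
  have "head_op d B cocycle_unit_head u (b # v) = (\<Sum>\<sigma><d. \<Sum>c\<in>rbasis d.
      of_bool (c = Ehat) * (rconst d B (Hhat \<sigma>) c b * lmult d B (GenX \<sigma>) (\<lambda>u. cocycle d B u v) u))"
    by (auto simp: cocycle_unit_head_def lmult_scale sum.cartesian_product[symmetric] mult_ac intro!: sum.cong)
  also have "\<dots> = (\<Sum>\<sigma><d. rconst d B (Hhat \<sigma>) Ehat b * lmult d B (GenX \<sigma>) (\<lambda>u. cocycle d B u v) u)"
    by (simp only: sum_of_bool_pick finite_rbasis basis_mem)
  also have "\<dots> = (case b of Hhat \<tau> \<Rightarrow> lmult d B (GenX \<tau>) (\<lambda>u. cocycle d B u v) u | _ \<Rightarrow> 0)"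
  proof (cases "b \<in> Hhat ` {..<d}")
    case True
    then obtain \<tau> where b: "b = Hhat \<tau>" "\<tau> < d" by auto
    have "(\<Sum>\<sigma><d. rconst d B (Hhat \<sigma>) Ehat b * lmult d B (GenX \<sigma>) (\<lambda>u. cocycle d B u v) u)
        = (\<Sum>\<sigma><d. of_bool (\<sigma> = \<tau>) * lmult d B (GenX \<sigma>) (\<lambda>u. cocycle d B u v) u)"
      using b by (intro sum.cong) (auto simp: rconst_def)
    then show ?thesis using b by (simp only: sum_of_bool_pick finite_lessThan lessThan_iff ridx.simps)
  next
    case False
    then have "\<not> \<tau> < d" if "b = Hhat \<tau>" for \<tau>
      using that by auto
    then show ?thesis
      using False by (auto simp: rconst_Hhat_zero lmult_GenX_out image_iff split: ridx.split)
  qed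
  finally show ?thesis .
qed

lemma cocycle_eq_unit_head: "cocycle d B = (\<lambda>u w. cocycle_unit_head u w - head_op d B cocycle_unit_head u w)"
proof (intro ext)
  fix u w
  show "cocycle d B u w = cocycle_unit_head u w - head_op d B cocycle_unit_head u w"
  proof (cases w)
    case (Cons b v)
    then show ?thesis
      unfolding Cons head_op_cocycle_unit_head by (cases b) (simp_all add: cocycle_unit_head_def)
  qed (simp add: cocycle_unit_head_def)
qed

lemma sum_head_op_pow_cocycle:
  assumes "X_degree u \<le> N"
  shows "(\<Sum>n\<in>{1..N}. (head_op d B ^^ n) (cocycle d B) u w) = head_op d B cocycle_unit_head u w"
proof -
  have step: "(head_op d B ^^ n) (cocycle d B) u w
      = (head_op d B ^^ n) cocycle_unit_head u w - (head_op d B ^^ Suc n) cocycle_unit_head u w" for n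
  proof -
    have "(head_op d B ^^ n) (cocycle d B)
        = (\<lambda>u w. (head_op d B ^^ n) cocycle_unit_head u w - (head_op d B ^^ n) (head_op d B cocycle_unit_head) u w)"
      by (subst cocycle_eq_unit_head) (rule linear_op_diff[OF linear_op_funpow[OF linear_op_head_op]])
    then show ?thesis by (simp add: funpow_swap1)
  qed
  have "(\<Sum>n\<in>{1..M}. (head_op d B ^^ n) (cocycle d B) u w)
      = head_op d B cocycle_unit_head u w - (head_op d B ^^ Suc M) cocycle_unit_head u w" for M
    by (induction M) (simp_all add: step)
  then show ?thesis
    using head_op_pow_degree[of u "Suc N" d B cocycle_unit_head w] assms by simp
qed

text \<open>
  The logarithmic derivative of \<open>1 - x\<^sub>i\<close> is \<open>- x\<^sub>i / (1 - x\<^sub>i) = - \<Sum>\<^sub>n\<^sub>\<ge>\<^sub>1 x\<^sub>i\<^sup>n\<close>.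
\<close>

lemma cocycle_euler:
  assumes "X_degree u \<le> N"
  shows "of_nat (X_degree u) * cocycle d B u v = - series_op d B N (\<lambda>_. 1) (cocycle d B) u v"
  using assms
proof (induction v arbitrary: u)
  case Nil
  then show ?case using T_one_X_degree[of u] by (cases "T_one u = (0::'k)") auto
next
  case (Cons b v)
  let ?Y = "series_op d B N (\<lambda>_. 1)" and ?G = "\<lambda>u. cocycle d B u v"
  have Y: "?Y (cocycle d B) u (b # v) = head_op d B cocycle_unit_head u (b # v) + ?Y (\<lambda>u v. cocycle d B u (b # v)) u v"
    using sum_head_op_pow_cocycle[OF Cons.prems, of "b # v"] by (simp add: series_op_Cons del: head_op.simps)
  have Y0: "?Y (\<lambda>u v. 0) u v = 0"
    using linear_op_zero[OF linear_op_series_op[of d B N "\<lambda>_. 1"]] by simp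
  show ?case
  proof (cases b)
    case Ehat
    then show ?thesis
      unfolding Y using Cons by (simp add: head_op_cocycle_unit_head del: head_op.simps)
  next
    case (Xhat \<tau>)
    then show ?thesis
      unfolding Y by (simp add: head_op_cocycle_unit_head Y0 del: head_op.simps)
  next
    case (Hhat \<tau>)
    show ?thesis
    proof (cases "\<tau> < d")
      case True
      let ?X = "lmult d B (GenX \<tau>)"
      have "?Y (\<lambda>u v. - ?X (\<lambda>u. cocycle d B u v) u) u v = - ?Y (\<lambda>u v. ?X (\<lambda>u. cocycle d B u v) u) u v"
        using linear_op_scale[OF linear_op_series_op[of d B N "\<lambda>_. 1"], of "- 1"] by simp
      also have "\<dots> = - ?X (\<lambda>u. ?Y (cocycle d B) u v) u"
        using True by (simp add: lmult_series_op_commute)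
      also have "\<dots> = - ?X (\<lambda>u. - (of_nat (X_degree u) * ?G u)) u"
      proof -
        have "?X (\<lambda>u. ?Y (cocycle d B) u v) u = ?X (\<lambda>u. - (of_nat (X_degree u) * ?G u)) u"
        proof (rule lmult_degree_cong)
          fix u' assume "X_degree u' < X_degree u"
          then show "?Y (cocycle d B) u' v = - (of_nat (X_degree u') * ?G u')"
            using Cons.IH[of u'] Cons.prems by simp
        qed
        then show ?thesis by simp
      qed
      also have "\<dots> = ?X (\<lambda>u. of_nat (X_degree u) * ?G u) u"
        by (simp add: lmult_minus)
      finally have "?Y (\<lambda>u v. cocycle d B u (b # v)) u v = ?X (\<lambda>u. of_nat (X_degree u) * ?G u) u"
        using Hhat by simp
      then show ?thesis
        unfolding Y using Hhat lmult_euler[of u d B \<tau> ?G]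
        by (simp add: head_op_cocycle_unit_head del: head_op.simps)
    next
      case False
      then show ?thesis
        unfolding Y using Hhat by (simp add: head_op_cocycle_unit_head lmult_GenX_out Y0 del: head_op.simps)
    qed
  qed
qed

text \<open>
  Powers of \<open>\<Sum>\<^sub>i log (1 - x\<^sub>i) = - \<Sum>\<^sub>n p\<^sub>n / n\<close>, truncated as in \<open>series_op\<close>.
\<close>

definition log_pow :: "nat \<Rightarrow> nat \<Rightarrow> ridx list \<Rightarrow> ridx list \<Rightarrow> 'k"
  where "log_pow N k = (series_op d B N (\<lambda>n. - 1 / of_nat n) ^^ k) (\<lambda>u v. T_one u * T_one v)"

lemma log_pow_simps:
  "log_pow N 0 = (\<lambda>u v. T_one u * T_one v)"
  "log_pow N (Suc k) = series_op d B N (\<lambda>n. - 1 / of_nat n) (log_pow N k)"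
  by (simp_all add: log_pow_def)

lemma log_pow_degree: "X_degree u < k \<Longrightarrow> log_pow N k u v = 0"
proof (induction k arbitrary: u v)
  case (Suc k)
  have "log_pow N (Suc k) u v = series_op d B N (\<lambda>n. - 1 / of_nat n) (\<lambda>_ _. 0) u v"
    unfolding log_pow_simps using Suc by (intro series_op_degree_cong) auto
  then show ?case using linear_op_zero[OF linear_op_series_op] by metis
qed simp

text \<open>
  The Euler operator takes the logarithm \<open>- \<Sum>\<^sub>n p\<^sub>n / n\<close> to \<open>- \<Sum>\<^sub>n p\<^sub>n\<close>, and power sums commute; so
  powers of the logarithm are differentiated as in a commutative algebra.
\<close>

lemma log_pow_euler:
  "of_nat (X_degree u) * log_pow N (Suc k) u v =
    - of_nat (Suc k) * series_op d B N (\<lambda>_. 1) (log_pow N k) u v"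
proof (induction k arbitrary: u v)
  case 0
  let ?w = "\<lambda>n. - 1 / of_nat n :: 'k"
  have z: "(\<lambda>u v. of_nat (X_degree u) * log_pow N 0 u v) = (\<lambda>u v. 0)"
    using T_one_X_degree by (fastforce simp: log_pow_simps fun_eq_iff)
  have w: "series_op d B N (\<lambda>n. ?w n * of_nat n) F u v = - series_op d B N (\<lambda>_. 1) F u v" for F
    by (simp add: series_op_def sum_negf)
  have "of_nat (X_degree u) * log_pow N (Suc 0) u v =
     series_op d B N ?w (\<lambda>u v. of_nat (X_degree u) * log_pow N 0 u v) u v
     + series_op d B N (\<lambda>n. ?w n * of_nat n) (log_pow N 0) u v"
    unfolding log_pow_simps(2) by (rule series_op_euler)
  then show ?case
    unfolding z w linear_op_zero[OF linear_op_series_op] by simp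
next
  case (Suc k)
  let ?w = "\<lambda>n. - 1 / of_nat n :: 'k" and ?Y = "series_op d B N (\<lambda>_. 1)"
  have w: "series_op d B N (\<lambda>n. ?w n * of_nat n) F u v = - ?Y F u v" for F
    by (simp add: series_op_def sum_negf)
  have "of_nat (X_degree u) * log_pow N (Suc (Suc k)) u v =
     series_op d B N ?w (\<lambda>u v. of_nat (X_degree u) * log_pow N (Suc k) u v) u v
     + series_op d B N (\<lambda>n. ?w n * of_nat n) (log_pow N (Suc k)) u v"
    unfolding log_pow_simps(2)[of N "Suc k"] by (rule series_op_euler)
  also have "series_op d B N ?w (\<lambda>u v. of_nat (X_degree u) * log_pow N (Suc k) u v) u v
     = - of_nat (Suc k) * series_op d B N ?w (?Y (log_pow N k)) u v"
    unfolding Suc.IH by (rule fun_cong[OF fun_cong[OF linear_op_scale[OF linear_op_series_op]]])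
  also have "series_op d B N ?w (?Y (log_pow N k)) u v = ?Y (log_pow N (Suc k)) u v"
    unfolding log_pow_simps by (rule series_op_commute)
  also have "- of_nat (Suc k) * ?Y (log_pow N (Suc k)) u v
      + series_op d B N (\<lambda>n. ?w n * of_nat n) (log_pow N (Suc k)) u v
      = - of_nat (Suc (Suc k)) * ?Y (log_pow N (Suc k)) u v"
    unfolding w by (simp add: algebra_simps)
  finally show ?case .
qed

text \<open>
  The exponential and the cocycle satisfy the same Euler equation, which determines every coordinate of
  positive \<open>X\<close>-degree from those of smaller degree (here the characteristic must be zero); in degree
  zero both are the unit.
\<close>

lemma exp_log_eq_cocycle:
  assumes "X_degree u \<le> M" "M \<le> N"
  shows "(\<Sum>k\<le>M. log_pow N k u v / fact k) = cocycle d B u v"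
  using assms
proof (induction "X_degree u" arbitrary: u v M rule: less_induct)
  case less
  let ?Y = "series_op d B N (\<lambda>_. 1)" and ?D = "of_nat (X_degree u) :: 'k"
  show ?case
  proof (cases "X_degree u = 0")
    case True
    have "cocycle d B u v = T_one u * T_one v"
    proof (induction v)
      case (Cons b v)
      have "lmult d B (GenX \<tau>) f u = 0" for \<tau> f
        using lmult_X_degree[of d B \<tau> f u] True by auto
      then show ?case using Cons by (cases b) (simp_all add: T_one_Cons)
    qed simp
    moreover have "(\<Sum>k\<le>M. log_pow N k u v / fact k) = log_pow N 0 u v"
    proof -
      have "(\<Sum>k\<le>M. log_pow N k u v / fact k) = (\<Sum>k\<in>{0}. log_pow N k u v / fact k)"
        using True by (intro sum.mono_neutral_right) (auto simp: log_pow_degree)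
      then show ?thesis by simp
    qed
    ultimately show ?thesis by (simp add: log_pow_simps)
  next
    case False
    then obtain M' where M: "M = Suc M'" using less.prems by (cases M) auto
    have "?D * (\<Sum>k\<le>M. log_pow N k u v / fact k) = (\<Sum>k\<le>M. ?D * log_pow N k u v / fact k)"
      by (simp add: sum_distrib_left)
    also have "\<dots> = ?D * log_pow N 0 u v + (\<Sum>k\<le>M'. ?D * log_pow N (Suc k) u v / fact (Suc k))"
      unfolding M by (subst sum.atMost_Suc_shift) simp
    also have "?D * log_pow N 0 u v = 0"
      using False T_one_X_degree[of u] by (auto simp: log_pow_simps)
    also have "(\<Sum>k\<le>M'. ?D * log_pow N (Suc k) u v / fact (Suc k))
        = - (\<Sum>k\<le>M'. 1 / fact k * ?Y (log_pow N k) u v)"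
    proof -
      have "?D * log_pow N (Suc k) u v / fact (Suc k) = - (1 / fact k * ?Y (log_pow N k) u v)" for k
      proof -
        have nz: "(of_nat (Suc k) :: 'k) \<noteq> 0" by (rule of_nat_neq_0)
        show ?thesis
          unfolding log_pow_euler fact_Suc using nz by (simp add: divide_simps del: of_nat_Suc)
      qed
      then show ?thesis by (simp add: sum_negf)
    qed
    also have "(\<Sum>k\<le>M'. 1 / fact k * ?Y (log_pow N k) u v)
        = ?Y (\<lambda>u v. \<Sum>k\<le>M'. 1 / fact k * log_pow N k u v) u v"
    proof -
      have "?Y (\<lambda>u v. \<Sum>k\<le>M'. 1 / fact k * log_pow N k u v)
          = (\<lambda>u v. \<Sum>k\<le>M'. 1 / fact k * ?Y (log_pow N k) u v)"
        by (rule linear_op_sum[OF linear_op_series_op]) simp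
      then show ?thesis by simp
    qed
    also have "\<dots> = ?Y (cocycle d B) u v"
    proof (rule series_op_degree_cong)
      fix u' v' assume "X_degree u' < X_degree u"
      then show "(\<Sum>k\<le>M'. 1 / fact k * log_pow N k u' v') = cocycle d B u' v'"
        using less.hyps[of u' M' v'] less.prems M by simp
    qed
    also have "0 + - ?Y (cocycle d B) u v = ?D * cocycle d B u v"
      using cocycle_euler[of u N v] less.prems by simp
    finally show ?thesis using False by simp
  qed
qed

end

section \<open>Identification with the exponential series\<close>

context fin_dim_assoc_algebra
begin

lemma X_mult_mset_eq:
  assumes "mset \<mu>s = mset \<nu>s" "set \<mu>s \<subseteq> {..<d}"
  shows "X_mult d B \<mu>s = X_mult d B \<nu>s"
proof -
  have "fold (\<lambda>\<mu>. lmult d B (GenX \<mu>)) (rev \<mu>s) = fold (\<lambda>\<mu>. lmult d B (GenX \<mu>)) (rev \<nu>s)"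
    by (rule fold_multiset_equiv)
       (use assms in \<open>auto simp: fun_eq_iff subset_iff lmult_GenX_commute\<close>)
  then show ?thesis by (simp add: X_mult_def fun_eq_iff foldr_conv_fold)
qed

lemma X_monomial_eq_X_mult:
  assumes "set \<mu>s \<subseteq> {..<d}" "set u \<subseteq> rbasis d"
  shows "X_monomial d B (mset \<mu>s) u = X_mult d B \<mu>s T_one u"
proof -
  have *: "foldr (\<lambda>\<mu> t. phi_gen d B (GenX \<mu>) \<otimes>\<^bsub>T_alg d B\<^esub> t) \<nu>s \<one>\<^bsub>T_alg d B\<^esub> u = X_mult d B \<nu>s T_one u"
    if "set \<nu>s \<subseteq> {..<d}" "set u \<subseteq> rbasis d" for \<nu>s u
    using that
  proof (induction \<nu>s arbitrary: u)
    case (Cons \<nu> \<nu>s)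
    let ?t = "foldr (\<lambda>\<mu> t. phi_gen d B (GenX \<mu>) \<otimes>\<^bsub>T_alg d B\<^esub> t) \<nu>s \<one>\<^bsub>T_alg d B\<^esub>"
    have "(phi_gen d B (GenX \<nu>) \<otimes>\<^bsub>T_alg d B\<^esub> ?t) u = lmult d B (GenX \<nu>) ?t u"
      using Cons.prems by (simp add: T_alg_def basis_alg_def phi_gen_eq_lmult mul_lmult_T_one)
    also have "\<dots> = lmult d B (GenX \<nu>) (X_mult d B \<nu>s T_one) u"
      using Cons by (intro lmult_cong) auto
    finally show ?case by simp
  qed (simp add: T_alg_def basis_alg_def)
  have "set (sorted_list_of_multiset (mset \<mu>s)) = set \<mu>s"
    by (simp add: set_sorted_list_of_multiset)
  then have "X_monomial d B (mset \<mu>s) u = X_mult d B (sorted_list_of_multiset (mset \<mu>s)) T_one u"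
    using assms unfolding X_monomial_def by (intro *) auto
  then show ?thesis
    using X_mult_mset_eq[of \<mu>s "sorted_list_of_multiset (mset \<mu>s)"] assms by simp
qed

text \<open>
  The coefficients of \<open>- log (1 - x) = \<Sum>\<^sub>n\<^sub>\<ge>\<^sub>1 x\<^sup>n / n\<close> for \<open>x = X\<^sup>\<mu> \<otimes> H\<^sub>\<mu>\<close>, first for words in the \<open>X\<close> and
  then for their commutative monomials.  The component at \<open>H\<^sub>\<nu>\<close> is the series for \<open>X\<close>-tilde.
\<close>

definition log_coeff :: "nat \<Rightarrow> nat list \<Rightarrow> 'k"
  where "log_coeff \<nu> \<mu>s = prod_coeff d B \<mu>s \<nu> / of_nat (length \<mu>s)"

definition log_series :: "nat \<Rightarrow> nat multiset \<Rightarrow> 'k"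
  where "log_series \<nu> \<alpha> = (\<Sum>\<mu>s | mset \<mu>s = \<alpha>. log_coeff \<nu> \<mu>s)"

abbreviation short_words :: "nat \<Rightarrow> nat list set"
  where "short_words N \<equiv> {\<mu>s. set \<mu>s \<subseteq> {..<d} \<and> length \<mu>s \<le> N}"

lemma finite_short_words: "finite (short_words N)"
  by (rule finite_lists_length_le) simp

text \<open>
  Collecting words into commutative monomials does not change the value of the series, because
  the \<open>X\<^sup>\<mu>\<close> commute.
\<close>

lemma X_series_log_series:
  assumes "set u \<subseteq> rbasis d" "X_degree u \<le> N"
  shows "X_series d B (log_series \<nu>) u = (\<Sum>\<mu>s\<in>short_words N. log_coeff \<nu> \<mu>s * X_mult d B \<mu>s T_one u)"
proof -
  have "X_series d B (log_series \<nu>) u = (\<Sum>\<alpha>\<in>mset ` short_words N.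
      if set_mset \<alpha> \<subseteq> {..<d} then log_series \<nu> \<alpha> * X_monomial d B \<alpha> u else 0)"
    unfolding X_series_def
  proof (rule Sum_any_bounded)
    fix \<alpha> assume "(if set_mset \<alpha> \<subseteq> {..<d} then log_series \<nu> \<alpha> * X_monomial d B \<alpha> u else 0) \<noteq> 0"
    then have *: "set_mset \<alpha> \<subseteq> {..<d}" "X_monomial d B \<alpha> u \<noteq> 0" by (auto split: if_splits)
    obtain \<mu>s where "\<alpha> = mset \<mu>s" using ex_mset by metis
    then show "\<alpha> \<in> mset ` short_words N"
      using X_monomial_X_degree[OF *] * assms(2) by auto
  qed (simp add: finite_short_words)
  also have "\<dots> = (\<Sum>\<alpha>\<in>mset ` short_words N. \<Sum>\<mu>s\<in>{\<mu>s \<in> short_words N. mset \<mu>s = \<alpha>}.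
      log_coeff \<nu> \<mu>s * X_mult d B \<mu>s T_one u)"
  proof (rule sum.cong[OF refl])
    fix \<alpha> assume "\<alpha> \<in> mset ` short_words N"
    then have \<alpha>: "set_mset \<alpha> \<subseteq> {..<d}" "{\<mu>s. mset \<mu>s = \<alpha>} = {\<mu>s \<in> short_words N. mset \<mu>s = \<alpha>}"
      by (auto dest: mset_eq_setD mset_eq_length)
    have "log_coeff \<nu> \<mu>s * X_monomial d B \<alpha> u = log_coeff \<nu> \<mu>s * X_mult d B \<mu>s T_one u"
      if "\<mu>s \<in> {\<mu>s \<in> short_words N. mset \<mu>s = \<alpha>}" for \<mu>s
      using that X_monomial_eq_X_mult[OF _ assms(1), of \<mu>s] by auto
    then show "(if set_mset \<alpha> \<subseteq> {..<d} then log_series \<nu> \<alpha> * X_monomial d B \<alpha> u else 0)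
        = (\<Sum>\<mu>s\<in>{\<mu>s \<in> short_words N. mset \<mu>s = \<alpha>}. log_coeff \<nu> \<mu>s * X_mult d B \<mu>s T_one u)"
      using \<alpha>(1) by (simp only: if_True log_series_def \<alpha>(2) sum_distrib_right cong: sum.cong)
  qed
  also have "\<dots> = (\<Sum>\<mu>s\<in>short_words N. log_coeff \<nu> \<mu>s * X_mult d B \<mu>s T_one u)"
    by (rule sum.image_gen[OF finite_short_words, symmetric])
  finally show ?thesis .
qed

lemma mul_X_mult_T_one:
  assumes "set u \<subseteq> rbasis d" "set \<mu>s \<subseteq> {..<d}"
  shows "mul (X_mult d B \<mu>s T_one) f u = X_mult d B \<mu>s f u"
  using assms
proof (induction \<mu>s arbitrary: u)
  case (Cons \<mu> \<mu>s)
  have "mul (X_mult d B (\<mu> # \<mu>s) T_one) f u = lmult d B (GenX \<mu>) (mul (X_mult d B \<mu>s T_one) f) u"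
    using Cons.prems by (simp add: lmult_mul)
  also have "\<dots> = lmult d B (GenX \<mu>) (X_mult d B \<mu>s f) u"
    using Cons by (intro lmult_cong) auto
  finally show ?case by simp
qed (simp add: mul_T_one_left)

lemma sum_short_words:
  assumes "f [] = 0"
  shows "(\<Sum>\<mu>s\<in>short_words N. f \<mu>s) = (\<Sum>n\<in>{1..N}. \<Sum>\<mu>s\<in>idx_words d n. f \<mu>s)"
proof -
  have "(\<Sum>\<mu>s\<in>short_words N. f \<mu>s) = (\<Sum>\<mu>s\<in>(\<Union>n\<in>{0..N}. idx_words d n). f \<mu>s)"
    by (intro sum.cong) (auto simp: idx_words_def)
  also have "\<dots> = (\<Sum>n\<in>{0..N}. \<Sum>\<mu>s\<in>idx_words d n. f \<mu>s)"
    by (rule sum.UNION_disjoint) (auto simp: idx_words_def finite_lists_length_eq)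
  also have "\<dots> = (\<Sum>\<mu>s\<in>idx_words d 0. f \<mu>s) + (\<Sum>n\<in>{1..N}. \<Sum>\<mu>s\<in>idx_words d n. f \<mu>s)"
    by (simp add: sum.atLeast_Suc_atMost)
  also have "(\<Sum>\<mu>s\<in>idx_words d 0. f \<mu>s) = 0"
  proof -
    have "idx_words d 0 = {[]}" by (auto simp: idx_words_def)
    then show ?thesis using assms by simp
  qed
  finally show ?thesis by simp
qed

definition exponent :: "ridx list list \<Rightarrow> 'k"
  where "exponent W =
    - (\<Sum>\<nu><d. T_tensor (X_series d B (log_series \<nu>)) (phi_gen d B (GenH \<nu>)) W)"

text \<open>
  The generator \<open>H\<^sub>\<nu>\<close> acts on \<open>R\<^sup>\<otimes>\<^sup>k\<close> as the sum of the \<open>(H\<^sub>\<nu>)\<^sub>i\<close>, so multiplication by the exponent is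
  multiplication by \<open>- \<Sum>\<^sub>n p\<^sub>n / n = \<Sum>\<^sub>i log (1 - x\<^sub>i)\<close>.
\<close>

lemma exponent_mult:
  assumes "set u \<subseteq> rbasis d" "set v \<subseteq> rbasis d" "length u \<le> N"
  shows "mul2 exponent G [u, v] =
    series_op d B N (\<lambda>n. - 1 / of_nat n) (\<lambda>u v. G [u, v]) u v"
proof -
  let ?f = "\<lambda>\<nu> u. lmult d B (GenH \<nu>) (\<lambda>v. G [u, v]) v"
  have 1: "mul2
       (T_tensor (X_series d B (log_series \<nu>)) (phi_gen d B (GenH \<nu>))) G [u, v]
     = (\<Sum>\<mu>s\<in>short_words N. log_coeff \<nu> \<mu>s * X_mult d B \<mu>s (?f \<nu>) u)" if "\<nu> < d" for \<nu>
  proof -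
    have "mul2
       (T_tensor (X_series d B (log_series \<nu>)) (phi_gen d B (GenH \<nu>))) G [u, v]
      = mul (X_series d B (log_series \<nu>)) (\<lambda>u. mul (phi_gen d B (GenH \<nu>)) (\<lambda>v. G [u, v]) v) u"
      by (rule mul2_product) (simp add: T_tensor_def)
    also have "\<dots> = mul (\<lambda>u. \<Sum>\<mu>s\<in>short_words N. log_coeff \<nu> \<mu>s * X_mult d B \<mu>s T_one u) (?f \<nu>) u"
    proof (rule T.basis_mult_cong)
      fix u' assume "u' \<in> words u"
      then show "X_series d B (log_series \<nu>) u' =
          (\<Sum>\<mu>s\<in>short_words N. log_coeff \<nu> \<mu>s * X_mult d B \<mu>s T_one u')"
        using assms(3) X_degree_le_length[of u'] by (intro X_series_log_series) auto
    next
      fix u'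
      show "mul (phi_gen d B (GenH \<nu>)) (\<lambda>v. G [u', v]) v = ?f \<nu> u'"
        using assms(2) that by (simp add: phi_gen_eq_lmult mul_lmult_T_one)
    qed
    also have "\<dots> = (\<Sum>\<mu>s\<in>short_words N. log_coeff \<nu> \<mu>s * mul (X_mult d B \<mu>s T_one) (?f \<nu>) u)"
      by (rule T.basis_mult_sum_left)
    also have "\<dots> = (\<Sum>\<mu>s\<in>short_words N. log_coeff \<nu> \<mu>s * X_mult d B \<mu>s (?f \<nu>) u)"
      using assms(1) by (intro sum.cong refl) (simp add: mul_X_mult_T_one)
    finally show ?thesis .
  qed
  have "exponent = (\<lambda>W. \<Sum>\<nu><d. (- 1) * T_tensor (X_series d B (log_series \<nu>)) (phi_gen d B (GenH \<nu>)) W)"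
    by (simp add: exponent_def fun_eq_iff sum_negf)
  then have "mul2 exponent G [u, v]
      = (\<Sum>\<nu><d. (- 1) * (\<Sum>\<mu>s\<in>short_words N. log_coeff \<nu> \<mu>s * X_mult d B \<mu>s (?f \<nu>) u))"
    by (simp only: T2.basis_mult_sum_left) (simp add: 1)
  also have "\<dots> = (\<Sum>\<nu><d. (- 1) * (\<Sum>n\<in>{1..N}. \<Sum>\<mu>s\<in>idx_words d n. log_coeff \<nu> \<mu>s * X_mult d B \<mu>s (?f \<nu>) u))"
    by (subst sum_short_words) (simp_all add: log_coeff_def)
  also have "\<dots> = (\<Sum>\<nu><d. \<Sum>n\<in>{1..N}. \<Sum>\<mu>s\<in>idx_words d n. (- 1) * (log_coeff \<nu> \<mu>s * X_mult d B \<mu>s (?f \<nu>) u))"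
    by (simp only: sum_distrib_left)
  also have "\<dots> = (\<Sum>n\<in>{1..N}. \<Sum>\<mu>s\<in>idx_words d n. \<Sum>\<nu><d. (- 1) * (log_coeff \<nu> \<mu>s * X_mult d B \<mu>s (?f \<nu>) u))"
    by (rule trans[OF sum.swap sum.cong[OF refl sum.swap]])
  also have "\<dots> = series_op d B N (\<lambda>n. - 1 / of_nat n) (\<lambda>u v. G [u, v]) u v"
    unfolding series_op_def power_sum_op_def sum.cartesian_product[symmetric] sum_distrib_left
    by (intro sum.cong refl) (simp add: log_coeff_def idx_words_def)
  finally show ?thesis .
qed

lemma one_T_pow2: "\<one>\<^bsub>T_pow d B 2\<^esub> [u, v] = T_one u * T_one v"
  by (simp add: T_pow_def basis_alg_def)

lemma one_mult2:
  assumes "set u \<subseteq> rbasis d" "set v \<subseteq> rbasis d"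
  shows "mul2 \<one>\<^bsub>T_pow d B 2\<^esub> F [u, v] = F [u, v]"
  using assms by (simp add: mul2_product[of _ T_one T_one] one_T_pow2 mul_T_one_left)

lemma mult2_one:
  assumes "set u \<subseteq> rbasis d" "set v \<subseteq> rbasis d"
  shows "mul2 F \<one>\<^bsub>T_pow d B 2\<^esub> [u, v] = F [u, v]"
proof -
  have "mul (\<lambda>v. F [u1, v]) (\<lambda>v. T_one u2 * T_one v) v = F [u1, v] * T_one u2" for u1 u2
    using T.basis_mult_sum_right[of "\<lambda>v. F [u1, v]" "\<lambda>_. T_one u2" "\<lambda>_. T_one" "{()}" v]
      mul_T_one_right[OF assms(2)] by (simp add: mult.commute)
  then have "mul2 F \<one>\<^bsub>T_pow d B 2\<^esub> [u, v]
      = mul (\<lambda>u. F [u, v]) T_one u"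
    by (simp add: mul2_pair one_T_pow2 T.basis_mult_eq_sum[of _ _ u] mult_ac)
  then show ?thesis using mul_T_one_right[OF assms(1)] by simp
qed

text \<open>
  The powers are defined by multiplication from the right, while \<open>exponent_mult\<close> multiplies from the
  left.
\<close>

lemma pow_Suc2:
  assumes "set u \<subseteq> rbasis d" "set v \<subseteq> rbasis d"
  shows "(A [^]\<^bsub>T_pow d B 2\<^esub> Suc k) [u, v] =
    mul2 A (A [^]\<^bsub>T_pow d B 2\<^esub> k) [u, v]"
  using assms
proof (induction k arbitrary: u v)
  case 0
  have "A [^]\<^bsub>T_pow d B 2\<^esub> (0::nat) = \<one>\<^bsub>T_pow d B 2\<^esub>"
    by (simp add: nat_pow_def)
  moreover have "A [^]\<^bsub>T_pow d B 2\<^esub> Suc 0 =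
     mul2 \<one>\<^bsub>T_pow d B 2\<^esub> A"
    by (simp add: nat_pow_def T_pow_def basis_alg_def)
  ultimately show ?case using 0 by (simp add: one_mult2 mult2_one)
next
  case (Suc k)
  let ?p = "\<lambda>k. A [^]\<^bsub>T_pow d B 2\<^esub> (k::nat)"
  have S: "?p (Suc k) = mul2 (?p k) A" for k
    by (simp add: nat_pow_def T_pow_def basis_alg_def)
  have "?p (Suc (Suc k)) [u, v] = mul2 (?p (Suc k)) A [u, v]"
    by (simp only: S)
  also have "\<dots> = mul2 (mul2 A (?p k)) A [u, v]"
  proof (rule T2.basis_mult_cong)
    fix W assume "W \<in> listset (map words [u, v])"
    then obtain u' v' where "W = [u', v']" "set u' \<subseteq> rbasis d" "set v' \<subseteq> rbasis d"
      by (auto simp: set_Cons_def)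
    then show "?p (Suc k) W = mul2 A (?p k) W" using Suc.IH by simp
  qed simp
  also have "\<dots> = mul2 A (?p (Suc k)) [u, v]"
    by (simp only: T2.basis_mult_assoc S)
  finally show ?case .
qed

lemma exponent_pow:
  assumes "set u \<subseteq> rbasis d" "set v \<subseteq> rbasis d" "length u \<le> N"
  shows "(exponent [^]\<^bsub>T_pow d B 2\<^esub> k) [u, v] = log_pow N k u v"
  using assms
proof (induction k arbitrary: u v)
  case 0
  then show ?case by (simp add: nat_pow_def one_T_pow2 log_pow_simps)
next
  case (Suc k)
  have "(exponent [^]\<^bsub>T_pow d B 2\<^esub> Suc k) [u, v] = mul2 exponent (exponent [^]\<^bsub>T_pow d B 2\<^esub> k) [u, v]"
    using Suc.prems by (simp only: pow_Suc2)
  also have "\<dots> = mul2 exponent (\<lambda>W. log_pow N k (hd W) (last W)) [u, v]"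
  proof (rule T2.basis_mult_cong)
    fix W assume "W \<in> listset (map words [u, v])"
    then obtain u' v' where "W = [u', v']" "set u' \<subseteq> rbasis d" "set v' \<subseteq> rbasis d" "length u' = length u"
      by (auto simp: set_Cons_def)
    then show "(exponent [^]\<^bsub>T_pow d B 2\<^esub> k) W = log_pow N k (hd W) (last W)"
      using Suc by simp
  qed simp
  also have "\<dots> = log_pow N (Suc k) u v"
    using Suc.prems by (simp add: exponent_mult[of u v N] log_pow_simps)
  finally show ?case .
qed

lemma tensor_rconst_rbasis: "tensor_const (rconst d B) u v w \<noteq> 0 \<Longrightarrow> set w \<subseteq> rbasis d"
proof (induction w arbitrary: u v)
  case (Cons a w)
  then obtain i u' j v' where "u = i # u'" "v = j # v'"
    by (metis neq_Nil_conv tensor_const_Nil(2,3))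
  then show ?case
    using Cons rconst_rbasis[of d B i j a] by (auto simp: tensor_const_Cons)
qed simp

lemma tensor_tensor_rconst_rbasis:
  "tensor_const (tensor_const (rconst d B)) U V W \<noteq> 0 \<Longrightarrow> W \<in> lists (lists (rbasis d))"
proof (induction W arbitrary: U V)
  case (Cons a w)
  then obtain i u' j v' where "U = i # u'" "V = j # v'"
    by (metis neq_Nil_conv tensor_const_Nil(2,3))
  then show ?case
    using Cons tensor_rconst_rbasis[of i j a] by (auto simp: tensor_const_Cons)
qed simp

lemma pow_support:
  assumes A: "\<And>W. A W \<noteq> 0 \<Longrightarrow> length W = 2"
    and "(A [^]\<^bsub>T_pow d B 2\<^esub> (k::nat)) W \<noteq> 0"
  shows "W \<in> lists (lists (rbasis d)) \<and> length W = 2"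
proof (cases k)
  case 0
  then have "of_bool (length W = 2) * (\<Prod>w\<leftarrow>W. T_one w) \<noteq> (0::'k)"
    using assms(2) by (simp add: nat_pow_def T_pow_def basis_alg_def)
  then have "length W = 2" "\<forall>w\<in>set W. T_one w \<noteq> (0::'k)"
    by (auto simp: prod_list_zero_iff)
  then show ?thesis by (fastforce simp: T_one_def)
next
  case (Suc k)
  then have "mul2 (A [^]\<^bsub>T_pow d B 2\<^esub> k) A W \<noteq> 0"
    using assms(2) by (simp add: nat_pow_def T_pow_def basis_alg_def)
  then obtain U V where "A V \<noteq> 0" "tensor_const (tensor_const (rconst d B)) U V W \<noteq> 0"
    by (rule basis_mult_neq_0)
  then show ?thesis
    using A tensor_tensor_rconst_rbasis tensor_const_length by metis
qed

lemma T2_exp_exponent: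
  assumes "\<Phi> \<in> carrier (T_pow d B 2)"
    and "\<And>u v. set u \<subseteq> rbasis d \<Longrightarrow> set v \<subseteq> rbasis d \<Longrightarrow> \<Phi> [u, v] = cocycle d B u v"
  shows "\<Phi> = T2_exp d B exponent"
proof
  fix W
  show "\<Phi> W = T2_exp d B exponent W"
  proof (cases "W \<in> lists (lists (rbasis d)) \<and> length W = 2")
    case True
    then obtain u v where W: "W = [u, v]"
      by (auto simp: numeral_2_eq_2 length_Suc_conv)
    with True have uv: "set u \<subseteq> rbasis d" "set v \<subseteq> rbasis d"
      by auto
    let ?N = "length u"
    have "T2_exp d B exponent W = Sum_any (\<lambda>k. log_pow ?N k u v / fact k)"
      unfolding T2_exp_def W by (simp add: exponent_pow[OF uv order_refl])
    also have "\<dots> = (\<Sum>k\<le>?N. log_pow ?N k u v / fact k)"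
    proof (rule Sum_any_bounded)
      fix k assume "log_pow ?N k u v / fact k \<noteq> 0"
      then show "k \<in> {..?N}"
        using log_pow_degree[of u k ?N v] X_degree_le_length[of u] by (cases "X_degree u < k") auto
    qed simp
    also have "\<dots> = cocycle d B u v"
      by (rule exp_log_eq_cocycle) (auto simp: X_degree_le_length)
    finally show ?thesis using W uv assms(2) by simp
  next
    case False
    have len: "length W = 2" if nz: "exponent W \<noteq> 0" for W
    proof -
      have "(\<Sum>\<nu><d. T_tensor (X_series d B (log_series \<nu>)) (phi_gen d B (GenH \<nu>)) W) \<noteq> 0"
        using nz by (simp add: exponent_def)
      then obtain \<nu> where "T_tensor (X_series d B (log_series \<nu>)) (phi_gen d B (GenH \<nu>)) W \<noteq> 0"
        by (rule sum.not_neutral_contains_not_neutral)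
      then show ?thesis by (auto simp: T_tensor_def split: list.splits)
    qed
    have "(exponent [^]\<^bsub>T_pow d B 2\<^esub> k) W = 0" for k :: nat
      using pow_support[of exponent k W, OF len] False by metis
    moreover have "\<Phi> W = 0"
      using assms(1) False by (auto simp: T_pow_def basis_alg_def)
    ultimately show ?thesis by (simp add: T2_exp_def)
  qed
qed

end

section \<open>Membership in the tensor product of the enveloping algebras\<close>

lemma lmult_length_cong:
  assumes "\<And>u. length u = length w \<Longrightarrow> f u = g u"
  shows "lmult d B x f w = lmult d B x g w"
  using assms
proof (induction w arbitrary: f g)
  case (Cons a w)
  have "lmult d B x (\<lambda>v. f (a # v)) w = lmult d B x (\<lambda>v. g (a # v)) w"
    using Cons.prems by (intro Cons.IH) simp
  then show ?case using Cons.prems by simp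
qed simp

lemma lmult_support:
  assumes "\<And>u. \<not> set u \<subseteq> rbasis d \<Longrightarrow> f u = 0" "\<not> set w \<subseteq> rbasis d"
  shows "lmult d B x f w = 0"
  using assms
proof (induction w arbitrary: f)
  case (Cons a w)
  show ?case
  proof (cases "a \<in> rbasis d")
    case True
    then have "lmult d B x (\<lambda>v. f (a # v)) w = 0"
      using Cons by (intro Cons.IH) auto
    then show ?thesis using Cons.prems True by simp
  next
    case False
    then have "f (a # v) = 0" for v using Cons.prems(1)[of "a # v"] by simp
    then show ?thesis using False by (simp add: rconst_def lmult_zero)
  qed
qed simp

lemma cocycle_support_left:
  assumes "\<not> set u \<subseteq> rbasis d"
  shows "cocycle d B u v = 0"
  using assms
proof (induction v arbitrary: u)
  case Nil
  have "Ehat \<in> rbasis d" by simp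
  then show ?case using Nil by (auto simp: T_one_def)
next
  case (Cons b v)
  then show ?case by (cases b) (simp_all add: lmult_support)
qed

lemma phi_free_scale:
  assumes "bounded_supp d N h"
  shows "phi_free d B (\<lambda>w. c * h w) = (\<lambda>w. c * phi_free d B h w)"
proof
  fix w
  have "bounded_supp d N (\<lambda>_. 0 :: 'a)" by (simp add: bounded_supp_def)
  then show "phi_free d B (\<lambda>w. c * h w) w = c * phi_free d B h w"
    using phi_free_lin[of d N "\<lambda>_. 0" h B c w] assms by (simp add: phi_free_zero)
qed

context fin_dim_assoc_algebra
begin

lemma cocycle_support_right:
  assumes "\<not> set v \<subseteq> rbasis d"
  shows "cocycle d B u v = 0"
  using assms
proof (induction v arbitrary: u)
  case (Cons b v)
  show ?case
  proof (cases "set v \<subseteq> rbasis d")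
    case True
    then show ?thesis using Cons.prems by (cases b) (simp_all add: lmult_GenX_out)
  next
    case False
    then show ?thesis using Cons.IH by (cases b) (simp_all add: lmult_zero)
  qed
qed simp

text \<open>
  The image in \<open>T(R)\<close> of the subalgebra of the enveloping algebra that is generated by \<open>G\<close>.
\<close>

definition env_image :: "gen set \<Rightarrow> (ridx list \<Rightarrow> 'k) set"
  where "env_image G = phi_free d B ` free_alg G"

lemma phi_image_uea_class:
  assumes "G \<subseteq> lie_basis d"
  shows "phi d B ` uea_class d B ` free_alg G = env_image G"
proof -
  have "free_alg G \<subseteq> (free_alg (lie_basis d) :: (gen list \<Rightarrow> 'k) set)"
    using assms by (fastforce simp: free_alg_def)
  then show ?thesis
    unfolding env_image_def image_image by (intro image_cong refl phi_uea_class) auto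
qed

lemma env_image_T_one: "T_one \<in> env_image G"
proof -
  have "word [] \<in> (free_alg G :: (gen list \<Rightarrow> 'k) set)"
    by (simp add: free_alg_def word_def)
  then show ?thesis
    unfolding env_image_def using phi_free_word_Nil[of d B] by (metis imageI)
qed

lemma env_image_scale:
  assumes "f \<in> env_image G" "G \<subseteq> lie_basis d"
  shows "(\<lambda>w. c * f w) \<in> env_image G"
proof -
  obtain h where h: "h \<in> free_alg G" "f = phi_free d B h"
    using assms(1) by (auto simp: env_image_def)
  have "h \<in> free_alg (lie_basis d)" using h(1) assms(2) by (fastforce simp: free_alg_def)
  then obtain N where N: "bounded_supp d N h" using free_alg_bounded_supp by blast
  have "{w. c * h w \<noteq> 0} \<subseteq> {w. h w \<noteq> 0}" by auto
  then have "(\<lambda>w. c * h w) \<in> free_alg G"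
    using h(1) by (auto simp: free_alg_def intro: finite_subset)
  then show ?thesis
    unfolding env_image_def h(2) phi_free_scale[OF N, symmetric] by (rule imageI)
qed

lemma env_image_lmult:
  assumes "f \<in> env_image G" "G \<subseteq> lie_basis d" "x \<in> G"
  shows "lmult d B x f \<in> env_image G"
proof -
  obtain h where h: "h \<in> free_alg G" "f = phi_free d B h"
    using assms(1) by (auto simp: env_image_def)
  have "h \<in> free_alg (lie_basis d)" using h(1) assms(2) by (fastforce simp: free_alg_def)
  then obtain N where N: "bounded_supp d N h" using free_alg_bounded_supp by blast
  have "{w. prepend x h w \<noteq> 0} \<subseteq> Cons x ` {w. h w \<noteq> 0}"
  proof
    fix w assume "w \<in> {w. prepend x h w \<noteq> 0}"
    then show "w \<in> Cons x ` {w. h w \<noteq> 0}"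
      by (cases w) (auto simp: prepend_def split: if_splits)
  qed
  then have "finite {w. prepend x h w \<noteq> 0}"
    using h(1) by (auto simp: free_alg_def intro: finite_subset)
  moreover have "set w \<subseteq> G" if "prepend x h w \<noteq> 0" for w
    using that h(1) assms(3) by (auto simp: free_alg_def prepend_def split: list.splits if_splits)
  ultimately have "prepend x h \<in> free_alg G" by (simp add: free_alg_def)
  moreover have "lmult d B x f = phi_free d B (prepend x h)"
    using phi_free_prepend[OF N, of x B] assms(2,3) unfolding h(2) by (auto simp: fun_eq_iff)
  ultimately show ?thesis by (auto simp: env_image_def)
qed

abbreviation "genX \<equiv> GenX ` {..<d}"
abbreviation "genH \<equiv> GenH ` {..<d}"

text \<open>
  Membership of one component in the algebraic tensor product of the images of \<open>U(L\<^sup>*)\<close> and \<open>U(L)\<close>,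
  stated without truncation of the factors so that it is visibly preserved by \<open>lmult\<close>.
\<close>

definition env_tensor :: "nat \<Rightarrow> nat \<Rightarrow> (ridx list \<Rightarrow> ridx list \<Rightarrow> 'k) \<Rightarrow> bool"
  where "env_tensor m n F \<longleftrightarrow> (\<exists>(r::nat) f g.
    (\<forall>i<r. f i \<in> env_image genX \<and> g i \<in> env_image genH) \<and>
    (\<forall>u v. length u = m \<longrightarrow> length v = n \<longrightarrow> F u v = (\<Sum>i<r. f i u * g i v)))"

lemma env_tensor_zero: "env_tensor m n (\<lambda>u v. 0)"
  unfolding env_tensor_def by (intro exI[of _ 0]) simp

lemma env_tensor_one: "env_tensor m n (\<lambda>u v. T_one u * T_one v)"
  unfolding env_tensor_def
  by (rule exI[of _ 1], rule exI[of _ "\<lambda>_. T_one"], rule exI[of _ "\<lambda>_. T_one"]) (simp add: env_image_T_one)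

lemma env_tensor_lin:
  assumes "env_tensor m n F" "env_tensor m n G"
  shows "env_tensor m n (\<lambda>u v. F u v + c * G u v)"
proof -
  obtain r f g where F: "\<forall>i<(r::nat). f i \<in> env_image genX \<and> g i \<in> env_image genH"
      "\<forall>u v. length u = m \<longrightarrow> length v = n \<longrightarrow> F u v = (\<Sum>i<r. f i u * g i v)"
    using assms(1) unfolding env_tensor_def by blast
  obtain r' f' g' where G: "\<forall>i<(r'::nat). f' i \<in> env_image genX \<and> g' i \<in> env_image genH"
      "\<forall>u v. length u = m \<longrightarrow> length v = n \<longrightarrow> G u v = (\<Sum>i<r'. f' i u * g' i v)"
    using assms(2) unfolding env_tensor_def by blast
  define f'' where "f'' i = (if i < r then f i else (\<lambda>u. c * f' (i - r) u))" for i
  define g'' where "g'' i = (if i < r then g i else g' (i - r))" for i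
  have "genX \<subseteq> lie_basis d" by auto
  then have mem: "\<forall>i<r + r'. f'' i \<in> env_image genX \<and> g'' i \<in> env_image genH"
    using F(1) G(1) env_image_scale[of _ genX c] by (auto simp: f''_def g''_def)
  have sum: "(\<Sum>i<r + r'. f'' i u * g'' i v) = (\<Sum>i<r. f i u * g i v) + c * (\<Sum>i<r'. f' i u * g' i v)"
    for u v
  proof -
    have "(\<Sum>i<r + r'. f'' i u * g'' i v)
        = (\<Sum>i<r. f'' i u * g'' i v) + (\<Sum>i<r'. f'' (r + i) u * g'' (r + i) v)"
      by (induction r') (simp_all add: add.assoc)
    then show ?thesis by (simp add: f''_def g''_def sum_distrib_left mult.assoc)
  qed
  have "\<forall>u v. length u = m \<longrightarrow> length v = n \<longrightarrow>
      F u v + c * G u v = (\<Sum>i<r + r'. f'' i u * g'' i v)"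
    unfolding sum using F(2) G(2) by simp
  with mem show ?thesis
    unfolding env_tensor_def by blast
qed

lemma env_tensor_sum:
  assumes "finite S" "\<And>i. i \<in> S \<Longrightarrow> env_tensor m n (F i)"
  shows "env_tensor m n (\<lambda>u v. \<Sum>i\<in>S. c i * F i u v)"
  using assms
proof (induction S rule: finite_induct)
  case (insert i S)
  then show ?case
    using env_tensor_lin[of m n "\<lambda>u v. \<Sum>i\<in>S. c i * F i u v" "F i" "c i"] by (simp add: add.commute)
qed (simp add: env_tensor_zero)

lemma env_tensor_lmult_left:
  assumes "env_tensor m n F" "\<sigma> < d"
  shows "env_tensor m n (\<lambda>u v. lmult d B (GenX \<sigma>) (\<lambda>u. F u v) u)"
proof -
  obtain r f g where F: "\<forall>i<(r::nat). f i \<in> env_image genX \<and> g i \<in> env_image genH"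
      "\<forall>u v. length u = m \<longrightarrow> length v = n \<longrightarrow> F u v = (\<Sum>i<r. f i u * g i v)"
    using assms(1) unfolding env_tensor_def by blast
  have "lmult d B (GenX \<sigma>) (\<lambda>u. F u v) u = (\<Sum>i<r. lmult d B (GenX \<sigma>) (f i) u * g i v)"
    if "length u = m" "length v = n" for u v
  proof -
    have "lmult d B (GenX \<sigma>) (\<lambda>u. F u v) u = lmult d B (GenX \<sigma>) (\<lambda>u. \<Sum>i<r. g i v * f i u) u"
      using F(2) that by (intro lmult_length_cong) (simp add: mult.commute)
    also have "\<dots> = (\<Sum>i<r. g i v * lmult d B (GenX \<sigma>) (f i) u)"
      by (rule lmult_sum) simp
    finally show ?thesis by (simp add: mult.commute)
  qed
  moreover have "lmult d B (GenX \<sigma>) (f i) \<in> env_image genX" if "i < r" for i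
    using F(1) that assms(2) by (intro env_image_lmult) auto
  ultimately show ?thesis
    unfolding env_tensor_def using F(1)
    by (intro exI[of _ r] exI[of _ "\<lambda>i. lmult d B (GenX \<sigma>) (f i)"] exI[of _ g]) simp
qed

lemma env_tensor_lmult_right:
  assumes "env_tensor m n F" "\<sigma> < d"
  shows "env_tensor m n (\<lambda>u v. lmult d B (GenH \<sigma>) (F u) v)"
proof -
  obtain r f g where F: "\<forall>i<(r::nat). f i \<in> env_image genX \<and> g i \<in> env_image genH"
      "\<forall>u v. length u = m \<longrightarrow> length v = n \<longrightarrow> F u v = (\<Sum>i<r. f i u * g i v)"
    using assms(1) unfolding env_tensor_def by blast
  have "lmult d B (GenH \<sigma>) (F u) v = (\<Sum>i<r. f i u * lmult d B (GenH \<sigma>) (g i) v)"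
    if "length u = m" "length v = n" for u v
  proof -
    have "lmult d B (GenH \<sigma>) (F u) v = lmult d B (GenH \<sigma>) (\<lambda>v. \<Sum>i<r. f i u * g i v) v"
      using F(2) that by (intro lmult_length_cong) simp
    then show ?thesis by (simp add: lmult_sum)
  qed
  moreover have "lmult d B (GenH \<sigma>) (g i) \<in> env_image genH" if "i < r" for i
    using F(1) that assms(2) by (intro env_image_lmult) auto
  ultimately show ?thesis
    unfolding env_tensor_def using F(1)
    by (intro exI[of _ r] exI[of _ f] exI[of _ "\<lambda>i. lmult d B (GenH \<sigma>) (g i)"]) simp
qed

lemma env_tensor_X_mult:
  assumes "env_tensor m n F" "set \<mu>s \<subseteq> {..<d}"
  shows "env_tensor m n (\<lambda>u v. X_mult d B \<mu>s (\<lambda>u. F u v) u)"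
  using assms(2)
proof (induction \<mu>s)
  case (Cons \<mu> \<mu>s)
  then show ?case
    using env_tensor_lmult_left[of m n "\<lambda>u v. X_mult d B \<mu>s (\<lambda>u. F u v) u" \<mu>] by simp
qed (use assms(1) in simp)

lemma env_tensor_series_op:
  assumes "env_tensor m n F"
  shows "env_tensor m n (series_op d B N w F)"
proof -
  have "env_tensor m n (\<lambda>u v. X_mult d B \<mu>s (\<lambda>u. lmult d B (GenH \<nu>) (F u) v) u)"
    if "\<mu>s \<in> idx_words d k" "\<nu> < d" for \<mu>s \<nu> k
    using that assms by (intro env_tensor_X_mult env_tensor_lmult_right) (auto simp: idx_words_def)
  then have "env_tensor m n (\<lambda>u v. \<Sum>p\<in>idx_words d k \<times> {..<d}. prod_coeff d B (fst p) (snd p) *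
      X_mult d B (fst p) (\<lambda>u. lmult d B (GenH (snd p)) (F u) v) u)" for k
    by (intro env_tensor_sum) auto
  then have "env_tensor m n (power_sum_op d B k F)" for k
    by (simp add: power_sum_op_def[abs_def] split_def)
  then show ?thesis
    unfolding series_op_def[abs_def] by (intro env_tensor_sum) auto
qed

lemma env_tensor_log_pow: "env_tensor m n (log_pow N k)"
  by (induction k) (simp_all add: log_pow_simps env_tensor_one env_tensor_series_op)

text \<open>
  On first words of length \<open>m\<close> the exponential series is a finite sum, and each of its terms is obtained
  from the unit by multiplications with \<open>X\<close> on the left and \<open>H\<close> on the right tensor factor.
\<close>

lemma env_tensor_cocycle: "env_tensor m n (cocycle d B)"
proof -
  have "env_tensor m n (\<lambda>u v. \<Sum>k\<le>m. 1 / fact k * log_pow m k u v)"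
    by (intro env_tensor_sum env_tensor_log_pow) simp
  moreover have "(\<Sum>k\<le>m. 1 / fact k * log_pow m k u v) = cocycle d B u v" if "length u = m" for u v
    using exp_log_eq_cocycle[of u m m v] X_degree_le_length[of u] that by simp
  ultimately show ?thesis
    unfolding env_tensor_def by simp
qed

lemma env_tensor_imp_tensor_subspace:
  assumes "env_tensor m n F" "\<And>u v. \<Phi> [u, v] = F u v"
  shows "T2_proj m n \<Phi> \<in> tensor_subspace (T_proj m ` env_image genX) (T_proj n ` env_image genH)"
proof -
  obtain r f g where F: "\<forall>i<(r::nat). f i \<in> env_image genX \<and> g i \<in> env_image genH"
      "\<forall>u v. length u = m \<longrightarrow> length v = n \<longrightarrow> F u v = (\<Sum>i<r. f i u * g i v)"
    using assms(1) unfolding env_tensor_def by blast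
  have "T2_proj m n \<Phi> = (\<lambda>W. \<Sum>i<r. T_tensor (T_proj m (f i)) (T_proj n (g i)) W)"
  proof
    fix W
    show "T2_proj m n \<Phi> W = (\<Sum>i<r. T_tensor (T_proj m (f i)) (T_proj n (g i)) W)"
    proof (cases "map length W = [m, n]")
      case True
      then obtain u v where "W = [u, v]" "length u = m" "length v = n" by auto
      then show ?thesis using F(2) assms(2) by (simp add: T2_proj_def T_tensor_def T_proj_def)
    next
      case False
      then have "T_tensor (T_proj m (f i)) (T_proj n (g i)) W = 0" for i
        by (auto simp: T_tensor_def T_proj_def split: list.splits)
      then show ?thesis using False by (simp add: T2_proj_def)
    qed
  qed
  then show ?thesis
    unfolding tensor_subspace_def using F(1)
    by (intro CollectI exI[of _ r] exI[of _ "\<lambda>i. T_proj m (f i)"]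
        exI[of _ "\<lambda>i. T_proj n (g i)"]) auto
qed

end

theorem theorem2:
  fixes scale :: "'k::field_char_0 \<Rightarrow> 'l::ring \<Rightarrow> 'l"
    and d :: nat
    and H :: "nat \<Rightarrow> 'l"
    and B :: "nat \<Rightarrow> nat \<Rightarrow> nat \<Rightarrow> 'k"
    and \<Phi> :: "ridx list list \<Rightarrow> 'k"
  assumes L: "fin_dim_assoc_algebra scale d H B"
    and invertible: "\<Phi> \<in> Units (T_pow d B 2)"
    and normalized: "normalized \<Phi>"
    and twisting: "twisting_equation d B \<Phi>"
    and expands: "expands_Phi11 d B \<Phi>"
  shows "(\<forall>m n. T2_proj m n \<Phi> \<in>
            tensor_subspace (T_proj m ` phi d B ` U_Ldual d B) (T_proj n ` phi d B ` U_L d B)) \<and>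
         (\<exists>p :: nat \<Rightarrow> nat multiset \<Rightarrow> 'k.
            (\<forall>\<nu><d. p \<nu> {#} = 0) \<and>
            \<Phi> = T2_exp d B
              (\<lambda>W. - (\<Sum>\<nu><d. T_tensor (X_series d B (p \<nu>)) (phi_gen d B (GenH \<nu>)) W)))"
proof -
  interpret fin_dim_assoc_algebra scale d H B by (rule L)
  have carrier: "\<Phi> \<in> carrier (T_pow d B 2)"
    using invertible by (simp add: Units_def)
  have \<Phi>: "\<Phi> [u, v] = cocycle d B u v" if "set u \<subseteq> rbasis d" "set v \<subseteq> rbasis d" for u v
    using twisting_solution[OF normalized twisting expands that] .
  show ?thesis
  proof (intro conjI allI exI[of _ log_series])
    fix m n
    have "\<Phi> [u, v] = cocycle d B u v" for u v
    proof (cases "set u \<subseteq> rbasis d \<and> set v \<subseteq> rbasis d")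
      case False
      then have "[u, v] \<notin> lists (lists (rbasis d))"
        by auto
      then have "\<Phi> [u, v] = 0"
        using carrier unfolding T_pow_def basis_alg_def by fastforce
      then show ?thesis
        using False cocycle_support_left cocycle_support_right by metis
    qed (simp add: \<Phi>)
    then have "T2_proj m n \<Phi> \<in> tensor_subspace (T_proj m ` env_image genX) (T_proj n ` env_image genH)"
      by (rule env_tensor_imp_tensor_subspace[OF env_tensor_cocycle])
    moreover have "genX \<subseteq> lie_basis d" "genH \<subseteq> lie_basis d" by auto
    ultimately show "T2_proj m n \<Phi> \<in>
        tensor_subspace (T_proj m ` phi d B ` U_Ldual d B) (T_proj n ` phi d B ` U_L d B)"
      by (simp add: U_Ldual_def U_L_def phi_image_uea_class)
  next
    show "\<nu> < d \<longrightarrow> log_series \<nu> {#} = 0" for \<nu>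
      by (simp add: log_series_def log_coeff_def)
    have "\<Phi> = T2_exp d B exponent"
      by (rule T2_exp_exponent[OF carrier \<Phi>])
    then show "\<Phi> = T2_exp d B
        (\<lambda>W. - (\<Sum>\<nu><d. T_tensor (X_series d B (log_series \<nu>)) (phi_gen d B (GenH \<nu>)) W))"
      by (simp add: exponent_def[abs_def])
  qed
qed

end
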